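(* Let $\Sigma$ be a connected Riemann surface and let $f\colon\Sigma\to\mathbf{C}^{2}$ be a conformal minimal Lagrangian immersion whose induced metric is complete and whose image is not a Lagrangian plane. Then the first component $g\colon\Sigma\to\overline{\mathbf{C}}$ of the Gauss map of $f$ can omit at most $3$ values in $\overline{\mathbf{C}}$.
   Context: $\overline{\mathbf{C}}=\mathbf{C}\cup\{\infty\}$ is the Riemann sphere. The Lagrangian angle of a minimal Lagrangian surface in $\mathbf{C}^2$ is a constant $\beta\in\mathbf{R}/2\pi\mathbf{Z}$. By a known representation theorem, every conformal minimal Lagrangian immersion $f\colon\Sigma\to\mathbf{C}^2$ with Lagrangian angle $\beta$ is, up to congruence, of the form $$f=\frac{1}{\sqrt{2}}e^{\sqrt{-1}\,\beta/2}\bigl(F_{1}-\sqrt{-1}\,\overline{F_{2}},\;F_{2}+\sqrt{-1}\,\overline{F_{1}}\bigr),$$ where $F=(F_{1},F_{2})\colon\Sigma\to\mathbf{C}^{2}$ is a holomorphic map such that, with $S_{1}:=dF_{2}/dz$ and $S_{2}:=-dF_{1}/dz$ for a local complex coordinate $z$, one has $|S_{1}|^{2}+|S_{2}|^{2}\neq0$ everywhere; conversely every such $F$ gives a conformal minimal Lagrangian immersion. The induced metric is $ds^{2}=(|S_{1}|^{2}+|S_{2}|^{2})|dz|^{2}$. Setting $g:=-S_{2}/S_{1}$ (a meromorphic function on $\Sigma$, i.e. a holomorphic map to $\overline{\mathbf{C}}$, independent of the choice of $z$), the map $G=(g,e^{\sqrt{-1}\beta})\colon\Sigma\to\overline{\mathbf{C}}\times\overline{\mathbf{C}}$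 is the Gauss map of the surface in $\mathbf{R}^4=\mathbf{C}^2$, and $g$ is its first component. A map omits a value if it never attains it. *)

theory Defs
  imports "HOL-Analysis.Analysis"
begin

section \<open>Riemann surfaces\<close>

text \<open>A chart is a pair of its domain and its coordinate map. The coordinate map is total;
  only its values on the domain matter. The atlas \<open>A\<close> need not be maximal.
  Connectedness and nonemptiness are stated separately. Second countability is not required
  (it is automatic for connected Riemann surfaces).\<close>

type_synonym 'a chart = "'a set \<times> ('a \<Rightarrow> complex)"

definition in_chart :: "'a chart \<Rightarrow> ('a \<Rightarrow> 'b) \<Rightarrow> complex \<Rightarrow> 'b" where
  "in_chart c h = h \<circ> inv_into (fst c) (snd c)"

definition riemann_surface :: "'a topology \<Rightarrow> 'a chart set \<Rightarrow> bool" where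
  "riemann_surface X A \<longleftrightarrow>
     Hausdorff_space X \<and>
     \<Union> (fst ` A) = topspace X \<and>
     (\<forall>(U, \<phi>) \<in> A. openin X U \<and> open (\<phi> ` U) \<and>
        homeomorphic_map (subtopology X U) (top_of_set (\<phi> ` U)) \<phi>) \<and>
     (\<forall>(U, \<phi>) \<in> A. \<forall>(V, \<psi>) \<in> A. (in_chart (U, \<phi>) \<psi>) holomorphic_on \<phi> ` (U \<inter> V))"


section \<open>Differential geometry of maps from a surface into a Euclidean space\<close>

definition Dx :: "(complex \<Rightarrow> 'b::real_normed_vector) \<Rightarrow> complex \<Rightarrow> 'b" where
  "Dx h z = frechet_derivative h (at z) 1"

definition Dy :: "(complex \<Rightarrow> 'b::real_normed_vector) \<Rightarrow> complex \<Rightarrow> 'b" where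
  "Dy h z = frechet_derivative h (at z) \<i>"

primrec Ck_on :: "nat \<Rightarrow> complex set \<Rightarrow> (complex \<Rightarrow> 'b::real_normed_vector) \<Rightarrow> bool" where
  "Ck_on 0 S h \<longleftrightarrow> continuous_on S h"
| "Ck_on (Suc k) S h \<longleftrightarrow>
     (\<forall>z\<in>S. h differentiable (at z)) \<and> Ck_on k S (Dx h) \<and> Ck_on k S (Dy h)"

text \<open>A pointwise condition on local expressions, imposed in every chart at every point.\<close>

definition in_all_charts ::
    "'a chart set \<Rightarrow> ('a \<Rightarrow> 'b) \<Rightarrow> ((complex \<Rightarrow> 'b) \<Rightarrow> complex \<Rightarrow> bool) \<Rightarrow> bool" where
  "in_all_charts A f P \<longleftrightarrow> (\<forall>c \<in> A. \<forall>p \<in> fst c. P (in_chart c f) (snd c p))"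

definition smooth_map :: "'a chart set \<Rightarrow> ('a \<Rightarrow> 'b::real_normed_vector) \<Rightarrow> bool" where
  "smooth_map A f \<longleftrightarrow> (\<forall>c \<in> A. \<forall>k. Ck_on k (snd c ` fst c) (in_chart c f))"

definition immersion :: "'a chart set \<Rightarrow> ('a \<Rightarrow> 'b::real_normed_vector) \<Rightarrow> bool" where
  "immersion A f \<longleftrightarrow> smooth_map A f \<and>
     in_all_charts A f (\<lambda>h z. inj (frechet_derivative h (at z)))"

definition conformal :: "'a chart set \<Rightarrow> ('a \<Rightarrow> 'b::euclidean_space) \<Rightarrow> bool" where
  "conformal A f \<longleftrightarrow>
     in_all_charts A f (\<lambda>h z. Dx h z \<bullet> Dx h z = Dy h z \<bullet> Dy h z \<and> Dx h z \<bullet> Dy h z = 0)"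

text \<open>Squared area density \<open>EG - F\<^sup>2\<close> of the induced metric.\<close>

definition gram :: "(complex \<Rightarrow> 'b::euclidean_space) \<Rightarrow> complex \<Rightarrow> real" where
  "gram h z = (Dx h z \<bullet> Dx h z) * (Dy h z \<bullet> Dy h z) - (Dx h z \<bullet> Dy h z)\<^sup>2"

text \<open>Orthogonal projection onto the normal space; \<open>closest_point\<close> on the tangent plane is the
  tangential projection.\<close>

definition normal_part :: "(complex \<Rightarrow> 'b::euclidean_space) \<Rightarrow> complex \<Rightarrow> 'b \<Rightarrow> 'b" where
  "normal_part h z w = w - closest_point (span {Dx h z, Dy h z}) w"

text \<open>The mean curvature vector is half the trace, with respect to the induced metric, of the
  second fundamental form \<open>B(\<partial>\<^sub>i, \<partial>\<^sub>j) = (\<partial>\<^sub>i\<partial>\<^sub>j h)\<^sup>\<bottom>\<close>.\<close>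

definition mean_curvature :: "(complex \<Rightarrow> 'b::euclidean_space) \<Rightarrow> complex \<Rightarrow> 'b" where
  "mean_curvature h z = (1 / (2 * gram h z)) *\<^sub>R
     ((Dy h z \<bullet> Dy h z) *\<^sub>R normal_part h z (Dx (Dx h) z)
      - (2 * (Dx h z \<bullet> Dy h z)) *\<^sub>R normal_part h z (Dy (Dx h) z)
      + (Dx h z \<bullet> Dx h z) *\<^sub>R normal_part h z (Dy (Dy h) z))"

definition minimal :: "'a chart set \<Rightarrow> ('a \<Rightarrow> 'b::euclidean_space) \<Rightarrow> bool" where
  "minimal A f \<longleftrightarrow> in_all_charts A f (\<lambda>h z. mean_curvature h z = 0)"


section \<open>Completeness of the induced metric\<close>

text \<open>The exceptional finite set absorbs corners; the end points are always excluded, since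
  derivatives are two-sided.\<close>

definition piecewise_C1_curve :: "'a topology \<Rightarrow> 'a chart set \<Rightarrow> (real \<Rightarrow> 'a) \<Rightarrow> bool" where
  "piecewise_C1_curve X A \<gamma> \<longleftrightarrow> pathin X \<gamma> \<and>
     (\<exists>S. finite S \<and>
       (\<forall>(U, \<phi>) \<in> A. (\<phi> \<circ> \<gamma>) C1_differentiable_on {t \<in> {0<..<1} - S. \<gamma> t \<in> U}))"

text \<open>The induced metric is the pullback of the Euclidean one, so \<open>\<gamma>'\<close> has length
  \<open>\<bar>df(\<gamma>')\<bar> = \<bar>(f \<circ> \<gamma>)'\<bar>\<close>. Using \<open>has_integral\<close> restricts to rectifiable curves
  (\<open>integral\<close> would silently assign length 0 to the others).\<close>

definition induced_dist ::
    "'a topology \<Rightarrow> 'a chart set \<Rightarrow> ('a \<Rightarrow> 'b::euclidean_space) \<Rightarrow> 'a \<Rightarrow> 'a \<Rightarrow> real" where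
  "induced_dist X A f p q =
     Inf {L. \<exists>\<gamma>. piecewise_C1_curve X A \<gamma> \<and> \<gamma> 0 = p \<and> \<gamma> 1 = q \<and>
       ((\<lambda>t. norm (vector_derivative (f \<circ> \<gamma>) (at t))) has_integral L) {0..1}}"

definition complete_induced_metric ::
    "'a topology \<Rightarrow> 'a chart set \<Rightarrow> ('a \<Rightarrow> 'b::euclidean_space) \<Rightarrow> bool" where
  "complete_induced_metric X A f \<longleftrightarrow>
     (\<forall>\<sigma>::nat \<Rightarrow> 'a. range \<sigma> \<subseteq> topspace X \<longrightarrow>
        (\<forall>\<epsilon>>0. \<exists>N. \<forall>m\<ge>N. \<forall>n\<ge>N. induced_dist X A f (\<sigma> m) (\<sigma> n) < \<epsilon>) \<longrightarrow>
        (\<exists>p \<in> topspace X. (\<lambda>n. induced_dist X A f (\<sigma> n) p) \<longlonglongrightarrow> 0))"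


section \<open>Lagrangian surfaces in \<open>\<complex>\<^sup>2\<close>\<close>

text \<open>The inner product of \<^typ>\<open>complex \<times> complex\<close> is the real Euclidean one on \<open>\<real>\<^sup>4\<close>, and
  \<open>\<omega>(u, v) = \<langle>\<i>u, v\<rangle>\<close> is the standard symplectic form.\<close>

definition symp :: "complex \<times> complex \<Rightarrow> complex \<times> complex \<Rightarrow> real" where
  "symp u v = (\<i> * fst u, \<i> * snd u) \<bullet> v"

definition lagrangian :: "'a chart set \<Rightarrow> ('a \<Rightarrow> complex \<times> complex) \<Rightarrow> bool" where
  "lagrangian A f \<longleftrightarrow> in_all_charts A f (\<lambda>h z. symp (Dx h z) (Dy h z) = 0)"

definition conformal_minimal_lagrangian_immersion ::
    "'a chart set \<Rightarrow> ('a \<Rightarrow> complex \<times> complex) \<Rightarrow> bool" where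
  "conformal_minimal_lagrangian_immersion A f \<longleftrightarrow>
     immersion A f \<and> conformal A f \<and> minimal A f \<and> lagrangian A f"

text \<open>Lagrangian planes are affine planes.\<close>

definition lagrangian_plane :: "(complex \<times> complex) set \<Rightarrow> bool" where
  "lagrangian_plane P \<longleftrightarrow>
     (\<exists>a V. subspace V \<and> dim V = 2 \<and> (\<forall>u\<in>V. \<forall>v\<in>V. symp u v = 0) \<and> P = (\<lambda>v. a + v) ` V)"

text \<open>\<open>f\<^sup>*(dz\<^sub>1 \<and> dz\<^sub>2) = e\<^bsup>i\<beta>\<^esup> dA\<close>. Here \<open>\<beta>\<close> is a real representative of an angle
  modulo \<open>2\<pi>\<close>, and the surface is oriented by its complex structure.\<close>

definition has_lagrangian_angle ::
    "'a chart set \<Rightarrow> ('a \<Rightarrow> complex \<times> complex) \<Rightarrow> real \<Rightarrow> bool" where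
  "has_lagrangian_angle A f \<beta> \<longleftrightarrow>
     in_all_charts A f (\<lambda>h z.
       fst (Dx h z) * snd (Dy h z) - snd (Dx h z) * fst (Dy h z)
         = of_real (sqrt (gram h z)) * cis \<beta>)"


section \<open>The representation formula and the Gauss map\<close>

definition rep_formula :: "real \<Rightarrow> complex \<times> complex \<Rightarrow> complex \<times> complex" where
  "rep_formula \<beta> = (\<lambda>(F1, F2).
     (of_real (1 / sqrt 2) * cis (\<beta> / 2) * (F1 - \<i> * cnj F2),
      of_real (1 / sqrt 2) * cis (\<beta> / 2) * (F2 + \<i> * cnj F1)))"

text \<open>The formula is pointwise invertible, so \<open>\<beta>\<close> and \<open>f\<close> determine \<open>F\<close>.\<close>

lemma inj_rep_formula: "inj (rep_formula \<beta>)"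
proof (rule injI)
  fix v w assume eq: "rep_formula \<beta> v = rep_formula \<beta> w"
  obtain a b c d where vw: "v = (a, b)" "w = (c, d)" by fastforce
  have nz: "of_real (1 / sqrt 2) * cis (\<beta> / 2) \<noteq> (0::complex)" by simp
  have e1: "a - \<i> * cnj b = c - \<i> * cnj d" and e2: "b + \<i> * cnj a = d + \<i> * cnj c"
    using eq nz unfolding vw rep_formula_def by (auto simp del: of_real_divide)
  show "v = w"
    using e1 e2 unfolding vw by (auto simp: complex_eq_iff)
qed

definition S1 :: "'a chart \<Rightarrow> ('a \<Rightarrow> complex \<times> complex) \<Rightarrow> 'a \<Rightarrow> complex" where
  "S1 c F p = deriv (in_chart c (\<lambda>q. snd (F q))) (snd c p)"

definition S2 :: "'a chart \<Rightarrow> ('a \<Rightarrow> complex \<times> complex) \<Rightarrow> 'a \<Rightarrow> complex" where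
  "S2 c F p = - deriv (in_chart c (\<lambda>q. fst (F q))) (snd c p)"

definition holomorphic_map :: "'a chart set \<Rightarrow> ('a \<Rightarrow> complex \<times> complex) \<Rightarrow> bool" where
  "holomorphic_map A F \<longleftrightarrow>
     (\<forall>c \<in> A. in_chart c (\<lambda>q. fst (F q)) holomorphic_on snd c ` fst c \<and>
              in_chart c (\<lambda>q. snd (F q)) holomorphic_on snd c ` fst c)"

text \<open>No congruence is applied to \<open>f\<close> here: inverting the formula, a conformal minimal Lagrangian
  immersion of angle \<open>\<beta>\<close> is itself of this form, with
  \<open>F\<^sub>1 = (h\<^sub>1 + i cnj h\<^sub>2) / 2\<close>, \<open>F\<^sub>2 = (h\<^sub>2 - i cnj h\<^sub>1) / 2\<close> for
  \<open>h = \<surd>2 e\<^bsup>-i\<beta>/2\<^esup> f\<close>.\<close>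

definition represents ::
    "'a topology \<Rightarrow> 'a chart set \<Rightarrow> real \<Rightarrow> ('a \<Rightarrow> complex \<times> complex) \<Rightarrow>
     ('a \<Rightarrow> complex \<times> complex) \<Rightarrow> bool" where
  "represents X A \<beta> F f \<longleftrightarrow>
     holomorphic_map A F \<and>
     (\<forall>c \<in> A. \<forall>p \<in> fst c. (cmod (S1 c F p))\<^sup>2 + (cmod (S2 c F p))\<^sup>2 \<noteq> 0) \<and>
     (\<forall>p \<in> topspace X. f p = rep_formula \<beta> (F p))"

text \<open>The Riemann sphere is \<^typ>\<open>complex option\<close>, with \<^term>\<open>None\<close> as \<open>\<infinity>\<close>.\<close>

definition sphere_quotient :: "complex \<Rightarrow> complex \<Rightarrow> complex option" where
  "sphere_quotient a b = (if b = 0 then None else Some (a / b))"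

text \<open>The choice of \<open>(\<beta>, F)\<close> is harmless: replacing \<open>\<beta>\<close> by \<open>\<beta> + 2\<pi>\<close> only changes the sign
  of \<open>F\<close>. The first component is the common value of \<open>-S\<^sub>2/S\<^sub>1\<close> in all coordinates at \<open>p\<close>.\<close>

definition gauss_map ::
    "'a topology \<Rightarrow> 'a chart set \<Rightarrow> ('a \<Rightarrow> complex \<times> complex) \<Rightarrow> 'a \<Rightarrow>
     complex option \<times> complex option" where
  "gauss_map X A f p =
     (let (\<beta>, F) = (SOME (\<beta>, F). has_lagrangian_angle A f \<beta> \<and> represents X A \<beta> F f)
      in (THE w. \<forall>c \<in> A. p \<in> fst c \<longrightarrow> w = sphere_quotient (- S2 c F p) (S1 c F p),
          Some (cis \<beta>)))"

definition omitted_values :: "'a set \<Rightarrow> ('a \<Rightarrow> 'b) \<Rightarrow> 'b set" where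
  "omitted_values \<Sigma> g = {w. \<forall>p \<in> \<Sigma>. g p \<noteq> w}"

end

theory Submission
  imports Defs "HOL-Complex_Analysis.Complex_Analysis"
begin

text \<open>The theorem is a Picard theorem for the function \<open>g = -S\<^sub>2/S\<^sub>1\<close>, proved by Fujimoto's method. The
  immersion is given by a holomorphic map \<open>F\<close> with \<open>F\<^sub>2' = S\<^sub>1\<close> and \<open>F\<^sub>1' = -S\<^sub>2\<close>, and the induced metric is
  \<open>(\<bar>S\<^sub>1\<bar>\<^sup>2 + \<bar>S\<^sub>2\<bar>\<^sup>2) |dz|\<^sup>2\<close> (\<open>representation_exists\<close>, \<open>represents_metric\<close>).

  Suppose that \<open>g\<close> omits four values. After a linear change of \<open>(S\<^sub>1, S\<^sub>2)\<close> that moves one of them to \<open>\<infinity>\<close>,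
  this gives a holomorphic function \<open>P\<close> without critical points and a holomorphic function \<open>G\<close>, a
  Moebius transform of \<open>g\<close>, such that \<open>G\<close> omits three finite values \<open>b\<^sub>1, b\<^sub>2, b\<^sub>3\<close> and the length
  element is at most a constant times \<open>(1 + \<bar>G\<bar>) \<bar>dP\<bar>\<close>. The expression
  \<open>G'\<^sup>5 / (P'\<^sup>6 (\<Prod>\<^sub>i (G - b\<^sub>i))\<^sup>4)\<close> transforms as a vector field. Consider its flow in complex time,
  starting at a point where \<open>G' \<noteq> 0\<close>. On a flow disc of radius \<open>r\<close> the function \<open>G\<close> omits three finite
  values, and a consequence of Schottky's theorem (\<open>deriv_bound_omitting_three\<close>) bounds the speed of
  the flow in the induced metric by a multiple of \<open>r\<^bsup>-5/6\<^esup>\<close>. It is here that four omitted values are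
  enough: the exponent is larger than \<open>-1\<close>.

  If flow discs around some point had bounded radius, then one could pass to points with smaller and
  smaller maximal radius along curves of finite total length. Completeness provides a limit point, and
  the local behaviour of the flow there gives a contradiction (\<open>flow_radius_unbounded\<close>). So there
  are flow discs of all radii, the speed bound forces the speed to vanish, and \<open>G' = 0\<close> everywhere
  (\<open>omitting_three_values_constant\<close>).

  Hence \<open>S\<^sub>1\<close> and \<open>S\<^sub>2\<close> are linearly dependent with constant coefficients and \<open>F\<close> maps to a complex line.
  An affine coordinate on this line is an isometry up to scale, and the same continuation argument,
  now for a flow of constant speed, shows that it attains all values. So the image of \<open>f\<close> is a full
  Lagrangian plane (\<open>linear_relation_imp_plane\<close>), which is excluded.

  The representation itself is obtained as follows. A conformal map with vanishing mean curvature is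
  harmonic, so its Wirtinger derivatives are holomorphic or antiholomorphic. The Lagrangian condition
  makes the complex determinant of the frame, divided by the area density, the conjugate of a quotient
  of holomorphic functions (\<open>angle_locally_constant\<close>); as it has modulus one, it is a constant
  \<open>e\<^bsup>i\<beta>\<^esup>\<close>.\<close>

section \<open>Derivatives of functions that omit three finite values\<close>

text \<open>Schottky's theorem bounds \<open>k\<close> on a disc of a quarter of the radius. Since \<open>k\<close> has no zeros, it has a
  holomorphic fifth root \<open>g\<close> there, which is bounded too, so that \<open>k' = 5 g\<^sup>4 g'\<close> is at most a
  constant times \<open>\<bar>k\<bar>\<^bsup>4/5\<^esup> / r\<close> by Cauchy's inequality. The decay of order \<open>4/5\<close> of the derivative
  near the omitted value \<open>0\<close> replaces the hyperbolic metric of the twice punctured plane; any exponent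
  below \<open>1\<close> could be reached with a root of higher order. The fifth power of the inequality is stated
  to keep the exponents integral.\<close>

lemma deriv_bound_omitting_0_1:
  fixes M :: real
  shows "\<exists>C>0. \<forall>k r. 0 < r \<longrightarrow> k holomorphic_on ball 0 r \<longrightarrow>
     (\<forall>z\<in>ball 0 r. k z \<noteq> 0 \<and> k z \<noteq> 1) \<longrightarrow> norm (k 0) \<le> M \<longrightarrow>
     (r * norm (deriv k 0)) ^ 5 \<le> C * norm (k 0) ^ 4"
proof -
  define K where "K = exp (pi * exp (pi * (2 + 2 * M + 12)))"
  have K1: "K \<ge> 1" unfolding K_def by simp
  have "(r * norm (deriv k 0)) ^ 5 \<le> (20 * K) ^ 5 * norm (k 0) ^ 4"
    if r: "0 < r" and hol: "k holomorphic_on ball 0 r"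
      and om: "\<forall>z\<in>ball 0 r. k z \<noteq> 0 \<and> k z \<noteq> 1" and M: "norm (k 0) \<le> M" for k r
  proof -
    define f where "f = (\<lambda>z. k (of_real (r/2) * z))"
    have inb: "of_real (r/2) * z \<in> ball 0 r" if "z \<in> cball 0 1" for z :: complex
    proof -
      have "norm (of_real (r/2) * z) \<le> r/2 * 1"
        using that r by (simp add: norm_mult)
      then show ?thesis using r by auto
    qed
    have holf: "f holomorphic_on cball 0 1"
    proof -
      have "(k \<circ> (\<lambda>z. of_real (r/2) * z)) holomorphic_on cball 0 1"
        by (rule holomorphic_on_compose_gen[OF _ hol]) (use inb in \<open>auto intro!: holomorphic_intros\<close>)
      then show ?thesis by (simp add: f_def o_def)
    qed
    have fnz: "f z \<noteq> 0 \<and> f z \<noteq> 1" if "z \<in> cball 0 1" for z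
      using om inb[OF that] by (auto simp: f_def)
    have fK: "norm (f z) \<le> K" if "norm z \<le> 1/2" for z
    proof -
      have "norm (f 0) \<le> M" using M by (simp add: f_def)
      from Schottky[OF holf this _ _ _ that] fnz show ?thesis by (auto simp: K_def)
    qed
    obtain l where l: "l holomorphic_on cball 0 1" "\<And>z. z \<in> cball 0 1 \<Longrightarrow> f z = exp (l z)"
      using contractible_imp_holomorphic_log[OF holf convex_imp_contractible[OF convex_cball]] fnz by metis
    define g where "g = (\<lambda>z. exp (l z / 5))"
    have holg: "g holomorphic_on cball 0 1" unfolding g_def by (intro holomorphic_intros l) auto
    have fg: "f z = g z ^ 5" if "z \<in> cball 0 1" for z
      using l(2)[OF that] by (simp add: g_def exp_of_nat_mult[symmetric])
    have gK: "norm (g z) \<le> K" if "norm z \<le> 1/2" for z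
    proof -
      have "norm (g z) ^ 5 \<le> K" using fK[OF that] fg[of z] that by (simp add: norm_power)
      also have "K \<le> K ^ 5" using K1 by (metis power_increasing power_one_right one_le_numeral)
      finally show ?thesis using K1 by (simp add: power_mono_iff)
    qed
    have gd: "norm ((deriv ^^ 1) g 0) \<le> fact 1 * K / (1/2)^1"
      by (rule Cauchy_inequality)
        (auto intro!: holomorphic_on_subset[OF holg] gK holomorphic_on_imp_continuous_on simp: dist_norm)
    have gder: "(g has_field_derivative deriv g 0) (at 0)"
      by (rule holomorphic_derivI[OF holomorphic_on_subset[OF holg ball_subset_cball]]) auto
    have "((\<lambda>z. g z ^ 5) has_field_derivative 5 * g 0 ^ 4 * deriv g 0) (at 0)"
      by (rule derivative_eq_intros gder refl)+ simp
    then have "(f has_field_derivative 5 * g 0 ^ 4 * deriv g 0) (at 0)"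
      by (rule has_field_derivative_transform_within[where d=1]) (auto simp: fg)
    moreover have "(f has_field_derivative of_real (r/2) * deriv k 0) (at 0)"
    proof -
      have kd: "(k has_field_derivative deriv k 0) (at (of_real (r/2) * 0))"
        using holomorphic_derivI[OF hol _ ] r by auto
      have md: "((\<lambda>z. complex_of_real (r/2) * z) has_field_derivative of_real (r/2)) (at 0)"
        by (rule derivative_eq_intros refl)+ simp
      show ?thesis using DERIV_chain2[OF kd md] unfolding f_def by (simp add: mult.commute)
    qed
    ultimately have eq: "of_real (r/2) * deriv k 0 = 5 * g 0 ^ 4 * deriv g 0"
      using DERIV_unique by blast
    have "r / 2 * norm (deriv k 0) = norm (of_real (r/2) * deriv k 0)"
      using r by (simp add: norm_mult)
    also have "\<dots> = 5 * norm (g 0) ^ 4 * norm (deriv g 0)"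
      unfolding eq by (simp add: norm_mult norm_power)
    also have "\<dots> \<le> 5 * norm (g 0) ^ 4 * (2 * K)"
      using gd by (intro mult_left_mono) auto
    finally have "r * norm (deriv k 0) \<le> 20 * K * norm (g 0) ^ 4" by (simp add: mult_ac)
    then have "(r * norm (deriv k 0)) ^ 5 \<le> (20 * K * norm (g 0) ^ 4) ^ 5"
      using r by (intro power_mono) auto
    also have "\<dots> = (20 * K) ^ 5 * (norm (g 0) ^ 5) ^ 4"
      by (simp only: power_mult_distrib power_mult[symmetric]) simp
    also have "norm (g 0) ^ 5 = norm (k 0)"
      using fg[of 0] by (simp add: f_def norm_power)
    finally show ?thesis .
  qed
  then show ?thesis using K1 by (intro exI[of _ "(20 * K) ^ 5"]) auto
qed

lemma deriv_bound_omitting_pair: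
  fixes a b :: complex and M :: real
  assumes "a \<noteq> b"
  shows "\<exists>C>0. \<forall>k r. 0 < r \<longrightarrow> k holomorphic_on ball 0 r \<longrightarrow>
     (\<forall>z\<in>ball 0 r. k z \<noteq> a \<and> k z \<noteq> b) \<longrightarrow> norm (k 0) \<le> M \<longrightarrow>
     (r * norm (deriv k 0)) ^ 5 \<le> C * norm (k 0 - a) ^ 4"
proof -
  define d where "d = b - a"
  have d: "d \<noteq> 0" using assms by (simp add: d_def)
  obtain C where C: "C > 0" and CC: "\<And>k r. 0 < r \<Longrightarrow> k holomorphic_on ball 0 r \<Longrightarrow>
     (\<forall>z\<in>ball 0 r. k z \<noteq> 0 \<and> k z \<noteq> 1) \<Longrightarrow> norm (k 0) \<le> (M + norm a) / norm d \<Longrightarrow>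
     (r * norm (deriv k 0)) ^ 5 \<le> C * norm (k 0) ^ 4"
    using deriv_bound_omitting_0_1[of "(M + norm a) / norm d"] by blast
  have "(r * norm (deriv k 0)) ^ 5 \<le> (C * norm d) * norm (k 0 - a) ^ 4"
    if r: "0 < r" and hol: "k holomorphic_on ball 0 r"
      and om: "\<forall>z\<in>ball 0 r. k z \<noteq> a \<and> k z \<noteq> b" and M: "norm (k 0) \<le> M" for k r
  proof -
    define h where "h = (\<lambda>z. (k z - a) / d)"
    have kd: "(k has_field_derivative deriv k 0) (at 0)"
      using holomorphic_derivI[OF hol] r by auto
    have "(h has_field_derivative deriv k 0 / d) (at 0)"
      unfolding h_def by (rule derivative_eq_intros kd refl)+ (use d in auto)
    then have hd: "deriv h 0 = deriv k 0 / d" by (rule DERIV_imp_deriv)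
    have "(r * norm (deriv h 0)) ^ 5 \<le> C * norm (h 0) ^ 4"
    proof (rule CC[OF r])
      show "h holomorphic_on ball 0 r" unfolding h_def by (intro holomorphic_intros hol) (use d in auto)
      show "\<forall>z\<in>ball 0 r. h z \<noteq> 0 \<and> h z \<noteq> 1" using om d by (auto simp: h_def d_def field_simps)
      have "norm (k 0 - a) \<le> M + norm a" using M norm_triangle_ineq4[of "k 0" a] by linarith
      then show "norm (h 0) \<le> (M + norm a) / norm d"
        by (simp add: h_def norm_divide divide_right_mono)
    qed
    then have "(r * norm (deriv k 0)) ^ 5 / norm d ^ 5 \<le> C * norm (k 0 - a) ^ 4 / norm d ^ 4"
      unfolding hd by (simp add: h_def norm_divide power_divide)
    then show ?thesis using d by (simp add: field_simps power_numeral_reduce)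
  qed
  then show ?thesis using C d by (intro exI[of _ "C * norm d"]) auto
qed

text \<open>Of the distances to three separated points, all but the smallest are bounded below.\<close>

lemma two_of_three_far:
  fixes x1 x2 x3 \<delta> E D :: real
  assumes d: "\<delta> > 0" and x: "x1 \<ge> 0" "x2 \<ge> 0" "x3 \<ge> 0"
    and s: "x1 + x2 \<ge> 2 * \<delta>" "x1 + x3 \<ge> 2 * \<delta>" "x2 + x3 \<ge> 2 * \<delta>"
    and E: "E \<le> D * x1 ^ 4" "E \<le> D * x2 ^ 4" "E \<le> D * x3 ^ 4" and D: "D > 0"
  shows "E * \<delta> ^ 8 \<le> D * (x1 * x2 * x3) ^ 4"
proof -
  have key: "E * \<delta> ^ 8 \<le> D * (x * (y * z)) ^ 4"
    if "E \<le> D * x ^ 4" "x \<ge> 0" "y \<ge> \<delta>" "z \<ge> \<delta>" for x y z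
  proof -
    have "\<delta> * \<delta> \<le> y * z" using that d by (intro mult_mono) auto
    then have "(\<delta> * \<delta>) ^ 4 \<le> (y * z) ^ 4" using d by (intro power_mono) auto
    then have "D * x ^ 4 * (\<delta> * \<delta>) ^ 4 \<le> D * x ^ 4 * (y * z) ^ 4"
      using D by (intro mult_left_mono) auto
    moreover have "E * \<delta> ^ 8 \<le> D * x ^ 4 * \<delta> ^ 8" using that d by (intro mult_right_mono) auto
    moreover have "(\<delta> * \<delta>) ^ 4 = \<delta> ^ 8" by (simp add: power_numeral_reduce)
    ultimately show ?thesis by (simp add: power_mult_distrib)
  qed
  consider "x2 \<ge> \<delta>" "x3 \<ge> \<delta>" | "x1 \<ge> \<delta>" "x3 \<ge> \<delta>" | "x1 \<ge> \<delta>" "x2 \<ge> \<delta>"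
    using s by linarith
  then show ?thesis
    using key[of x1 x2 x3] key[of x2 x1 x3] key[of x3 x1 x2] E x
    by cases (simp_all add: mult_ac)
qed

text \<open>Near each of the three omitted values, and near the fourth omitted value \<open>\<infinity>\<close>, the derivative decays
  as for a pair of omitted values. The weights on both sides encode these four local statements in
  one formula: for large \<open>k 0\<close> it says that \<open>r\<^sup>5 \<bar>k'(0)\<bar>\<^sup>5\<close> is at most a constant times \<open>\<bar>k(0)\<bar>\<^sup>6\<close>,
  which is the decay of order \<open>4/5\<close> for \<open>1/k\<close>.\<close>

lemma deriv_bound_omitting_three:
  fixes b1 b2 b3 :: complex
  assumes ne: "b1 \<noteq> b2" "b1 \<noteq> b3" "b2 \<noteq> b3"
  shows "\<exists>C>0. \<forall>k r. 0 < r \<longrightarrow> k holomorphic_on ball 0 r \<longrightarrow>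
     (\<forall>z\<in>ball 0 r. k z \<noteq> b1 \<and> k z \<noteq> b2 \<and> k z \<noteq> b3) \<longrightarrow>
     (r * norm (deriv k 0)) ^ 5 * (1 + norm (k 0)) ^ 6
       \<le> C * (norm (k 0 - b1) * norm (k 0 - b2) * norm (k 0 - b3)) ^ 4"
proof -
  define B where "B = 2 * (1 + norm b1 + norm b2 + norm b3)"
  have B: "B \<ge> 2" by (simp add: B_def)
  define \<delta> where "\<delta> = min (norm (b1 - b2)) (min (norm (b1 - b3)) (norm (b2 - b3))) / 2"
  have \<delta>: "\<delta> > 0" using ne by (simp add: \<delta>_def)
  define OM where "OM = (\<lambda>k r. 0 < r \<and> k holomorphic_on ball 0 r \<and>
     (\<forall>z\<in>ball 0 r. k z \<noteq> b1 \<and> k z \<noteq> b2 \<and> k z \<noteq> b3))"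
  obtain C1 where C1: "C1 > 0" "\<And>k r. OM k r \<Longrightarrow> norm (k 0) \<le> B \<Longrightarrow>
      (r * norm (deriv k 0)) ^ 5 \<le> C1 * norm (k 0 - b1) ^ 4"
    using deriv_bound_omitting_pair[OF ne(1), of B] by (fastforce simp: OM_def)
  obtain C2 where C2: "C2 > 0" "\<And>k r. OM k r \<Longrightarrow> norm (k 0) \<le> B \<Longrightarrow>
      (r * norm (deriv k 0)) ^ 5 \<le> C2 * norm (k 0 - b2) ^ 4"
    using deriv_bound_omitting_pair[OF ne(3), of B] by (fastforce simp: OM_def)
  obtain C3 where C3: "C3 > 0" "\<And>k r. OM k r \<Longrightarrow> norm (k 0) \<le> B \<Longrightarrow>
      (r * norm (deriv k 0)) ^ 5 \<le> C3 * norm (k 0 - b3) ^ 4"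
    using deriv_bound_omitting_pair[OF ne(2)[symmetric], of B] by (fastforce simp: OM_def)
  define D where "D = C1 + C2 + C3"
  have D: "D > 0" using C1 C2 C3 by (simp add: D_def)
  have bounded: "(r * norm (deriv k 0)) ^ 5 * (1 + norm (k 0)) ^ 6
      \<le> ((1 + B) ^ 6 * D / \<delta> ^ 8) * (norm (k 0 - b1) * norm (k 0 - b2) * norm (k 0 - b3)) ^ 4"
    if OM: "OM k r" and small: "norm (k 0) \<le> B" for k r
  proof -
    let ?E = "(r * norm (deriv k 0)) ^ 5"
    let ?Q = "(norm (k 0 - b1) * norm (k 0 - b2) * norm (k 0 - b3)) ^ 4"
    have E0: "?E \<ge> 0" using OM by (simp add: OM_def)
    have tri: "norm (b1 - b2) \<le> norm (k 0 - b1) + norm (k 0 - b2)"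
      "norm (b1 - b3) \<le> norm (k 0 - b1) + norm (k 0 - b3)"
      "norm (b2 - b3) \<le> norm (k 0 - b2) + norm (k 0 - b3)"
      using norm_triangle_ineq4[of "k 0 - b2" "k 0 - b1"] norm_triangle_ineq4[of "k 0 - b3" "k 0 - b1"]
        norm_triangle_ineq4[of "k 0 - b3" "k 0 - b2"] by simp_all
    have "?E * \<delta> ^ 8 \<le> D * ?Q"
    proof (rule two_of_three_far[OF \<delta>])
      show "?E \<le> D * norm (k 0 - b1) ^ 4"
        by (rule order_trans[OF C1(2)[OF OM small]]) (use C2 C3 in \<open>auto simp: D_def intro!: mult_right_mono\<close>)
      show "?E \<le> D * norm (k 0 - b2) ^ 4"
        by (rule order_trans[OF C2(2)[OF OM small]]) (use C1 C3 in \<open>auto simp: D_def intro!: mult_right_mono\<close>)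
      show "?E \<le> D * norm (k 0 - b3) ^ 4"
        by (rule order_trans[OF C3(2)[OF OM small]]) (use C1 C2 in \<open>auto simp: D_def intro!: mult_right_mono\<close>)
    qed (use tri D in \<open>auto simp: \<delta>_def\<close>)
    then have "?E \<le> D * ?Q / \<delta> ^ 8" using \<delta> by (simp add: field_simps)
    moreover have "(1 + norm (k 0)) ^ 6 \<le> (1 + B) ^ 6" using small by (intro power_mono) auto
    ultimately have "?E * (1 + norm (k 0)) ^ 6 \<le> (D * ?Q / \<delta> ^ 8) * (1 + B) ^ 6"
      using D \<delta> by (intro mult_mono) auto
    then show ?thesis by (simp add: mult_ac)
  qed
  have ne': "0 \<noteq> 1 / (b2 - b1)" using ne by simp
  obtain C4 where C4: "C4 > 0" "\<And>k r. 0 < r \<Longrightarrow> k holomorphic_on ball 0 r \<Longrightarrow>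
     (\<forall>z\<in>ball 0 r. k z \<noteq> 0 \<and> k z \<noteq> 1 / (b2 - b1)) \<Longrightarrow> norm (k 0) \<le> 1 \<Longrightarrow>
     (r * norm (deriv k 0)) ^ 5 \<le> C4 * norm (k 0) ^ 4"
    using deriv_bound_omitting_pair[OF ne', of 1] by auto
  have large: "(r * norm (deriv k 0)) ^ 5 * (1 + norm (k 0)) ^ 6
      \<le> (C4 * 2 ^ 24) * (norm (k 0 - b1) * norm (k 0 - b2) * norm (k 0 - b3)) ^ 4"
    if OM: "OM k r" and lg: "\<not> norm (k 0) \<le> B" for k r
  proof -
    \<comment> \<open>far out, pass to a bounded function: the omitted values b1 and b2 of k become \<open>\<infinity>\<close> and 1/(b2-b1),
      and 0 is omitted because k is finite\<close>
    define h where "h = (\<lambda>z. 1 / (k z - b1))"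
    have r: "r > 0" and hol: "k holomorphic_on ball 0 r"
      and om: "\<And>z. z \<in> ball 0 r \<Longrightarrow> k z \<noteq> b1 \<and> k z \<noteq> b2 \<and> k z \<noteq> b3"
      using OM by (auto simp: OM_def)
    have kd: "(k has_field_derivative deriv k 0) (at 0)"
      using holomorphic_derivI[OF hol] r by auto
    have k0: "k 0 \<noteq> b1" using om r by auto
    have "(h has_field_derivative - (deriv k 0) / (k 0 - b1) ^ 2) (at 0)"
      unfolding h_def by (rule derivative_eq_intros kd refl)+ (use k0 in \<open>auto simp: power2_eq_square field_simps\<close>)
    then have hd: "deriv h 0 = - (deriv k 0) / (k 0 - b1) ^ 2" by (rule DERIV_imp_deriv)
    let ?z = "norm (k 0)"
    have z: "?z > 2 * (1 + norm b1 + norm b2 + norm b3)" using lg by (simp add: B_def)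
    have nn: "norm b1 \<ge> 0" "norm b2 \<ge> 0" "norm b3 \<ge> 0" by simp_all
    have lo1: "?z / 2 \<le> norm (k 0 - b1)" using z nn norm_triangle_ineq2[of "k 0" b1] by argo
    have lo2: "?z / 2 \<le> norm (k 0 - b2)" using z nn norm_triangle_ineq2[of "k 0" b2] by argo
    have lo3: "?z / 2 \<le> norm (k 0 - b3)" using z nn norm_triangle_ineq2[of "k 0" b3] by argo
    note lo = lo1 lo2 lo3
    have up: "norm (k 0 - b1) \<le> 2 * ?z" using z norm_triangle_ineq4[of "k 0" b1]
      using norm_ge_zero[of b1] norm_ge_zero[of b2] norm_ge_zero[of b3] by argo
    have z1: "?z > 2"  using z
      using norm_ge_zero[of b1] norm_ge_zero[of b2] norm_ge_zero[of b3] by argo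
    have "(r * norm (deriv h 0)) ^ 5 \<le> C4 * norm (h 0) ^ 4"
    proof (rule C4(2)[OF r])
      show "h holomorphic_on ball 0 r" unfolding h_def by (intro holomorphic_intros hol) (use om in auto)
      show "\<forall>z\<in>ball 0 r. h z \<noteq> 0 \<and> h z \<noteq> 1 / (b2 - b1)"
        using om ne by (auto simp: h_def field_simps)
      have "1 \<le> norm (k 0 - b1)" using lo z1 by linarith
      then show "norm (h 0) \<le> 1" by (simp add: h_def norm_divide divide_le_eq)
    qed
    then have "(r * norm (deriv k 0)) ^ 5 / norm (k 0 - b1) ^ 10 \<le> C4 / norm (k 0 - b1) ^ 4"
      unfolding hd by (simp add: h_def norm_divide power_divide norm_power flip: power_mult)
    then have "(r * norm (deriv k 0)) ^ 5 \<le> C4 / norm (k 0 - b1) ^ 4 * norm (k 0 - b1) ^ 10"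
      using k0 by (simp add: pos_divide_le_eq)
    also have "\<dots> = C4 * norm (k 0 - b1) ^ 6"
      using k0 by (simp add: power_numeral_reduce)
    finally have E: "(r * norm (deriv k 0)) ^ 5 \<le> C4 * norm (k 0 - b1) ^ 6" .
    have "norm (k 0 - b1) ^ 6 \<le> (2 * ?z) ^ 6" using up by (intro power_mono) auto
    then have "C4 * norm (k 0 - b1) ^ 6 \<le> C4 * (2 * ?z) ^ 6" using C4 by auto
    with E have E: "(r * norm (deriv k 0)) ^ 5 \<le> C4 * (2 * ?z) ^ 6" by linarith
    have "(1 + ?z) ^ 6 \<le> (2 * ?z) ^ 6" using z1 by (intro power_mono) auto
    with E have "(r * norm (deriv k 0)) ^ 5 * (1 + ?z) ^ 6 \<le> (C4 * (2 * ?z) ^ 6) * (2 * ?z) ^ 6"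
      using C4 by (intro mult_mono) auto
    also have "\<dots> = (C4 * 2 ^ 24) * (?z / 2 * (?z / 2) * (?z / 2)) ^ 4"
      by (simp add: power_mult_distrib power_divide)
    also have "\<dots> \<le> (C4 * 2 ^ 24) * (norm (k 0 - b1) * norm (k 0 - b2) * norm (k 0 - b3)) ^ 4"
      using lo C4 z1 by (intro mult_left_mono power_mono mult_mono) auto
    finally show ?thesis .
  qed
  define C where "C = (1 + B) ^ 6 * D / \<delta> ^ 8 + C4 * 2 ^ 24"
  have p1: "(1 + B) ^ 6 * D / \<delta> ^ 8 > 0" using B D \<delta> by (intro divide_pos_pos mult_pos_pos) auto
  have le: "(r * norm (deriv k 0)) ^ 5 * (1 + norm (k 0)) ^ 6
       \<le> C * (norm (k 0 - b1) * norm (k 0 - b2) * norm (k 0 - b3)) ^ 4" if OM: "OM k r" for k r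
  proof (cases "norm (k 0) \<le> B")
    case True
    show ?thesis
      by (rule order_trans[OF bounded[OF OM True]], rule mult_right_mono) (use C4 in \<open>auto simp: C_def\<close>)
  next
    case False
    show ?thesis
      by (rule order_trans[OF large[OF OM False]], rule mult_right_mono) (use p1 in \<open>auto simp: C_def\<close>)
  qed
  have "C > 0" using p1 C4 by (simp add: C_def)
  then show ?thesis using le by (intro exI[of _ C]) (auto simp: OM_def)
qed

section \<open>Holomorphic functions on a Riemann surface\<close>

abbreviation point_at :: "'a chart \<Rightarrow> complex \<Rightarrow> 'a" where
  "point_at c \<equiv> inv_into (fst c) (snd c)"

locale surface =
  fixes X :: "'a topology" and A :: "'a chart set"
  assumes riemann: "riemann_surface X A"
begin

lemma hausdorff: "Hausdorff_space X"
  using riemann by (simp add: riemann_surface_def)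

lemma
  assumes c: "c \<in> A"
  shows chart_openin: "openin X (fst c)"
    and chart_open: "open (snd c ` fst c)"
    and chart_homeo: "homeomorphic_map (subtopology X (fst c)) (top_of_set (snd c ` fst c)) (snd c)"
proof -
  obtain U \<phi> where Up: "c = (U, \<phi>)" by (metis surj_pair)
  have "\<forall>(U, \<phi>) \<in> A. openin X U \<and> open (\<phi> ` U) \<and>
        homeomorphic_map (subtopology X U) (top_of_set (\<phi> ` U)) \<phi>"
    using riemann unfolding riemann_surface_def by (elim conjE)
  then have "openin X U \<and> open (\<phi> ` U) \<and>
        homeomorphic_map (subtopology X U) (top_of_set (\<phi> ` U)) \<phi>"
    using c Up by blast
  then show "openin X (fst c)" "open (snd c ` fst c)"
    "homeomorphic_map (subtopology X (fst c)) (top_of_set (snd c ` fst c)) (snd c)"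
    by (simp_all add: Up)
qed

lemma chart_subset: "c \<in> A \<Longrightarrow> fst c \<subseteq> topspace X"
  by (rule openin_subset[OF chart_openin])

lemma chart_at:
  assumes "p \<in> topspace X" obtains c where "c \<in> A" "p \<in> fst c"
proof -
  have "\<Union> (fst ` A) = topspace X"
    using riemann unfolding riemann_surface_def by (elim conjE)
  with assms have "p \<in> \<Union> (fst ` A)" by simp
  then show ?thesis using that by auto
qed

lemma chart_inj: "c \<in> A \<Longrightarrow> inj_on (snd c) (fst c)"
  using homeomorphic_imp_injective_map[OF chart_homeo] chart_subset
  by (simp add: inf.absorb2)

lemma chart_inv [simp]: "c \<in> A \<Longrightarrow> p \<in> fst c \<Longrightarrow> point_at c (snd c p) = p"
  by (simp add: chart_inj)

lemma in_chart_apply [simp]: "c \<in> A \<Longrightarrow> p \<in> fst c \<Longrightarrow> in_chart c h (snd c p) = h p"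
  by (simp add: in_chart_def)

lemma chart_cont: "c \<in> A \<Longrightarrow> continuous_map (subtopology X (fst c)) euclidean (snd c)"
  by (rule continuous_map_into_fulltopology[OF homeomorphic_imp_continuous_map[OF chart_homeo]])

lemma chart_openin_vimage:
  assumes c: "c \<in> A" and V: "open V"
  shows "openin X {p \<in> fst c. snd c p \<in> V}"
proof -
  have "openin (subtopology X (fst c)) {p \<in> topspace (subtopology X (fst c)). snd c p \<in> V}"
    by (rule openin_continuous_map_preimage[OF chart_cont[OF c]]) (use V in simp)
  moreover have "topspace (subtopology X (fst c)) = fst c"
    using chart_subset[OF c] by auto
  ultimately have "openin X {p \<in> topspace (subtopology X (fst c)). snd c p \<in> V}"
    using openin_trans_full[OF _ chart_openin[OF c]] by blast
  then show ?thesis using \<open>topspace (subtopology X (fst c)) = fst c\<close> by metis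
qed

lemma chart_image_open:
  assumes c: "c \<in> A" and W: "openin X W" "W \<subseteq> fst c"
  shows "open (snd c ` W)"
proof -
  have "openin (subtopology X (fst c)) W"
    using W by (metis inf.absorb2 inf_commute openin_subtopology_Int)
  then have "openin (top_of_set (snd c ` fst c)) (snd c ` W)"
    using homeomorphic_imp_open_map[OF chart_homeo[OF c]] by (simp add: open_map_def)
  then show ?thesis using chart_open[OF c] openin_open_trans by blast
qed

lemma chart_inv_continuous:
  assumes c: "c \<in> A" shows "continuous_map (top_of_set (snd c ` fst c)) X (point_at c)"
proof -
  obtain g where g: "homeomorphic_maps (subtopology X (fst c)) (top_of_set (snd c ` fst c)) (snd c) g"
    using chart_homeo[OF c] by (auto simp: homeomorphic_map_maps)
  have tp: "topspace (subtopology X (fst c)) = fst c" using chart_subset[OF c] by auto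
  have gi: "g (snd c p) = p" if "p \<in> fst c" for p using g that tp by (auto simp: homeomorphic_maps_def)
  have "continuous_map (top_of_set (snd c ` fst c)) X g"
    using g by (auto simp: homeomorphic_maps_def continuous_map_in_subtopology)
  then show ?thesis
    by (rule continuous_map_eq) (use gi c in auto)
qed

lemma eventually_in_openin:
  fixes \<Phi> :: "'b::topological_space \<Rightarrow> 'a"
  assumes "continuous_map (top_of_set D) X \<Phi>" "open E" "E \<subseteq> D" "w \<in> E" "openin X W" "\<Phi> w \<in> W"
  shows "eventually (\<lambda>z. \<Phi> z \<in> W) (nhds w)"
proof -
  have "continuous_map (top_of_set E) X \<Phi>"
    using assms(1,3) continuous_map_from_subtopology_mono by blast
  then have "openin (top_of_set E) {z \<in> topspace (top_of_set E). \<Phi> z \<in> W}"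
    using assms(5) openin_continuous_map_preimage by blast
  then have "open {z \<in> E. \<Phi> z \<in> W}" using assms(2) openin_open_trans by auto
  then show ?thesis unfolding eventually_nhds using assms(4,6) by (intro exI[of _ "{z \<in> E. \<Phi> z \<in> W}"]) auto
qed

lemma chart_inv_eventually:
  assumes "c \<in> A" "p \<in> fst c" "openin X W" "p \<in> W"
  shows "eventually (\<lambda>z. point_at c z \<in> W) (nhds (snd c p))"
  by (rule eventually_in_openin[OF chart_inv_continuous[OF assms(1)] chart_open[OF assms(1)] order_refl])
    (use assms in auto)

text \<open>The coefficient of \<open>du\<close> with respect to the coordinate of the chart. It is meant for functions \<open>u\<close>
  that are holomorphic on the whole surface.\<close>

definition dv :: "'a chart \<Rightarrow> ('a \<Rightarrow> complex) \<Rightarrow> 'a \<Rightarrow> complex" where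
  "dv c u p = deriv (in_chart c u) (snd c p)"

definition holo :: "('a \<Rightarrow> complex) \<Rightarrow> bool" where
  "holo u \<longleftrightarrow> (\<forall>c \<in> A. in_chart c u holomorphic_on snd c ` fst c)"

lemma holo_deriv:
  assumes "holo u" "c \<in> A" "p \<in> fst c"
  shows "(in_chart c u has_field_derivative dv c u p) (at (snd c p))"
  unfolding dv_def using assms chart_open by (auto simp: holo_def intro!: holomorphic_derivI)

lemma chain_complex:
  assumes c: "c \<in> A" and ev: "eventually (\<lambda>z. \<Phi> z \<in> fst c) (nhds w)"
    and D: "((snd c \<circ> \<Phi>) has_field_derivative D) (at w)"
    and E: "(in_chart c u has_field_derivative E) (at (snd c (\<Phi> w)))"
  shows "((u \<circ> \<Phi>) has_field_derivative E * D) (at w)"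
proof -
  have "((in_chart c u \<circ> (snd c \<circ> \<Phi>)) has_field_derivative E * D) (at w)"
    using DERIV_chain[OF _ D] E by simp
  moreover have "eventually (\<lambda>z. (in_chart c u \<circ> (snd c \<circ> \<Phi>)) z = (u \<circ> \<Phi>) z) (nhds w)"
    using ev by eventually_elim (simp add: c)
  ultimately show ?thesis using DERIV_cong_ev by blast
qed

lemma chain_real:
  assumes c: "c \<in> A" and ev: "eventually (\<lambda>z. \<gamma> z \<in> fst c) (nhds (t::real))"
    and D: "((snd c \<circ> \<gamma>) has_vector_derivative D) (at t)"
    and E: "(in_chart c u has_field_derivative E) (at (snd c (\<gamma> t)))"
  shows "((u \<circ> \<gamma>) has_vector_derivative E * D) (at t)"
proof -
  have "((in_chart c u \<circ> (snd c \<circ> \<gamma>)) has_vector_derivative D * E) (at t)"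
    using field_vector_diff_chain_at[OF D] E by simp
  moreover have "eventually (\<lambda>z. (in_chart c u \<circ> (snd c \<circ> \<gamma>)) z = (u \<circ> \<gamma>) z) (nhds t)"
    using ev by eventually_elim (simp add: c)
  moreover have "in_chart c u (snd c (\<gamma> t)) = u (\<gamma> t)"
    using eventually_nhds_x_imp_x[OF ev] c by simp
  ultimately show ?thesis
    by (subst has_vector_derivative_cong_ev[symmetric, where f = "in_chart c u \<circ> (snd c \<circ> \<gamma>)"])
      (auto simp: mult.commute elim: eventually_mono)
qed

definition jacobian :: "'a chart \<Rightarrow> 'a chart \<Rightarrow> 'a \<Rightarrow> complex" where
  "jacobian c d p = deriv (in_chart c (snd d)) (snd c p)"

lemma transition_holo:
  assumes c: "c \<in> A" and d: "d \<in> A"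
  shows "in_chart c (snd d) holomorphic_on snd c ` (fst c \<inter> fst d)"
proof -
  obtain U \<phi> V \<psi> where "c = (U, \<phi>)" "d = (V, \<psi>)" by (metis surj_pair)
  moreover have "\<forall>(U, \<phi>) \<in> A. \<forall>(V, \<psi>) \<in> A. (in_chart (U, \<phi>) \<psi>) holomorphic_on \<phi> ` (U \<inter> V)"
    using riemann unfolding riemann_surface_def by (elim conjE)
  ultimately show ?thesis using c d by fastforce
qed

lemma transition_deriv:
  assumes c: "c \<in> A" and d: "d \<in> A" and p: "p \<in> fst c" "p \<in> fst d"
  shows "(in_chart c (snd d) has_field_derivative jacobian c d p) (at (snd c p))"
proof -
  have "open (snd c ` (fst c \<inter> fst d))"
    by (rule chart_image_open[OF c]) (use chart_openin[OF c] chart_openin[OF d] in auto)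
  then show ?thesis unfolding jacobian_def
    using transition_holo[OF c d] p by (auto intro: holomorphic_derivI)
qed

lemma in_chart_deriv_change:
  assumes c: "c \<in> A" and d: "d \<in> A" and p: "p \<in> fst c" "p \<in> fst d"
    and E: "(in_chart c u has_field_derivative E) (at (snd c p))"
  shows "(in_chart d u has_field_derivative E * jacobian d c p) (at (snd d p))"
proof -
  have "((u \<circ> point_at d) has_field_derivative E * jacobian d c p) (at (snd d p))"
  proof (rule chain_complex[OF c])
    show "eventually (\<lambda>z. point_at d z \<in> fst c) (nhds (snd d p))"
      by (rule chart_inv_eventually[OF d p(2) chart_openin[OF c] p(1)])
    show "((snd c \<circ> point_at d) has_field_derivative jacobian d c p) (at (snd d p))"
      using transition_deriv[OF d c p(2,1)] by (simp add: in_chart_def)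
  qed (use d p E in simp)
  then show ?thesis by (simp add: in_chart_def)
qed

lemma dv_change:
  assumes "holo u" "c \<in> A" "d \<in> A" "p \<in> fst c" "p \<in> fst d"
  shows "dv d u p = dv c u p * jacobian d c p"
  using in_chart_deriv_change[OF assms(2-5) holo_deriv[OF assms(1,2,4)]]
  unfolding dv_def by (rule DERIV_imp_deriv)

lemma in_chart_self_deriv:
  assumes c: "c \<in> A" "p \<in> fst c"
  shows "(in_chart c (snd c) has_field_derivative 1) (at (snd c p))"
proof (rule has_field_derivative_transform_within_open)
  show "((\<lambda>z. z) has_field_derivative 1) (at (snd c p))" by simp
  show "open (snd c ` fst c)" by (rule chart_open[OF c(1)])
qed (use c in auto)

lemma jacobian_inverse:
  assumes c: "c \<in> A" and d: "d \<in> A" and p: "p \<in> fst c" "p \<in> fst d"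
  shows "jacobian c d p * jacobian d c p = 1"
  using in_chart_deriv_change[OF c d p transition_deriv[OF c d p]] in_chart_self_deriv[OF d p(2)]
  by (rule DERIV_unique)

lemma jacobian_nonzero:
  assumes "c \<in> A" "d \<in> A" "p \<in> fst c" "p \<in> fst d"
  shows "jacobian c d p \<noteq> 0"
  using jacobian_inverse[OF assms] by auto

lemma coord_deriv_change:
  assumes c: "c \<in> A" and d: "d \<in> A" and p: "\<Phi> w \<in> fst c" "\<Phi> w \<in> fst d"
    and ev: "eventually (\<lambda>z. \<Phi> z \<in> fst c) (nhds w)"
    and D: "((snd c \<circ> \<Phi>) has_field_derivative D) (at w)"
  shows "((snd d \<circ> \<Phi>) has_field_derivative jacobian c d (\<Phi> w) * D) (at w)"
  by (rule chain_complex[OF c ev D transition_deriv[OF c d p]])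

lemma holo_const_if_dv_zero:
  assumes conn: "connected_space X" and u: "holo u"
    and z: "\<And>c p. c \<in> A \<Longrightarrow> p \<in> fst c \<Longrightarrow> dv c u p = 0"
    and p: "p \<in> topspace X" and q: "q \<in> topspace X"
  shows "u p = u q"
proof -
  have loc: "\<exists>N. openin X N \<and> a \<in> N \<and> (\<forall>b\<in>N. u b = u a)" if a: "a \<in> topspace X" for a
  proof -
    obtain c where c: "c \<in> A" "a \<in> fst c" using chart_at[OF a] .
    obtain e where e: "e > 0" "ball (snd c a) e \<subseteq> snd c ` fst c"
      using chart_open[OF c(1)] c(2) open_contains_ball by (metis imageI)
    let ?N = "{b \<in> fst c. snd c b \<in> ball (snd c a) e}"
    have eqN: "u b = u a" if b: "b \<in> ?N" for b
    proof -
      have "\<exists>k. \<forall>z\<in>ball (snd c a) e. in_chart c u z = k"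
      proof (rule has_field_derivative_zero_constant[OF convex_ball])
        fix z' assume z': "z' \<in> ball (snd c a) e"
        then obtain q' where q': "q' \<in> fst c" "z' = snd c q'" using e by blast
        show "(in_chart c u has_field_derivative 0) (at z' within ball (snd c a) e)"
          using holo_deriv[OF u c(1) q'(1)] z[OF c(1) q'(1)] q'
          by (simp add: has_field_derivative_at_within)
      qed
      then have "in_chart c u (snd c b) = in_chart c u (snd c a)" using b e by auto
      then show ?thesis using b c by auto
    qed
    have "openin X ?N" by (rule chart_openin_vimage[OF c(1) open_ball])
    moreover have "a \<in> ?N" using c e by simp
    ultimately show ?thesis using eqN by blast
  qed
  have op: "openin X {a \<in> topspace X. P (u a)}" for P
    unfolding openin_subopen[of X "{a \<in> topspace X. P (u a)}"]
  proof
    fix a assume "a \<in> {a \<in> topspace X. P (u a)}"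
    then obtain N where "openin X N" "a \<in> N" "\<forall>b\<in>N. u b = u a" "P (u a)" using loc by blast
    then show "\<exists>T. openin X T \<and> a \<in> T \<and> T \<subseteq> {a \<in> topspace X. P (u a)}"
      using openin_subset by (intro exI[of _ N]) fastforce
  qed
  let ?S = "{a \<in> topspace X. u a = u q}"
  have "closedin X ?S"
  proof -
    have "topspace X - ?S = {a \<in> topspace X. u a \<noteq> u q}" by auto
    then show ?thesis unfolding closedin_def using op[of "\<lambda>x. x \<noteq> u q"] by auto
  qed
  with op[of "\<lambda>x. x = u q"] conn have "?S = {} \<or> ?S = topspace X"
    by (meson connected_space_clopen_in)
  then show ?thesis using p q by auto
qed

end

section \<open>The complex flow of a holomorphic vector field\<close>

text \<open>The component \<open>H c\<close> of the field in a chart is multiplied by the Jacobian of the coordinate change.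
  Zeros of \<open>H\<close> are allowed, but flow maps avoid them: this makes a flow map locally biholomorphic and
  lets the flow be treated through primitives of \<open>1/H\<close>.\<close>

locale vector_field = surface +
  fixes H :: "'a chart \<Rightarrow> 'a \<Rightarrow> complex"
  assumes H_holo: "c \<in> A \<Longrightarrow> in_chart c (H c) holomorphic_on snd c ` fst c"
    and H_change: "\<lbrakk>c \<in> A; d \<in> A; p \<in> fst c; p \<in> fst d\<rbrakk> \<Longrightarrow> H d p = jacobian c d p * H c p"
begin

definition flow_on :: "complex set \<Rightarrow> (complex \<Rightarrow> 'a) \<Rightarrow> bool" where
  "flow_on D \<Phi> \<longleftrightarrow> continuous_map (top_of_set D) X \<Phi> \<and>
     (\<forall>w\<in>D. \<forall>c\<in>A. \<Phi> w \<in> fst c \<longrightarrow>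
        H c (\<Phi> w) \<noteq> 0 \<and> ((snd c \<circ> \<Phi>) has_field_derivative H c (\<Phi> w)) (at w))"

lemma
  assumes "flow_on D \<Phi>" "w \<in> D"
  shows flow_in_topspace: "\<Phi> w \<in> topspace X"
    and flow_nz: "c \<in> A \<Longrightarrow> \<Phi> w \<in> fst c \<Longrightarrow> H c (\<Phi> w) \<noteq> 0"
    and flow_deriv: "c \<in> A \<Longrightarrow> \<Phi> w \<in> fst c \<Longrightarrow>
      ((snd c \<circ> \<Phi>) has_field_derivative H c (\<Phi> w)) (at w)"
  using assms unfolding flow_on_def by (auto simp: continuous_map_def)

lemma flow_eventually:
  assumes "flow_on D \<Phi>" "open D" "w \<in> D" "openin X W" "\<Phi> w \<in> W"
  shows "eventually (\<lambda>z. \<Phi> z \<in> W) (nhds w)"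
  using assms eventually_in_openin[of D \<Phi> D w W] by (auto simp: flow_on_def)

lemma flow_onI:
  assumes D: "open D" and cont: "continuous_map (top_of_set D) X \<Phi>"
    and ex: "\<And>w. w \<in> D \<Longrightarrow> \<exists>c\<in>A. \<Phi> w \<in> fst c \<and> H c (\<Phi> w) \<noteq> 0 \<and>
        ((snd c \<circ> \<Phi>) has_field_derivative H c (\<Phi> w)) (at w)"
  shows "flow_on D \<Phi>"
  unfolding flow_on_def
proof (intro conjI cont ballI impI)
  fix w d assume w: "w \<in> D" and d: "d \<in> A" "\<Phi> w \<in> fst d"
  obtain c where c: "c \<in> A" "\<Phi> w \<in> fst c" "H c (\<Phi> w) \<noteq> 0"
    "((snd c \<circ> \<Phi>) has_field_derivative H c (\<Phi> w)) (at w)" using ex[OF w] by blast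
  have ev: "eventually (\<lambda>z. \<Phi> z \<in> fst c) (nhds w)"
    by (rule eventually_in_openin[OF cont D order_refl w chart_openin[OF c(1)] c(2)])
  show "H d (\<Phi> w) \<noteq> 0"
    using c d H_change[OF c(1) d(1) c(2) d(2)] jacobian_nonzero[OF c(1) d(1) c(2) d(2)] by simp
  show "((snd d \<circ> \<Phi>) has_field_derivative H d (\<Phi> w)) (at w)"
    using coord_deriv_change[OF c(1) d(1) c(2) d(2) ev c(4)] H_change[OF c(1) d(1) c(2) d(2)] by simp
qed

lemma flow_on_subset:
  assumes "flow_on D \<Phi>" "E \<subseteq> D" shows "flow_on E \<Phi>"
  using assms continuous_map_from_subtopology_mono unfolding flow_on_def by blast

lemma flow_on_cong:
  assumes D: "open D" and f: "flow_on D \<Phi>" and eq: "\<And>w. w \<in> D \<Longrightarrow> \<Psi> w = \<Phi> w"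
  shows "flow_on D \<Psi>"
  unfolding flow_on_def
proof (intro conjI ballI impI)
  show "continuous_map (top_of_set D) X \<Psi>"
    using f eq by (auto simp: flow_on_def intro: continuous_map_eq[of _ _ \<Phi>])
  fix w c assume w: "w \<in> D" and c: "c \<in> A" "\<Psi> w \<in> fst c"
  show "H c (\<Psi> w) \<noteq> 0" using flow_nz[OF f w c(1)] c eq[OF w] by simp
  have "((snd c \<circ> \<Phi>) has_field_derivative H c (\<Phi> w)) (at w)"
    using flow_deriv[OF f w c(1)] c eq[OF w] by simp
  then have "((snd c \<circ> \<Psi>) has_field_derivative H c (\<Phi> w)) (at w)"
    by (rule has_field_derivative_transform_within_open[OF _ D w]) (simp add: eq)
  then show "((snd c \<circ> \<Psi>) has_field_derivative H c (\<Psi> w)) (at w)" using eq[OF w] by simp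
qed

lemma flow_on_shift:
  assumes f: "flow_on D \<Phi>" and D: "open D" and E: "open E" "(\<lambda>w. a + w) ` E \<subseteq> D"
  shows "flow_on E (\<lambda>w. \<Phi> (a + w))"
  unfolding flow_on_def
proof (intro conjI ballI impI)
  have "continuous_map (top_of_set E) (top_of_set D) (\<lambda>w. a + w)"
    using E(2) by (auto intro!: continuous_intros)
  moreover have "continuous_map (top_of_set D) X \<Phi>" using f by (simp add: flow_on_def)
  ultimately have "continuous_map (top_of_set E) X (\<Phi> \<circ> (\<lambda>w. a + w))"
    by (rule continuous_map_compose)
  then show "continuous_map (top_of_set E) X (\<lambda>w. \<Phi> (a + w))" by (simp add: o_def)
  fix w c assume w: "w \<in> E" and c: "c \<in> A" "\<Phi> (a + w) \<in> fst c"
  have aw: "a + w \<in> D" using E w by auto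
  show "H c (\<Phi> (a + w)) \<noteq> 0" by (rule flow_nz[OF f aw c])
  have d: "((snd c \<circ> \<Phi>) has_field_derivative H c (\<Phi> (a + w))) (at (a + w))"
    by (rule flow_deriv[OF f aw c])
  have "((\<lambda>w. a + w) has_field_derivative 1) (at w)" by (auto intro!: derivative_eq_intros)
  from DERIV_chain[OF d this]
  show "((snd c \<circ> (\<lambda>w. \<Phi> (a + w))) has_field_derivative H c (\<Phi> (a + w))) (at w)"
    by (simp add: o_def)
qed

text \<open>A primitive \<open>T\<close> of \<open>1/H\<close> is a flow box coordinate: in it the field is constant, and flow maps are
  translations.\<close>

lemma straighten:
  assumes c: "c \<in> A" and p: "p \<in> fst c" and nz: "H c p \<noteq> 0"
  obtains s T where "s > 0" "ball (snd c p) s \<subseteq> snd c ` fst c" "inj_on T (ball (snd c p) s)"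
    "\<And>z. z \<in> ball (snd c p) s \<Longrightarrow> in_chart c (H c) z \<noteq> 0"
    "\<And>z. z \<in> ball (snd c p) s \<Longrightarrow> (T has_field_derivative 1 / in_chart c (H c) z) (at z)"
proof -
  let ?h = "in_chart c (H c)" and ?z = "snd c p"
  have h: "?h holomorphic_on snd c ` fst c" by (rule H_holo[OF c])
  have cont: "continuous (at ?z) ?h"
    using h chart_open[OF c] p by (meson continuous_on_eq_continuous_at holomorphic_on_imp_continuous_on image_eqI)
  have hz: "?h ?z \<noteq> 0" using nz c p by simp
  obtain e1 where e1: "e1 > 0" "\<And>z. dist ?z z < e1 \<Longrightarrow> ?h z \<noteq> 0"
    using continuous_at_avoid[OF cont hz] by blast
  obtain e2 where e2: "e2 > 0" "ball ?z e2 \<subseteq> snd c ` fst c"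
    using chart_open[OF c] p open_contains_ball by (metis imageI)
  define e where "e = min e1 e2"
  have e: "e > 0" "ball ?z e \<subseteq> snd c ` fst c" "\<And>z. z \<in> ball ?z e \<Longrightarrow> ?h z \<noteq> 0"
    using e1 e2 by (auto simp: e_def)
  have "(\<lambda>z. 1 / ?h z) holomorphic_on ball ?z e"
    using e by (intro holomorphic_intros holomorphic_on_subset[OF h]) auto
  then obtain T where T0: "\<And>z. z \<in> ball ?z e \<Longrightarrow> (T has_field_derivative 1 / ?h z) (at z within ball ?z e)"
    using holomorphic_convex_primitive'[of "ball ?z e" "\<lambda>z. 1 / ?h z"] by auto
  have T: "(T has_field_derivative 1 / ?h z) (at z)" if "z \<in> ball ?z e" for z
    using T0[OF that] at_within_open[OF that open_ball] by simp
  have holT: "T holomorphic_on ball ?z e" using T0 holomorphic_onI field_differentiable_def by blast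
  have zin: "?z \<in> ball ?z e" using e by simp
  have "deriv T ?z \<noteq> 0" using T[OF zin] hz DERIV_imp_deriv by fastforce
  then obtain s where s: "s > 0" "ball ?z s \<subseteq> ball ?z e" "inj_on T (ball ?z s)"
    using has_complex_derivative_locally_injective[OF holT zin open_ball] by blast
  show ?thesis
  proof (rule that[OF s(1) _ s(3)])
    show "ball ?z s \<subseteq> snd c ` fst c" using s(2) e(2) by blast
    show "in_chart c (H c) z \<noteq> 0" if "z \<in> ball ?z s" for z using that s(2) e(3) by blast
    show "(T has_field_derivative 1 / in_chart c (H c) z) (at z)" if "z \<in> ball ?z s" for z
      using that s(2) T by blast
  qed
qed

text \<open>In a flow box coordinate two flow maps differ by a constant, so the set on which they agree is
  open; it is closed because the surface is a Hausdorff space.\<close>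

lemma flow_unique:
  assumes D: "open D" "connected D" and f: "flow_on D \<Phi>" and g: "flow_on D \<Psi>"
    and w0: "w0 \<in> D" "\<Phi> w0 = \<Psi> w0" and w: "w \<in> D"
  shows "\<Phi> w = \<Psi> w"
proof -
  let ?E = "{x \<in> topspace (top_of_set D). \<Phi> x = \<Psi> x}"
  have "closedin (top_of_set D) ?E"
    by (rule closedin_continuous_maps_eq[OF hausdorff])
      (use f g in \<open>auto simp: flow_on_def\<close>)
  moreover have "openin (top_of_set D) ?E"
  proof -
    have "\<exists>e>0. ball a e \<subseteq> ?E" if a: "a \<in> ?E" for a
    proof -
      have aD: "a \<in> D" and eq: "\<Phi> a = \<Psi> a" using a by auto
      obtain c where c: "c \<in> A" "\<Phi> a \<in> fst c" using chart_at[OF flow_in_topspace[OF f aD]] .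
      obtain s T where s: "s > 0" "ball (snd c (\<Phi> a)) s \<subseteq> snd c ` fst c"
        "inj_on T (ball (snd c (\<Phi> a)) s)"
        "\<And>z. z \<in> ball (snd c (\<Phi> a)) s \<Longrightarrow> in_chart c (H c) z \<noteq> 0"
        "\<And>z. z \<in> ball (snd c (\<Phi> a)) s \<Longrightarrow> (T has_field_derivative 1 / in_chart c (H c) z) (at z)"
        using straighten[OF c flow_nz[OF f aD c]] by blast
      let ?W = "{q \<in> fst c. snd c q \<in> ball (snd c (\<Phi> a)) s}"
      have W: "openin X ?W" "\<Phi> a \<in> ?W" "\<Psi> a \<in> ?W"
        using chart_openin_vimage[OF c(1) open_ball] c s eq by auto
      have "eventually (\<lambda>z. \<Phi> z \<in> ?W) (nhds a)" "eventually (\<lambda>z. \<Psi> z \<in> ?W) (nhds a)"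
        "eventually (\<lambda>z. z \<in> D) (nhds a)"
        using flow_eventually[OF f D(1) aD W(1,2)] flow_eventually[OF g D(1) aD W(1,3)]
          eventually_nhds_in_open[OF D(1) aD] by blast+
      then have "eventually (\<lambda>z. \<Phi> z \<in> ?W \<and> \<Psi> z \<in> ?W \<and> z \<in> D) (nhds a)"
        by eventually_elim simp
      then obtain e where e: "e > 0" "\<And>z. z \<in> ball a e \<Longrightarrow> \<Phi> z \<in> ?W \<and> \<Psi> z \<in> ?W \<and> z \<in> D"
        unfolding eventually_nhds_metric by (auto simp: dist_commute)
      have der: "((T \<circ> (snd c \<circ> \<Theta>)) has_field_derivative 1) (at z)"
        if "flow_on D \<Theta>" "\<Theta> z \<in> ?W" "z \<in> D" for \<Theta> z
      proof -
        have i: "\<Theta> z \<in> fst c" "snd c (\<Theta> z) \<in> ball (snd c (\<Phi> a)) s" using that by auto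
        have "((T \<circ> (snd c \<circ> \<Theta>)) has_field_derivative 1 / in_chart c (H c) (snd c (\<Theta> z)) * H c (\<Theta> z)) (at z)"
          by (rule DERIV_chain) (use s(5)[OF i(2)] flow_deriv[OF that(1,3) c(1) i(1)] in auto)
        then show ?thesis using flow_nz[OF that(1,3) c(1) i(1)] c i by simp
      qed
      have "\<exists>k. \<forall>z\<in>ball a e. (T \<circ> (snd c \<circ> \<Phi>)) z - (T \<circ> (snd c \<circ> \<Psi>)) z = k"
      proof (rule has_field_derivative_zero_constant[OF convex_ball])
        fix z assume z: "z \<in> ball a e"
        have "((\<lambda>z. (T \<circ> (snd c \<circ> \<Phi>)) z - (T \<circ> (snd c \<circ> \<Psi>)) z) has_field_derivative 1 - 1) (at z)"
          by (rule DERIV_diff; rule der) (use f g e(2)[OF z] in auto)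
        then show "((\<lambda>z. (T \<circ> (snd c \<circ> \<Phi>)) z - (T \<circ> (snd c \<circ> \<Psi>)) z) has_field_derivative 0) (at z within ball a e)"
          by (simp add: has_field_derivative_at_within)
      qed
      then have Teq: "T (snd c (\<Phi> z)) = T (snd c (\<Psi> z))" if "z \<in> ball a e" for z
      proof -
        obtain k where k: "\<And>z. z \<in> ball a e \<Longrightarrow> (T \<circ> (snd c \<circ> \<Phi>)) z - (T \<circ> (snd c \<circ> \<Psi>)) z = k"
          using \<open>\<exists>k. _\<close> by blast
        have "a \<in> ball a e" using e(1) by simp
        from k[OF this] have "k = 0" using eq by simp
        with k[OF that] show ?thesis by simp
      qed
      have "\<Phi> z = \<Psi> z" if z: "z \<in> ball a e" for z
      proof -
        have "snd c (\<Phi> z) = snd c (\<Psi> z)"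
          using inj_onD[OF s(3) Teq[OF z]] e(2)[OF z] by auto
        then show ?thesis using e(2)[OF z] chart_inj[OF c(1)] by (auto dest: inj_onD)
      qed
      then show ?thesis using e by (intro exI[of _ e]) auto
    qed
    then have "open ?E" unfolding open_contains_ball by blast
    then show ?thesis by (simp add: open_subset)
  qed
  ultimately have "?E = {} \<or> ?E = D" using D(2) unfolding connected_clopen by blast
  then show ?thesis using w0 w by auto
qed

text \<open>Flow maps are translations in a flow box coordinate, followed by its inverse. The image of the flow
  box contains a disc of radius \<open>2\<delta>\<close>, so for starting points in the disc of radius \<open>\<delta>\<close> the
  translations by less than \<open>\<delta>\<close> stay inside.\<close>

lemma flow_exists_locally:
  assumes c: "c \<in> A" and p: "p \<in> fst c" and nz: "H c p \<noteq> 0"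
  obtains N \<delta> where "openin X N" "p \<in> N" "\<delta> > 0"
    "\<And>q. q \<in> N \<Longrightarrow> \<exists>\<Phi>. flow_on (ball 0 \<delta>) \<Phi> \<and> \<Phi> 0 = q"
proof -
  obtain s T where s: "s > 0" "ball (snd c p) s \<subseteq> snd c ` fst c" "inj_on T (ball (snd c p) s)"
    "\<And>z. z \<in> ball (snd c p) s \<Longrightarrow> in_chart c (H c) z \<noteq> 0"
    "\<And>z. z \<in> ball (snd c p) s \<Longrightarrow> (T has_field_derivative 1 / in_chart c (H c) z) (at z)"
    using straighten[OF assms] by blast
  let ?B = "ball (snd c p) s"
  have holT: "T holomorphic_on ?B"
    unfolding holomorphic_on_def field_differentiable_def
    using s(5) has_field_derivative_at_within by blast
  obtain g where g: "g holomorphic_on (T ` ?B)" "\<And>z. z \<in> ?B \<Longrightarrow> deriv T z * deriv g (T z) = 1"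
     "\<And>z. z \<in> ?B \<Longrightarrow> g (T z) = z"
    using holomorphic_has_inverse[OF holT open_ball s(3)] by metis
  have opT: "open (T ` ?B)" by (rule open_mapping_thm3[OF holT open_ball s(3)])
  have "T (snd c p) \<in> T ` ?B" using s(1) by auto
  then obtain d where d: "d > 0" "ball (T (snd c p)) d \<subseteq> T ` ?B"
    using opT unfolding open_contains_ball by blast
  define \<delta> where "\<delta> = d / 2"
  have contT: "continuous_on ?B T" using holT holomorphic_on_imp_continuous_on by blast
  define V where "V = {z \<in> ?B. T z \<in> ball (T (snd c p)) \<delta>}"
  have "open V" unfolding V_def
    using continuous_open_preimage[OF contT open_ball open_ball] by (simp add: vimage_def Int_def)
  define N where "N = {q \<in> fst c. snd c q \<in> V}"
  show ?thesis
  proof (rule that[of N \<delta>])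
    show "openin X N" unfolding N_def by (rule chart_openin_vimage[OF c \<open>open V\<close>])
    show "p \<in> N" "\<delta> > 0" using p s d by (auto simp: N_def V_def \<delta>_def)
    fix q assume q: "q \<in> N"
    define \<Phi> where "\<Phi> = (\<lambda>w. point_at c (g (T (snd c q) + w)))"
    have qV: "q \<in> fst c" "snd c q \<in> ?B" "T (snd c q) \<in> ball (T (snd c p)) \<delta>"
      using q by (auto simp: N_def V_def)
    have inT: "T (snd c q) + w \<in> T ` ?B" if "w \<in> ball 0 \<delta>" for w :: complex
    proof -
      have "dist (T (snd c p)) (T (snd c q) + w) \<le> dist (T (snd c p)) (T (snd c q)) + dist (T (snd c q)) (T (snd c q) + w)"
        by (rule dist_triangle)
      also have "\<dots> < \<delta> + \<delta>" using qV(3) that by (intro add_strict_mono) (auto simp: dist_norm)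
      finally show ?thesis using d by (auto simp: \<delta>_def)
    qed
    have gB: "g (T (snd c q) + w) \<in> ?B" if "w \<in> ball 0 \<delta>" for w :: complex
      using inT[OF that] g(3) by auto
    have \<Phi>in: "\<Phi> w \<in> fst c" "snd c (\<Phi> w) = g (T (snd c q) + w)" if "w \<in> ball 0 \<delta>" for w :: complex
    proof -
      have "g (T (snd c q) + w) \<in> snd c ` fst c" using gB[OF that] s(2) by blast
      then show "\<Phi> w \<in> fst c" "snd c (\<Phi> w) = g (T (snd c q) + w)"
        unfolding \<Phi>_def by (rule inv_into_into, rule f_inv_into_f)
    qed
    have "flow_on (ball 0 \<delta>) \<Phi>"
    proof (rule flow_onI[OF open_ball])
      have "continuous_on (ball 0 \<delta>) (\<lambda>w. g (T (snd c q) + w))"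
        by (rule continuous_on_compose2[OF holomorphic_on_imp_continuous_on[OF g(1)]])
          (intro continuous_intros, use inT in blast)
      then have "continuous_map (top_of_set (ball 0 \<delta>)) (top_of_set (snd c ` fst c)) (\<lambda>w. g (T (snd c q) + w))"
        using gB s(2) by auto
      from continuous_map_compose[OF this chart_inv_continuous[OF c]]
      show "continuous_map (top_of_set (ball 0 \<delta>)) X \<Phi>" by (simp add: \<Phi>_def o_def)
      fix w :: complex assume w: "w \<in> ball 0 \<delta>"
      let ?z = "g (T (snd c q) + w)"
      have Tz: "T ?z = T (snd c q) + w" using inT[OF w] g(3) by auto
      have "(g has_field_derivative deriv g (T (snd c q) + w)) (at (T (snd c q) + w))"
        by (rule holomorphic_derivI[OF g(1) opT inT[OF w]])
      moreover have "deriv g (T (snd c q) + w) = in_chart c (H c) ?z"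
        using g(2)[OF gB[OF w]] DERIV_imp_deriv[OF s(5)[OF gB[OF w]]] s(4)[OF gB[OF w]] Tz
        by (simp add: field_simps)
      ultimately have gd: "(g has_field_derivative in_chart c (H c) ?z) (at (T (snd c q) + w))" by simp
      have "((\<lambda>w. T (snd c q) + w) has_field_derivative 1) (at w)" by (auto intro!: derivative_eq_intros)
      from DERIV_chain2[OF gd this]
      have "((\<lambda>w. g (T (snd c q) + w)) has_field_derivative in_chart c (H c) ?z) (at w)" by simp
      then have "((snd c \<circ> \<Phi>) has_field_derivative in_chart c (H c) ?z) (at w)"
        by (rule has_field_derivative_transform_within_open[OF _ open_ball w]) (simp add: \<Phi>in)
      moreover have "in_chart c (H c) ?z = H c (\<Phi> w)"
        using \<Phi>in[OF w] c in_chart_apply[OF c, of "\<Phi> w" "H c"] by simp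
      ultimately show "\<exists>c\<in>A. \<Phi> w \<in> fst c \<and> H c (\<Phi> w) \<noteq> 0 \<and>
        ((snd c \<circ> \<Phi>) has_field_derivative H c (\<Phi> w)) (at w)"
        using c \<Phi>in[OF w] s(4)[OF gB[OF w]] by (intro bexI[of _ c]) auto
    qed
    moreover have "\<Phi> 0 = q" using g(3)[OF qV(2)] c qV by (simp add: \<Phi>_def)
    ultimately show "\<exists>\<Phi>. flow_on (ball 0 \<delta>) \<Phi> \<and> \<Phi> 0 = q" by blast
  qed
qed

lemma flow_glue:
  assumes op: "\<And>i. i \<in> I \<Longrightarrow> open (D i)" and fl: "\<And>i. i \<in> I \<Longrightarrow> flow_on (D i) (\<Phi> i)"
    and agree: "\<And>i j w. \<lbrakk>i \<in> I; j \<in> I; w \<in> D i; w \<in> D j\<rbrakk> \<Longrightarrow> \<Phi> i w = \<Phi> j w"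
  obtains \<Psi> where "flow_on (\<Union>i\<in>I. D i) \<Psi>" "\<And>i w. \<lbrakk>i \<in> I; w \<in> D i\<rbrakk> \<Longrightarrow> \<Psi> w = \<Phi> i w"
proof -
  define \<Psi> where "\<Psi> = (\<lambda>w. \<Phi> (SOME i. i \<in> I \<and> w \<in> D i) w)"
  have eq: "\<Psi> w = \<Phi> i w" if i: "i \<in> I" "w \<in> D i" for i w
  proof -
    have "(SOME i. i \<in> I \<and> w \<in> D i) \<in> I \<and> w \<in> D (SOME i. i \<in> I \<and> w \<in> D i)"
      by (rule someI[of _ i]) (use i in simp)
    then show ?thesis unfolding \<Psi>_def using i by (intro agree) auto
  qed
  have loc: "flow_on (D i) \<Psi>" if "i \<in> I" for i
    by (rule flow_on_cong[OF op[OF that] fl[OF that]]) (rule eq[OF that])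
  have "continuous_map (top_of_set (\<Union>i\<in>I. D i)) X \<Psi>"
    unfolding continuous_map_def
  proof (intro conjI allI impI)
    show "\<Psi> \<in> topspace (top_of_set (\<Union>i\<in>I. D i)) \<rightarrow> topspace X"
      using flow_in_topspace[OF loc] by auto
    fix W assume W: "openin X W"
    have op': "open {x \<in> D i. \<Psi> x \<in> W}" if "i \<in> I" for i
    proof -
      have "openin (top_of_set (D i)) {x \<in> topspace (top_of_set (D i)). \<Psi> x \<in> W}"
        using loc[OF that] W unfolding flow_on_def by (intro openin_continuous_map_preimage) auto
      then show ?thesis using op[OF that] openin_open_trans by auto
    qed
    have "open (\<Union>i\<in>I. {x \<in> D i. \<Psi> x \<in> W})" by (rule open_UN) (use op' in blast)
    moreover have "{x \<in> topspace (top_of_set (\<Union>i\<in>I. D i)). \<Psi> x \<in> W} = (\<Union>i\<in>I. {x \<in> D i. \<Psi> x \<in> W})"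
      by auto
    ultimately show "openin (top_of_set (\<Union>i\<in>I. D i)) {x \<in> topspace (top_of_set (\<Union>i\<in>I. D i)). \<Psi> x \<in> W}"
      by (auto intro: open_subset)
  qed
  then have "flow_on (\<Union>i\<in>I. D i) \<Psi>"
    using loc unfolding flow_on_def by blast
  then show ?thesis using eq that by blast
qed

lemma flow_maximal_disc:
  assumes ex: "flow_on (ball 0 r0) \<Phi>0" "\<Phi>0 0 = q" "r0 > 0"
    and bd: "\<And>r \<Phi>. flow_on (ball 0 r) \<Phi> \<Longrightarrow> \<Phi> 0 = q \<Longrightarrow> r \<le> B"
  obtains \<rho> \<Phi> where "\<rho> > 0" "flow_on (ball 0 \<rho>) \<Phi>" "\<Phi> 0 = q"
    "\<And>r \<Psi>. flow_on (ball 0 r) \<Psi> \<Longrightarrow> \<Psi> 0 = q \<Longrightarrow> r \<le> \<rho>"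
proof -
  define R where "R = {r. 0 < r \<and> (\<exists>\<Phi>. flow_on (ball 0 r) \<Phi> \<and> \<Phi> 0 = q)}"
  have r0: "r0 \<in> R" using ex by (auto simp: R_def)
  have bdd: "bdd_above R" using bd by (auto simp: R_def bdd_above_def)
  define F where "F = (\<lambda>r. SOME \<Phi>. flow_on (ball 0 r) \<Phi> \<and> \<Phi> 0 = q)"
  have F: "flow_on (ball 0 r) (F r)" "F r 0 = q" "r > 0" if "r \<in> R" for r
  proof -
    have "\<exists>\<Phi>. flow_on (ball 0 r) \<Phi> \<and> \<Phi> 0 = q" using that by (auto simp: R_def)
    from someI_ex[OF this] show "flow_on (ball 0 r) (F r)" "F r 0 = q" by (auto simp: F_def)
    show "r > 0" using that by (simp add: R_def)
  qed
  obtain \<Psi> where \<Psi>: "flow_on (\<Union>r\<in>R. ball 0 r) \<Psi>" "\<And>i w. \<lbrakk>i \<in> R; w \<in> ball 0 i\<rbrakk> \<Longrightarrow> \<Psi> w = F i w"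
  proof (rule flow_glue[where I = R and D = "\<lambda>r. ball 0 r" and \<Phi> = F])
    fix r r' :: real and w :: complex
    assume r: "r \<in> R" and r': "r' \<in> R" and w: "w \<in> ball 0 r" "w \<in> ball 0 r'"
    show "F r w = F r' w"
    proof (rule flow_unique[of "ball 0 (min r r')" "F r" "F r'" 0])
      show "flow_on (ball 0 (min r r')) (F r)" by (rule flow_on_subset[OF F(1)[OF r]]) auto
      show "flow_on (ball 0 (min r r')) (F r')" by (rule flow_on_subset[OF F(1)[OF r']]) auto
    qed (use w F r r' in auto)
  qed (use F in auto)
  have U: "(\<Union>r\<in>R. ball 0 r) = ball (0::complex) (Sup R)"
  proof (intro equalityI subsetI)
    fix w :: complex assume "w \<in> (\<Union>r\<in>R. ball 0 r)"
    then obtain r where "r \<in> R" "norm w < r" by auto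
    then show "w \<in> ball 0 (Sup R)" using cSup_upper[OF _ bdd, of r] by simp
  next
    fix w :: complex assume "w \<in> ball 0 (Sup R)"
    then obtain r where "r \<in> R" "norm w < r" using less_cSup_iff[of R "norm w"] r0 bdd by auto
    then show "w \<in> (\<Union>r\<in>R. ball 0 r)" by auto
  qed
  show ?thesis
  proof (rule that)
    show "Sup R > 0" using cSup_upper[OF r0 bdd] ex(3) by linarith
    show "flow_on (ball 0 (Sup R)) \<Psi>" using \<Psi>(1) U by simp
    show "\<Psi> 0 = q" using \<Psi>(2)[OF r0] F[OF r0] by simp
    show "r \<le> Sup R" if "flow_on (ball 0 r) \<Theta>" "\<Theta> 0 = q" for r \<Theta>
    proof (cases "r > 0")
      case True
      then have "r \<in> R" using that by (auto simp: R_def)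
      then show ?thesis using cSup_upper bdd by blast
    qed (use \<open>Sup R > 0\<close> in linarith)
  qed
qed

text \<open>If all discs centred on the circle of radius \<open>r/2\<close> have radius at least \<open>3r/4\<close>, then they cover the
  larger disc of radius \<open>5r/4\<close>. Any two of them agree where they meet, because the midpoint of their
  centres lies in both and in the original disc.\<close>

lemma flow_extend:
  assumes r: "r > 0" and f: "flow_on (ball 0 r) \<Phi>"
    and ext: "\<And>c. norm c = r / 2 \<Longrightarrow> \<exists>\<Psi>. flow_on (ball 0 (3 * r / 4)) \<Psi> \<and> \<Psi> 0 = \<Phi> c"
  obtains \<Psi> where "flow_on (ball 0 (5 * r / 4)) \<Psi>" "\<Psi> 0 = \<Phi> 0"
proof -
  define G where "G = (\<lambda>c. SOME \<Psi>. flow_on (ball 0 (3 * r / 4)) \<Psi> \<and> \<Psi> 0 = \<Phi> c)"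
  have G: "flow_on (ball 0 (3 * r / 4)) (G c)" "G c 0 = \<Phi> c" if "norm c = r / 2" for c
    using someI_ex[OF ext[OF that]] by (auto simp: G_def)
  define C where "C = {c::complex. norm c = r / 2}"
  define D where "D = (\<lambda>c::complex. if c = 0 then ball (0::complex) r else ball c (3 * r / 4))"
  define F where "F = (\<lambda>(c::complex) w. if c = 0 then \<Phi> w else G c (w - c))"
  have C0: "0 \<notin> C" using r by (auto simp: C_def)
  have fl: "flow_on (D c) (F c)" if "c \<in> insert 0 C" for c
  proof (cases "c = 0")
    case True then show ?thesis using f by (simp add: D_def F_def)
  next
    case False
    with that have c: "norm c = r / 2" by (simp add: C_def)
    have "flow_on (ball c (3 * r / 4)) (\<lambda>w. G c (- c + w))"
      by (rule flow_on_shift[OF G(1)[OF c]]) (auto simp: dist_norm norm_minus_commute)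
    then show ?thesis using False by (simp add: D_def F_def)
  qed
  have base: "F c w = \<Phi> w" if c: "c \<in> C" and w: "w \<in> D c" "norm w < r" for c w
  proof (rule flow_unique[of "ball c (3 * r / 4) \<inter> ball 0 r" "F c" \<Phi> c])
    have cn: "norm c = r / 2" "c \<noteq> 0" using c C0 by (auto simp: C_def)
    show "connected (ball c (3 * r / 4) \<inter> ball 0 r)"
      by (intro convex_connected convex_Int convex_ball)
    show "flow_on (ball c (3 * r / 4) \<inter> ball 0 r) (F c)"
      by (rule flow_on_subset[OF fl[of c]]) (use c cn in \<open>auto simp: D_def\<close>)
    show "flow_on (ball c (3 * r / 4) \<inter> ball 0 r) \<Phi>"
      by (rule flow_on_subset[OF f]) auto
    show "c \<in> ball c (3 * r / 4) \<inter> ball 0 r" using cn r by auto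
    show "F c c = \<Phi> c" using G(2)[OF cn(1)] cn by (simp add: F_def)
    show "w \<in> ball c (3 * r / 4) \<inter> ball 0 r" using w cn by (auto simp: D_def)
  qed auto
  have agC: "F c w = F d w" if c: "c \<in> C" "d \<in> C" and w: "w \<in> D c" "w \<in> D d" for c d w
  proof (rule flow_unique[of "ball c (3 * r / 4) \<inter> ball d (3 * r / 4)" "F c" "F d" "(c + d) / 2"])
    have cn: "norm c = r / 2" "c \<noteq> 0" "norm d = r / 2" "d \<noteq> 0" using c C0 by (auto simp: C_def)
    show "connected (ball c (3 * r / 4) \<inter> ball d (3 * r / 4))"
      by (intro convex_connected convex_Int convex_ball)
    show "flow_on (ball c (3 * r / 4) \<inter> ball d (3 * r / 4)) (F c)"
      by (rule flow_on_subset[OF fl[of c]]) (use c cn in \<open>auto simp: D_def\<close>)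
    show "flow_on (ball c (3 * r / 4) \<inter> ball d (3 * r / 4)) (F d)"
      by (rule flow_on_subset[OF fl[of d]]) (use c cn in \<open>auto simp: D_def\<close>)
    have n1: "norm ((c - d) / 2) \<le> r / 2" "norm ((c + d) / 2) \<le> r / 2"
      using norm_triangle_ineq4[of c d] norm_triangle_ineq[of c d] cn by (auto simp: norm_divide)
    have m: "dist c ((c + d) / 2) \<le> r / 2" "dist d ((c + d) / 2) \<le> r / 2"
    proof -
      have "c - (c + d) / 2 = (c - d) / 2" "d - (c + d) / 2 = - ((c - d) / 2)" by (simp_all add: field_simps)
      then show "dist c ((c + d) / 2) \<le> r / 2" "dist d ((c + d) / 2) \<le> r / 2"
        using n1 by (simp_all only: dist_norm norm_minus_cancel)
    qed
    then show mid: "(c + d) / 2 \<in> ball c (3 * r / 4) \<inter> ball d (3 * r / 4)" using r by auto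
    have "norm ((c + d) / 2) < r" using n1 r by linarith
    then show "F c ((c + d) / 2) = F d ((c + d) / 2)"
      using base[OF c(1), of "(c + d) / 2"] base[OF c(2), of "(c + d) / 2"] mid cn by (auto simp: D_def)
    show "w \<in> ball c (3 * r / 4) \<inter> ball d (3 * r / 4)" using w cn by (auto simp: D_def)
  qed auto
  obtain \<Psi> where \<Psi>: "flow_on (\<Union>c\<in>insert 0 C. D c) \<Psi>"
    "\<And>i w. \<lbrakk>i \<in> insert 0 C; w \<in> D i\<rbrakk> \<Longrightarrow> \<Psi> w = F i w"
  proof (rule flow_glue[where I = "insert 0 C" and D = D and \<Phi> = F])
    fix c d w assume c: "c \<in> insert 0 C" "d \<in> insert 0 C" and w: "w \<in> D c" "w \<in> D d"
    have F0: "F 0 = \<Phi>" and D0: "D 0 = ball 0 r" by (auto simp: F_def D_def)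
    show "F c w = F d w"
      using base[of c w] base[of d w] agC[of c d w] c w F0 D0
      by (cases "c = 0"; cases "d = 0") auto
  qed (use fl in \<open>auto simp: D_def\<close>)
  have sub: "ball 0 (5 * r / 4) \<subseteq> (\<Union>c\<in>insert 0 C. D c)"
  proof
    fix w :: complex assume w: "w \<in> ball 0 (5 * r / 4)"
    show "w \<in> (\<Union>c\<in>insert 0 C. D c)"
    proof (cases "norm w < r")
      case True then show ?thesis by (intro UN_I[of 0]) (auto simp: D_def)
    next
      case False
      define c where "c = of_real (r / 2 / norm w) * w"
      have nw: "norm w > 0" using False r by linarith
      have "norm c = r / 2" using nw r by (simp add: c_def norm_mult norm_divide)
      then have cC: "c \<in> C" by (simp add: C_def)
      have "w - c = of_real (1 - r / 2 / norm w) * w" by (simp add: c_def algebra_simps)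
      then have "norm (w - c) = \<bar>1 - r / 2 / norm w\<bar> * norm w" by (simp only: norm_mult norm_of_real)
      also have "1 - r / 2 / norm w \<ge> 0" using False nw r by (simp add: field_simps)
      then have "\<bar>1 - r / 2 / norm w\<bar> * norm w = norm w - r / 2" using nw by (simp add: field_simps)
      finally have "norm (w - c) < 3 * r / 4" using w by simp
      then have "w \<in> D c" using cC C0 by (auto simp: D_def dist_norm norm_minus_commute)
      then show ?thesis using cC by blast
    qed
  qed
  show ?thesis
  proof (rule that)
    show "flow_on (ball 0 (5 * r / 4)) \<Psi>" by (rule flow_on_subset[OF \<Psi>(1) sub])
    show "\<Psi> 0 = \<Phi> 0" using \<Psi>(2)[of 0 0] r by (simp add: D_def F_def)
  qed
qed

end

section \<open>Rectifiable curves in a conformal metric\<close>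

lemma C1_differentiable_on_cong_open:
  fixes g h :: "real \<Rightarrow> 'b::real_normed_vector"
  assumes "open N" "g C1_differentiable_on N" "\<And>t. t \<in> N \<Longrightarrow> h t = g t"
  shows "h C1_differentiable_on N"
proof -
  obtain D where D: "\<And>x. x \<in> N \<Longrightarrow> (g has_vector_derivative D x) (at x)" "continuous_on N D"
    using assms(2) by (auto simp: C1_differentiable_on_def)
  have "(h has_vector_derivative D x) (at x)" if "x \<in> N" for x
    by (rule has_vector_derivative_transform_within_open[OF D(1)[OF that] assms(1) that])
      (simp add: assms(3))
  then show ?thesis using D(2) unfolding C1_differentiable_on_def by blast
qed

abbreviation C1_near :: "(real \<Rightarrow> 'b::real_normed_vector) \<Rightarrow> real \<Rightarrow> bool" where
  "C1_near g t \<equiv> \<exists>N. open N \<and> t \<in> N \<and> g C1_differentiable_on N"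

lemma C1_differentiable_on_locally:
  fixes g :: "real \<Rightarrow> 'b::real_normed_vector"
  assumes "\<And>t. t \<in> S \<Longrightarrow> C1_near g t"
  shows "g C1_differentiable_on S"
  unfolding C1_differentiable_on_eq
proof (intro conjI ballI)
  fix t assume "t \<in> S"
  then obtain N where N: "open N" "t \<in> N" "g C1_differentiable_on N" using assms by blast
  then show "g differentiable at t" by (simp add: C1_differentiable_on_eq)
next
  show "continuous_on S (\<lambda>x. vector_derivative g (at x))"
    unfolding continuous_on_eq_continuous_within
  proof
    fix t assume "t \<in> S"
    then obtain N where N: "open N" "t \<in> N" "g C1_differentiable_on N" using assms by blast
    then have "continuous (at t) (\<lambda>x. vector_derivative g (at x))"
      by (simp add: C1_differentiable_on_eq continuous_on_eq_continuous_at)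
    then show "continuous (at t within S) (\<lambda>x. vector_derivative g (at x))"
      by (rule continuous_at_imp_continuous_within)
  qed
qed

lemma C1_differentiable_on_affine:
  fixes g :: "real \<Rightarrow> 'b::real_normed_vector" and m b :: real
  assumes "g C1_differentiable_on N"
  shows "(\<lambda>t. g (m * t + b)) C1_differentiable_on {t. m * t + b \<in> N}"
proof -
  obtain D where D: "\<And>x. x \<in> N \<Longrightarrow> (g has_vector_derivative D x) (at x)" "continuous_on N D"
    using assms by (auto simp: C1_differentiable_on_def)
  have "((\<lambda>t. g (m * t + b)) has_vector_derivative m *\<^sub>R D (m * t + b)) (at t)" if "m * t + b \<in> N" for t
  proof -
    have "((\<lambda>t. m * t + b) has_vector_derivative m) (at t)"
      by (auto intro!: derivative_eq_intros)
    from vector_diff_chain_at[OF this D(1)[OF that]] show ?thesis by (simp add: o_def)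
  qed
  moreover have "continuous_on {t. m * t + b \<in> N} (\<lambda>t. m *\<^sub>R D (m * t + b))"
    by (intro continuous_intros continuous_on_compose2[OF D(2)]) auto
  ultimately show ?thesis
    unfolding C1_differentiable_on_def
    by (intro exI[of _ "\<lambda>t. m *\<^sub>R D (m * t + b)"]) simp
qed

context surface
begin

lemma pathin_eventually:
  assumes "pathin X \<gamma>" "t \<in> {0<..<1}" "openin X W" "\<gamma> t \<in> W"
  shows "eventually (\<lambda>s. \<gamma> s \<in> W) (nhds t)"
  by (rule eventually_in_openin[OF assms(1)[unfolded pathin_def] open_greaterThanLessThan _ assms(2-4)])
    auto

text \<open>The local form of the definition is stable under reparametrisation and concatenation.\<close>

lemma piecewise_C1_curve_iff:
  "piecewise_C1_curve X A \<gamma> \<longleftrightarrow> pathin X \<gamma> \<and>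
     (\<exists>S. finite S \<and> (\<forall>c\<in>A. \<forall>t\<in>{0<..<1} - S. \<gamma> t \<in> fst c \<longrightarrow> C1_near (snd c \<circ> \<gamma>) t))"
proof (intro iffI conjI)
  assume "piecewise_C1_curve X A \<gamma>"
  then obtain S where \<gamma>: "pathin X \<gamma>" and S: "finite S"
    "\<And>c. c \<in> A \<Longrightarrow> (snd c \<circ> \<gamma>) C1_differentiable_on {t \<in> {0<..<1} - S. \<gamma> t \<in> fst c}"
    unfolding piecewise_C1_curve_def by fastforce
  show "pathin X \<gamma>" by fact
  have "C1_near (snd c \<circ> \<gamma>) t"
    if c: "c \<in> A" and t: "t \<in> {0<..<1} - S" "\<gamma> t \<in> fst c" for c t
  proof (intro exI conjI)
    show "open {t \<in> {0<..<1} - S. \<gamma> t \<in> fst c}"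
    proof -
      have "openin (top_of_set {0<..<1}) {t \<in> topspace (top_of_set {0<..<1}). \<gamma> t \<in> fst c}"
      proof (rule openin_continuous_map_preimage[OF _ chart_openin[OF c]])
        show "continuous_map (top_of_set {0<..<1}) X \<gamma>"
          by (rule continuous_map_from_subtopology_mono[OF \<gamma>[unfolded pathin_def]]) auto
      qed
      then have "openin (top_of_set {0<..<1}) {t \<in> {0<..<1}. \<gamma> t \<in> fst c}" by simp
      then have "open {t \<in> {0<..<1}. \<gamma> t \<in> fst c}"
        by (rule openin_open_trans) (rule open_greaterThanLessThan)
      then have "open ({t \<in> {0<..<1}. \<gamma> t \<in> fst c} - S)"
        by (rule open_Diff[OF _ finite_imp_closed[OF S(1)]])
      moreover have "{t \<in> {0<..<1}. \<gamma> t \<in> fst c} - S = {t \<in> {0<..<1} - S. \<gamma> t \<in> fst c}" by auto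
      ultimately show ?thesis by simp
    qed
  qed (use S(2)[OF c] t in auto)
  with S(1) show "\<exists>S. finite S \<and> (\<forall>c\<in>A. \<forall>t\<in>{0<..<1} - S. \<gamma> t \<in> fst c \<longrightarrow> C1_near (snd c \<circ> \<gamma>) t)" by blast
next
  assume *: "pathin X \<gamma> \<and>
     (\<exists>S. finite S \<and> (\<forall>c\<in>A. \<forall>t\<in>{0<..<1} - S. \<gamma> t \<in> fst c \<longrightarrow> C1_near (snd c \<circ> \<gamma>) t))"
  then obtain S where S: "finite S" "\<And>c t. c\<in>A \<Longrightarrow> t\<in>{0<..<1} - S \<Longrightarrow> \<gamma> t \<in> fst c \<Longrightarrow>
        C1_near (snd c \<circ> \<gamma>) t" by blast
  have "(snd c \<circ> \<gamma>) C1_differentiable_on {t \<in> {0<..<1} - S. \<gamma> t \<in> fst c}" if "c \<in> A" for c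
    by (rule C1_differentiable_on_locally) (use S(2)[OF that] in blast)
  then have "\<forall>(U, \<phi>)\<in>A. (\<phi> \<circ> \<gamma>) C1_differentiable_on {t \<in> {0<..<1} - S. \<gamma> t \<in> U}" by force
  moreover have "pathin X \<gamma>" using * by (rule conjunct1)
  ultimately show "piecewise_C1_curve X A \<gamma>"
    unfolding piecewise_C1_curve_def using S(1) by blast
qed

end

text \<open>In every chart the metric induced by \<open>f\<close> is \<open>\<mu>\<^sup>2 |dz|\<^sup>2\<close>. This is expressed through the speed of
  curves, the form in which the metric enters the induced distance.\<close>

locale metric_surface = surface X A for X :: "'a topology" and A +
  fixes f :: "'a \<Rightarrow> 'b::euclidean_space" and \<mu> :: "'a chart \<Rightarrow> 'a \<Rightarrow> real"
  assumes speed: "\<lbrakk>c \<in> A; eventually (\<lambda>s. \<gamma> s \<in> fst c) (nhds t);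
      ((snd c \<circ> \<gamma>) has_vector_derivative D) (at (t::real))\<rbrakk> \<Longrightarrow>
      norm (vector_derivative (f \<circ> \<gamma>) (at t)) = \<mu> c (\<gamma> t) * norm D"
    and mu_cont: "c \<in> A \<Longrightarrow> continuous_on (snd c ` fst c) (in_chart c (\<mu> c))"
    and mu_pos: "c \<in> A \<Longrightarrow> p \<in> fst c \<Longrightarrow> \<mu> c p > 0"
begin

definition rect_curve :: "(real \<Rightarrow> 'a) \<Rightarrow> real \<Rightarrow> bool" where
  "rect_curve \<gamma> L \<longleftrightarrow> piecewise_C1_curve X A \<gamma> \<and>
     ((\<lambda>t. norm (vector_derivative (f \<circ> \<gamma>) (at t))) has_integral L) {0..1}"

definition joined :: "'a \<Rightarrow> 'a \<Rightarrow> real \<Rightarrow> bool" where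
  "joined p q L \<longleftrightarrow> (\<exists>\<gamma>. rect_curve \<gamma> L \<and> \<gamma> 0 = p \<and> \<gamma> 1 = q)"

lemma induced_dist_eq: "induced_dist X A f p q = Inf {L. joined p q L}"
  unfolding induced_dist_def joined_def rect_curve_def by (simp add: conj_ac)

lemma rect_curve_nonneg: "rect_curve \<gamma> L \<Longrightarrow> 0 \<le> L"
  unfolding rect_curve_def by (elim conjE, erule has_integral_nonneg) simp

lemma joined_nonneg: "joined p q L \<Longrightarrow> 0 \<le> L"
  using rect_curve_nonneg by (auto simp: joined_def)

lemma induced_dist_le: "joined p q L \<Longrightarrow> induced_dist X A f p q \<le> L"
  unfolding induced_dist_eq
proof (rule cInf_lower)
  show "bdd_below {L. joined p q L}" by (rule bdd_belowI[of _ 0]) (simp add: joined_nonneg)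
qed simp

lemma induced_dist_less:
  assumes "joined p q L0" "induced_dist X A f p q < \<epsilon>"
  shows "\<exists>L<\<epsilon>. joined p q L"
proof -
  have "{L. joined p q L} \<noteq> {}" using assms(1) by blast
  from cInf_lessD[OF this assms(2)[unfolded induced_dist_eq]] show ?thesis by blast
qed

lemma curve_deriv:
  assumes N: "open N" "t \<in> N" "(snd c \<circ> \<gamma>) C1_differentiable_on N"
  shows "((snd c \<circ> \<gamma>) has_vector_derivative vector_derivative (snd c \<circ> \<gamma>) (at t)) (at t)"
  using assms by (simp add: C1_differentiable_on_eq vector_derivative_works)

text \<open>The derivative of \<open>f \<circ> \<gamma>\<close> is only known through its norm, which by the assumption \<open>speed\<close> is a multiple of
  the norm of the coordinate velocity; the latter obeys the chain rule.\<close>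

lemma speed_affine:
  assumes c: "c \<in> A" and \<gamma>: "pathin X \<gamma>" and u: "m * t + b \<in> {0<..<1}" "\<gamma> (m * t + b) \<in> fst c"
    and N: "open N" "m * t + b \<in> N" "(snd c \<circ> \<gamma>) C1_differentiable_on N"
    and eq: "eventually (\<lambda>s. \<eta> s = \<gamma> (m * s + b)) (nhds t)"
  shows "norm (vector_derivative (f \<circ> \<eta>) (at t)) =
     \<bar>m\<bar> * norm (vector_derivative (f \<circ> \<gamma>) (at (m * t + b)))"
proof -
  define D where "D = vector_derivative (snd c \<circ> \<gamma>) (at (m * t + b))"
  have D: "((snd c \<circ> \<gamma>) has_vector_derivative D) (at (m * t + b))"
    unfolding D_def by (rule curve_deriv[OF N])
  have ev: "eventually (\<lambda>s. \<gamma> s \<in> fst c) (nhds (m * t + b))"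
    by (rule pathin_eventually[OF \<gamma> u(1) chart_openin[OF c] u(2)])
  have lim: "filterlim (\<lambda>s. m * s + b) (nhds (m * t + b)) (nhds t)"
    by (intro tendsto_intros filterlim_ident)
  have ev': "eventually (\<lambda>s. \<gamma> (m * s + b) \<in> fst c) (nhds t)"
    using filterlim_iff[THEN iffD1, OF lim] ev by blast
  have ev\<eta>: "eventually (\<lambda>s. \<eta> s \<in> fst c) (nhds t)"
    using eq ev' by eventually_elim simp
  have "((\<lambda>s. m * s + b) has_vector_derivative m) (at t)" by (auto intro!: derivative_eq_intros)
  from vector_diff_chain_at[OF this D]
  have "(((snd c \<circ> \<gamma>) \<circ> (\<lambda>s. m * s + b)) has_vector_derivative m *\<^sub>R D) (at t)" .
  moreover have "eventually (\<lambda>s. ((snd c \<circ> \<gamma>) \<circ> (\<lambda>s. m * s + b)) s = (snd c \<circ> \<eta>) s) (nhds t)"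
    using eq by eventually_elim simp
  ultimately have D\<eta>: "((snd c \<circ> \<eta>) has_vector_derivative m *\<^sub>R D) (at t)"
    using eventually_nhds_x_imp_x[OF eq]
    by (subst has_vector_derivative_cong_ev[symmetric, where f = "(snd c \<circ> \<gamma>) \<circ> (\<lambda>s. m * s + b)"])
      (auto elim: eventually_mono)
  show ?thesis
    using speed[OF c ev\<eta> D\<eta>] speed[OF c ev D] eventually_nhds_x_imp_x[OF eq] by simp
qed

text \<open>This is the common part of reversing a curve (\<open>m = -1\<close>) and of joining two curves (\<open>m = 2\<close>).\<close>

lemma affine_piece:
  assumes \<gamma>: "rect_curve \<gamma> L" and m: "m \<noteq> 0" and uv: "u \<le> v"
    and ends: "(\<lambda>t. m * t + b) ` {u..v} = {0..1}"
    and eq: "\<And>t. t \<in> {u<..<v} \<Longrightarrow> \<eta> t = \<gamma> (m * t + b)"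
  shows "((\<lambda>t. norm (vector_derivative (f \<circ> \<eta>) (at t))) has_integral L) {u..v}"
    and "\<exists>S. finite S \<and> (\<forall>c\<in>A. \<forall>t\<in>{u<..<v} - S. \<eta> t \<in> fst c \<longrightarrow> C1_near (snd c \<circ> \<eta>) t)"
proof -
  let ?n = "\<lambda>t. norm (vector_derivative (f \<circ> \<gamma>) (at t))"
  have \<gamma>p: "pathin X \<gamma>" and I: "(?n has_integral L) {0..1}"
    using \<gamma> by (auto simp: rect_curve_def piecewise_C1_curve_def)
  obtain S where S: "finite S" "\<And>c t. c\<in>A \<Longrightarrow> t\<in>{0<..<1} - S \<Longrightarrow> \<gamma> t \<in> fst c \<Longrightarrow>
        C1_near (snd c \<circ> \<gamma>) t"
    using \<gamma> unfolding rect_curve_def piecewise_C1_curve_iff by blast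
  \<comment> \<open>exceptional parameters: those of \<open>\<gamma>\<close> and its end points, transported back\<close>
  define S' where "S' = (\<lambda>s. (s - b) / m) ` (S \<union> {0, 1})"
  have S': "finite S'" using S(1) by (simp add: S'_def)
  have good: "m * t + b \<in> {0<..<1} - S" if "t \<in> {u<..<v} - S'" for t
  proof -
    have t: "t = ((m * t + b) - b) / m" using m by simp
    have "m * t + b \<in> (\<lambda>t. m * t + b) ` {u..v}" using that by (intro imageI) auto
    then have "m * t + b \<in> {0..1}" unfolding ends .
    moreover have "m * t + b \<notin> S \<union> {0, 1}"
    proof
      assume "m * t + b \<in> S \<union> {0, 1}"
      then have "t \<in> S'" unfolding S'_def using t by (metis image_eqI)
      then show False using that by simp
    qed
    ultimately show ?thesis by (auto simp: less_le)
  qed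
  have evq: "eventually (\<lambda>s. \<eta> s = \<gamma> (m * s + b)) (nhds t)" if "t \<in> {u<..<v}" for t
    using eventually_nhds_in_open[OF open_greaterThanLessThan that] by eventually_elim (rule eq)
  have neq: "norm (vector_derivative (f \<circ> \<eta>) (at t)) = \<bar>m\<bar> * ?n (m * t + b)"
    if t: "t \<in> {u..v} - (S' \<union> {u, v})" for t
  proof -
    have t': "t \<in> {u<..<v} - S'" using t by auto
    have "\<gamma> (m * t + b) \<in> topspace X"
      using \<gamma>p good[OF t'] by (auto simp: pathin_def continuous_map_def)
    then obtain c where c: "c \<in> A" "\<gamma> (m * t + b) \<in> fst c" using chart_at by blast
    obtain N where N: "open N" "m * t + b \<in> N" "(snd c \<circ> \<gamma>) C1_differentiable_on N"
      using S(2)[OF c(1) good[OF t'] c(2)] by blast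
    show ?thesis
      by (rule speed_affine[OF c(1) \<gamma>p _ c(2) N evq]) (use good[OF t'] t' in auto)
  qed
  have int: "((\<lambda>t. \<bar>m\<bar> * ?n (m * t + b)) has_integral L) {u..v}"
  proof -
    have "((\<lambda>x. ?n (m *\<^sub>R x + b)) has_integral (1 / \<bar>m\<bar> ^ DIM(real)) *\<^sub>R L) ((\<lambda>x. (1/m) *\<^sub>R x + - ((1/m) *\<^sub>R b)) ` cbox 0 1)"
      by (rule has_integral_affinity[OF I[folded cbox_interval] m])
    moreover have "(\<lambda>x. (1/m) *\<^sub>R x + - ((1/m) *\<^sub>R b)) ` cbox 0 1 = {u..v}"
    proof -
      have "(\<lambda>x. (1/m) *\<^sub>R x + - ((1/m) *\<^sub>R b)) ` cbox 0 1 = (\<lambda>x. (x - b) / m) ` (\<lambda>t. m * t + b) ` {u..v}"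
        unfolding ends cbox_interval by (intro image_cong) (auto simp: diff_divide_distrib)
      also have "\<dots> = {u..v}" using m by (simp add: image_image)
      finally show ?thesis .
    qed
    ultimately have "((\<lambda>x. ?n (m * x + b)) has_integral (1 / \<bar>m\<bar>) * L) {u..v}" by simp
    from has_integral_mult_right[OF this, of "\<bar>m\<bar>"] show ?thesis using m by simp
  qed
  show "((\<lambda>t. norm (vector_derivative (f \<circ> \<eta>) (at t))) has_integral L) {u..v}"
    by (rule has_integral_spike_finite[OF _ neq int, of "S' \<union> {u, v}"]) (use S' in simp_all)
  show "\<exists>S. finite S \<and> (\<forall>c\<in>A. \<forall>t\<in>{u<..<v} - S. \<eta> t \<in> fst c \<longrightarrow> C1_near (snd c \<circ> \<eta>) t)"
  proof (rule exI[of _ S'], intro conjI S' ballI impI)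
    fix c t assume c: "c \<in> A" and t: "t \<in> {u<..<v} - S'" and \<eta>: "\<eta> t \<in> fst c"
    have tuv: "t \<in> {u<..<v}" using t by simp
    have "\<gamma> (m * t + b) \<in> fst c" using \<eta> eq[OF tuv] by simp
    then obtain N where N: "open N" "m * t + b \<in> N" "(snd c \<circ> \<gamma>) C1_differentiable_on N"
      using S(2)[OF c good[OF t]] by blast
    let ?N = "{s. m * s + b \<in> N} \<inter> {u<..<v}"
    have "open {s. m * s + b \<in> N}"
    proof -
      have "continuous_on UNIV (\<lambda>s. m * s + b)" by (intro continuous_intros)
      from open_vimage[OF N(1) this] show ?thesis by (simp add: vimage_def)
    qed
    then have op: "open ?N" by (rule open_Int) simp
    moreover have "t \<in> ?N" using N(2) tuv by simp
    moreover have "(snd c \<circ> \<eta>) C1_differentiable_on ?N"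
    proof (rule C1_differentiable_on_cong_open[OF op, where g = "\<lambda>s. (snd c \<circ> \<gamma>) (m * s + b)"])
      show "(\<lambda>s. (snd c \<circ> \<gamma>) (m * s + b)) C1_differentiable_on ?N"
        using C1_differentiable_on_affine[OF N(3), of m b] by (rule C1_differentiable_on_subset) auto
      fix s assume "s \<in> ?N"
      then have "s \<in> {u<..<v}" by simp
      then show "(snd c \<circ> \<eta>) s = (snd c \<circ> \<gamma>) (m * s + b)" by (simp add: eq)
    qed
    ultimately show "C1_near (snd c \<circ> \<eta>) t" by blast
  qed
qed

lemma joined_reverse:
  assumes "joined p q L" shows "joined q p L"
proof -
  obtain \<gamma> where \<gamma>: "rect_curve \<gamma> L" "\<gamma> 0 = p" "\<gamma> 1 = q" using assms by (auto simp: joined_def)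
  define \<eta> where "\<eta> = (\<lambda>t. \<gamma> (- 1 * t + 1))"
  have im: "(\<lambda>t. - 1 * t + 1) ` {0..1::real} = {0..1}"
  proof -
    have "x \<in> (\<lambda>t. - 1 * t + 1) ` {0..1}" if "x \<in> {0..1}" for x :: real
      by (rule image_eqI[of _ _ "1 - x"]) (use that in auto)
    then show ?thesis by auto
  qed
  have "continuous_map (top_of_set {0..1}) (top_of_set {0..1}) (\<lambda>t::real. - 1 * t + 1)"
    by (auto intro!: continuous_intros)
  moreover have "continuous_map (top_of_set {0..1}) X \<gamma>"
    using \<gamma>(1) by (simp add: rect_curve_def piecewise_C1_curve_def pathin_def)
  ultimately have "pathin X (\<gamma> \<circ> (\<lambda>t::real. - 1 * t + 1))"
    unfolding pathin_def by (rule continuous_map_compose)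
  then have "pathin X \<eta>" by (simp add: \<eta>_def o_def)
  with affine_piece[OF \<gamma>(1) _ _ im, of \<eta>] have "rect_curve \<eta> L"
    unfolding rect_curve_def piecewise_C1_curve_iff by (simp add: \<eta>_def)
  then show ?thesis unfolding joined_def using \<gamma> by (intro exI[of _ \<eta>]) (simp add: \<eta>_def)
qed

lemma joined_trans:
  assumes "joined p q L" "joined q r M" shows "joined p r (L + M)"
proof -
  obtain \<gamma> where \<gamma>: "rect_curve \<gamma> L" "\<gamma> 0 = p" "\<gamma> 1 = q" using assms by (auto simp: joined_def)
  obtain \<theta> where \<theta>: "rect_curve \<theta> M" "\<theta> 0 = q" "\<theta> 1 = r" using assms by (auto simp: joined_def)
  define \<eta> where "\<eta> = (\<lambda>t::real. if t \<le> 1/2 then \<gamma> (2 * t + 0) else \<theta> (2 * t + (- 1)))"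
  have pc: "continuous_map (top_of_set {0..1}) X \<gamma>" "continuous_map (top_of_set {0..1}) X \<theta>"
    using \<gamma>(1) \<theta>(1) by (auto simp: rect_curve_def piecewise_C1_curve_def pathin_def)
  have "continuous_map (top_of_set {0..1::real}) X \<eta>"
    unfolding \<eta>_def
  proof (rule continuous_map_cases_le)
    have c1: "continuous_map (subtopology (top_of_set {0..1}) {x \<in> topspace (top_of_set {0..1}). x \<le> 1/2}) (top_of_set {0..1}) (\<lambda>t::real. 2 * t + 0)"
      by (auto simp: subtopology_subtopology intro!: continuous_intros)
    from continuous_map_compose[OF c1 pc(1)]
    show "continuous_map (subtopology (top_of_set {0..1}) {x \<in> topspace (top_of_set {0..1}). x \<le> 1/2}) X (\<lambda>t. \<gamma> (2 * t + 0))"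
      by (simp add: o_def)
    have c2: "continuous_map (subtopology (top_of_set {0..1}) {x \<in> topspace (top_of_set {0..1}). 1/2 \<le> x}) (top_of_set {0..1}) (\<lambda>t::real. 2 * t + (- 1))"
      by (auto simp: subtopology_subtopology intro!: continuous_intros)
    from continuous_map_compose[OF c2 pc(2)]
    show "continuous_map (subtopology (top_of_set {0..1}) {x \<in> topspace (top_of_set {0..1}). 1/2 \<le> x}) X (\<lambda>t. \<theta> (2 * t + (- 1)))"
      by (simp add: o_def)
    fix x :: real assume "x = 1/2"
    then have "2 * x + 0 = 1" "2 * x + (- 1) = 0" by simp_all
    then show "\<gamma> (2 * x + 0) = \<theta> (2 * x + (- 1))" using \<gamma>(3) \<theta>(2) by (simp only:)
  qed (auto intro!: continuous_intros)
  then have p\<eta>: "pathin X \<eta>" by (simp add: pathin_def)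
  have im1: "(\<lambda>t. 2 * t + 0) ` {0..1/2::real} = {0..1}"
  proof -
    have "x \<in> (\<lambda>t. 2 * t + 0) ` {0..1/2}" if "x \<in> {0..1}" for x :: real
      by (rule image_eqI[of _ _ "x / 2"]) (use that in auto)
    then show ?thesis by auto
  qed
  have im2: "(\<lambda>t. 2 * t + (- 1)) ` {1/2..1::real} = {0..1}"
  proof -
    have "x \<in> (\<lambda>t. 2 * t + (- 1)) ` {1/2..1}" if "x \<in> {0..1}" for x :: real
      by (rule image_eqI[of _ _ "(x + 1) / 2"]) (use that in \<open>auto simp: field_simps\<close>)
    then show ?thesis by auto
  qed
  have a1: "((\<lambda>t. norm (vector_derivative (f \<circ> \<eta>) (at t))) has_integral L) {0..1/2}"
    "\<exists>S. finite S \<and> (\<forall>c\<in>A. \<forall>t\<in>{0<..<1/2} - S. \<eta> t \<in> fst c \<longrightarrow> C1_near (snd c \<circ> \<eta>) t)"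
    by (rule affine_piece[OF \<gamma>(1) _ _ im1]; simp add: \<eta>_def)+
  have a2: "((\<lambda>t. norm (vector_derivative (f \<circ> \<eta>) (at t))) has_integral M) {1/2..1}"
    "\<exists>S. finite S \<and> (\<forall>c\<in>A. \<forall>t\<in>{1/2<..<1} - S. \<eta> t \<in> fst c \<longrightarrow> C1_near (snd c \<circ> \<eta>) t)"
    by (rule affine_piece[OF \<theta>(1) _ _ im2]; simp add: \<eta>_def)+
  have int: "((\<lambda>t. norm (vector_derivative (f \<circ> \<eta>) (at t))) has_integral (L + M)) {0..1}"
    by (rule has_integral_combine[OF _ _ a1(1) a2(1)]) auto
  obtain S1 where S1: "finite S1" "\<forall>c\<in>A. \<forall>t\<in>{0<..<1/2} - S1. \<eta> t \<in> fst c \<longrightarrow> C1_near (snd c \<circ> \<eta>) t" using a1(2) by blast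
  obtain S2 where S2: "finite S2" "\<forall>c\<in>A. \<forall>t\<in>{1/2<..<1} - S2. \<eta> t \<in> fst c \<longrightarrow> C1_near (snd c \<circ> \<eta>) t" using a2(2) by blast
  have "C1_near (snd c \<circ> \<eta>) t"
    if "c \<in> A" "t \<in> {0<..<1} - (S1 \<union> S2 \<union> {1/2})" "\<eta> t \<in> fst c" for c t
  proof (cases "t < 1/2")
    case True then have "t \<in> {0<..<1/2} - S1" using that by auto
    then show ?thesis using S1(2) that by blast
  next
    case False then have "t \<in> {1/2<..<1} - S2" using that by auto
    then show ?thesis using S2(2) that by blast
  qed
  note good = this
  have "rect_curve \<eta> (L + M)"
    unfolding rect_curve_def piecewise_C1_curve_iff
  proof (intro conjI p\<eta> int, rule exI[of _ "S1 \<union> S2 \<union> {1/2}"], intro conjI ballI impI)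
    show "finite (S1 \<union> S2 \<union> {1/2})" using S1(1) S2(1) by simp
  qed (rule good)
  then show ?thesis unfolding joined_def using \<gamma> \<theta> by (intro exI[of _ \<eta>]) (simp add: \<eta>_def)
qed

text \<open>Charts are only compared after composition with coordinates, so this covers both flow maps and
  the inverses of charts.\<close>

definition holo_curve :: "complex set \<Rightarrow> (complex \<Rightarrow> 'a) \<Rightarrow> bool" where
  "holo_curve D \<Phi> \<longleftrightarrow> open D \<and> continuous_map (top_of_set D) X \<Phi> \<and>
     (\<forall>w\<in>D. \<forall>c\<in>A. \<Phi> w \<in> fst c \<longrightarrow> (snd c \<circ> \<Phi>) field_differentiable (at w))"

lemma rect_curve_segment:
  assumes \<Phi>: "holo_curve D \<Phi>" and seg: "\<And>t. t \<in> {0..1} \<Longrightarrow> a + of_real t * b \<in> D"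
  defines "\<gamma> \<equiv> \<lambda>t. \<Phi> (a + of_real t * b)"
  obtains L where "rect_curve \<gamma> L"
    "\<And>B. (\<And>t. t \<in> {0..1} \<Longrightarrow> \<exists>c\<in>A. \<gamma> t \<in> fst c \<and>
        \<mu> c (\<gamma> t) * norm (deriv (snd c \<circ> \<Phi>) (a + of_real t * b)) \<le> B) \<Longrightarrow> L \<le> B * norm b"
proof -
  have D: "open D" and \<Phi>c: "continuous_map (top_of_set D) X \<Phi>"
    and \<Phi>d: "\<And>w c. w \<in> D \<Longrightarrow> c \<in> A \<Longrightarrow> \<Phi> w \<in> fst c \<Longrightarrow> (snd c \<circ> \<Phi>) field_differentiable (at w)"
    using \<Phi> by (auto simp: holo_curve_def)
  let ?l = "\<lambda>t::real. a + of_real t * b"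
  have lc: "continuous_on UNIV ?l" by (intro continuous_intros)
  have top: "\<gamma> t \<in> topspace X" if "t \<in> {0..1}" for t
    using \<Phi>c seg[OF that] by (auto simp: \<gamma>_def continuous_map_def)
  have "continuous_map (top_of_set {0..1}) (top_of_set D) ?l"
    using seg continuous_on_subset[OF lc subset_UNIV] by auto
  from continuous_map_compose[OF this \<Phi>c] have path: "pathin X \<gamma>"
    by (simp add: pathin_def \<gamma>_def o_def)
  have opD: "open {w \<in> D. \<Phi> w \<in> fst c}" if "c \<in> A" for c
  proof -
    have "openin (top_of_set D) {w \<in> topspace (top_of_set D). \<Phi> w \<in> fst c}"
      by (rule openin_continuous_map_preimage[OF \<Phi>c chart_openin[OF that]])
    then show ?thesis using D openin_open_trans by auto
  qed
  define N where "N = (\<lambda>c::'a chart. {t. ?l t \<in> D \<and> \<Phi> (?l t) \<in> fst c})"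
  have opN: "open (N c)" if "c \<in> A" for c
    using open_vimage[OF opD[OF that] lc] by (simp add: N_def vimage_def)
  have hol: "(snd c \<circ> \<Phi>) holomorphic_on {w \<in> D. \<Phi> w \<in> fst c}" if "c \<in> A" for c
    unfolding holomorphic_on_def
    using \<Phi>d[OF _ that] field_differentiable_at_within by blast
  have vd: "((snd c \<circ> \<gamma>) has_vector_derivative b * deriv (snd c \<circ> \<Phi>) (?l t)) (at t)"
    if "c \<in> A" "t \<in> N c" for c t
  proof -
    have "(?l has_vector_derivative b) (at t)"
      by (auto intro!: derivative_eq_intros simp: has_vector_derivative_def scaleR_conv_of_real)
    moreover have "((snd c \<circ> \<Phi>) has_field_derivative deriv (snd c \<circ> \<Phi>) (?l t)) (at (?l t))"
      using \<Phi>d that by (auto simp: N_def field_differentiable_derivI)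
    ultimately have "(((snd c \<circ> \<Phi>) \<circ> ?l) has_vector_derivative b * deriv (snd c \<circ> \<Phi>) (?l t)) (at t)"
      by (rule field_vector_diff_chain_at)
    then show ?thesis by (simp add: o_def \<gamma>_def)
  qed
  have dcont: "continuous_on (N c) (\<lambda>t. deriv (snd c \<circ> \<Phi>) (?l t))" if "c \<in> A" for c
    by (rule continuous_on_compose2[OF holomorphic_on_imp_continuous_on[OF holomorphic_deriv[OF hol[OF that] opD[OF that]]]])
      (auto intro!: continuous_intros simp: N_def)
  have C1: "(snd c \<circ> \<gamma>) C1_differentiable_on N c" if "c \<in> A" for c
    unfolding C1_differentiable_on_def using vd[OF that] dcont[OF that]
    by (intro exI[of _ "\<lambda>t. b * deriv (snd c \<circ> \<Phi>) (?l t)"] conjI ballI continuous_intros) auto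
  have inN: "t \<in> N c" if "t \<in> {0..1}" "\<gamma> t \<in> fst c" for t c
    using that seg by (simp add: N_def \<gamma>_def)
  have pc: "piecewise_C1_curve X A \<gamma>"
    unfolding piecewise_C1_curve_iff
  proof (intro conjI path, rule exI[of _ "{}"], intro conjI ballI impI finite.emptyI)
    fix c t assume "c \<in> A" "t \<in> {0<..<1} - {}" "\<gamma> t \<in> fst c"
    then show "C1_near (snd c \<circ> \<gamma>) t"
      using opN inN[of t c] C1 by (intro exI[of _ "N c"]) auto
  qed
  let ?n = "\<lambda>t. norm (vector_derivative (f \<circ> \<gamma>) (at t))"
  have n: "?n t = \<mu> c (\<gamma> t) * norm (b * deriv (snd c \<circ> \<Phi>) (?l t))" if "c \<in> A" "t \<in> N c" for c t
  proof (rule speed[OF that(1) _ vd[OF that]])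
    show "eventually (\<lambda>s. \<gamma> s \<in> fst c) (nhds t)"
      using eventually_nhds_in_open[OF opN[OF that(1)] that(2)]
      by eventually_elim (simp add: N_def \<gamma>_def)
  qed
  have mucont: "continuous_on (N c) (\<lambda>t. \<mu> c (\<gamma> t))" if c: "c \<in> A" for c
  proof -
    have "continuous_on (N c) (snd c \<circ> \<gamma>)"
      using C1[OF c] C1_differentiable_imp_continuous_on by blast
    then have "continuous_on (N c) (\<lambda>t. in_chart c (\<mu> c) ((snd c \<circ> \<gamma>) t))"
      by (rule continuous_on_compose2[OF mu_cont[OF c]]) (auto simp: N_def \<gamma>_def)
    then show ?thesis by (rule continuous_on_eq) (use c in \<open>auto simp: N_def \<gamma>_def\<close>)
  qed
  have ncont: "continuous_on {0..1} ?n"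
    unfolding continuous_on_eq_continuous_within
  proof
    fix t :: real assume t: "t \<in> {0..1}"
    obtain c where c: "c \<in> A" "\<gamma> t \<in> fst c" using chart_at[OF top[OF t]] .
    have "continuous_on (N c) (\<lambda>t. \<mu> c (\<gamma> t) * norm (b * deriv (snd c \<circ> \<Phi>) (?l t)))"
      by (intro continuous_intros mucont dcont c)
    then have "continuous_on (N c) ?n"
      by (rule continuous_on_eq) (simp add: n[OF c(1)])
    then have "continuous (at t) ?n"
      using opN[OF c(1)] inN[OF t c(2)] by (simp add: continuous_on_eq_continuous_at)
    then show "continuous (at t within {0..1}) ?n" by (rule continuous_at_imp_continuous_within)
  qed
  then obtain L where L: "(?n has_integral L) {0..1}"
    using integrable_continuous_interval by (metis integrable_on_def)
  show ?thesis
  proof (rule that)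
    show "rect_curve \<gamma> L" using pc L by (simp add: rect_curve_def)
    fix B assume B: "\<And>t. t \<in> {0..1} \<Longrightarrow> \<exists>c\<in>A. \<gamma> t \<in> fst c \<and>
        \<mu> c (\<gamma> t) * norm (deriv (snd c \<circ> \<Phi>) (?l t)) \<le> B"
    have "?n t \<le> B * norm b" if t: "t \<in> {0..1}" for t
    proof -
      obtain c where c: "c \<in> A" "\<gamma> t \<in> fst c" "\<mu> c (\<gamma> t) * norm (deriv (snd c \<circ> \<Phi>) (?l t)) \<le> B"
        using B[OF t] by blast
      have "?n t = (\<mu> c (\<gamma> t) * norm (deriv (snd c \<circ> \<Phi>) (?l t))) * norm b"
        by (simp add: n[OF c(1) inN[OF t c(2)]] norm_mult)
      also have "\<dots> \<le> B * norm b" by (rule mult_right_mono[OF c(3)]) simp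
      finally show ?thesis .
    qed
    from has_integral_le[OF L has_integral_const_real this] show "L \<le> B * norm b" by simp
  qed
qed

end

text \<open>The logarithmic derivative of \<open>y\<close> is bounded by \<open>\<kappa>\<close>. Only the real function \<open>ln \<bar>y\<bar>\<close> is used, so no
  branch of the complex logarithm is needed.\<close>

lemma norm_decay_bound:
  fixes y :: "real \<Rightarrow> complex"
  assumes der: "\<And>t. t \<in> {0..1} \<Longrightarrow> (y has_vector_derivative y' t) (at t)"
    and nz: "\<And>t. t \<in> {0..1} \<Longrightarrow> y t \<noteq> 0"
    and bd: "\<And>t. t \<in> {0..1} \<Longrightarrow> norm (y' t) \<le> \<kappa> * norm (y t)"
  shows "ln (norm (y 0)) - \<kappa> \<le> ln (norm (y 1))"
proof -
  define g where "g = (\<lambda>t. ln (y t \<bullet> y t))"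
  have gd: "(g has_real_derivative 2 * (y t \<bullet> y' t) / (y t \<bullet> y t)) (at t)" if t: "t \<in> {0..1}" for t
  proof -
    have pos: "y t \<bullet> y t > 0" using nz[OF t] by simp
    have "((\<lambda>s. y s \<bullet> y s) has_vector_derivative (y t \<bullet> y' t + y' t \<bullet> y t)) (at t)"
      by (rule bounded_bilinear.has_vector_derivative[OF bounded_bilinear_inner der[OF t] der[OF t]])
    then have "((\<lambda>s. y s \<bullet> y s) has_real_derivative 2 * (y t \<bullet> y' t)) (at t)"
      by (simp add: has_real_derivative_iff_has_vector_derivative inner_commute)
    from DERIV_chain2[OF DERIV_ln_divide[OF pos] this] show ?thesis unfolding g_def by simp
  qed
  have "\<exists>x\<in>{0..1}. g 1 - g 0 = (1 - 0) * (2 * (y x \<bullet> y' x) / (y x \<bullet> y x))"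
    using MVT2[of 0 1 g "\<lambda>x. 2 * (y x \<bullet> y' x) / (y x \<bullet> y x)"] gd by force
  then obtain x where x: "x \<in> {0..1}" "g 1 - g 0 = 2 * (y x \<bullet> y' x) / (y x \<bullet> y x)" by auto
  have "- (y x \<bullet> y' x) \<le> \<kappa> * (y x \<bullet> y x)"
  proof -
    have "- (y x \<bullet> y' x) \<le> norm (y x) * norm (y' x)"
      using Cauchy_Schwarz_ineq2[of "y x" "y' x"] by linarith
    also have "\<dots> \<le> norm (y x) * (\<kappa> * norm (y x))"
      by (intro mult_left_mono bd x) auto
    also have "\<dots> = \<kappa> * (y x \<bullet> y x)" by (simp add: dot_square_norm power2_eq_square)
    finally show ?thesis .
  qed
  moreover have "y x \<bullet> y x > 0" using nz[OF x(1)] by simp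
  ultimately have "- (2 * \<kappa>) \<le> 2 * (y x \<bullet> y' x) / (y x \<bullet> y x)"
    by (subst pos_le_divide_eq) simp_all
  then have "g 1 - g 0 \<ge> - (2 * \<kappa>)" unfolding x(2) .
  moreover have "g t = 2 * ln (norm (y t))" if "t \<in> {0..1}" for t
    using nz[OF that] by (simp add: g_def dot_square_norm ln_realpow)
  ultimately show ?thesis by simp
qed

context metric_surface
begin

text \<open>The coordinate is the integral of its velocity, which is bounded by the speed of the curve divided
  by \<open>m\<close>; the finitely many corners do not affect the integral.\<close>

lemma rect_curve_progress:
  assumes \<gamma>: "rect_curve \<gamma> L" and c: "c \<in> A" and m: "m > 0"
    and u: "0 \<le> u" "u \<le> 1"
    and inU: "\<And>t. t \<in> {0..u} \<Longrightarrow> \<gamma> t \<in> fst c \<and> m \<le> \<mu> c (\<gamma> t)"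
  shows "norm (snd c (\<gamma> u) - snd c (\<gamma> 0)) \<le> L / m"
proof -
  let ?n = "\<lambda>t. norm (vector_derivative (f \<circ> \<gamma>) (at t))"
  have path: "pathin X \<gamma>" and I: "(?n has_integral L) {0..1}"
    using \<gamma> by (auto simp: rect_curve_def piecewise_C1_curve_def)
  obtain S where S: "finite S" "\<And>c t. c\<in>A \<Longrightarrow> t\<in>{0<..<1} - S \<Longrightarrow> \<gamma> t \<in> fst c \<Longrightarrow>
        C1_near (snd c \<circ> \<gamma>) t"
    using \<gamma> unfolding rect_curve_def piecewise_C1_curve_iff by blast
  define g where "g = snd c \<circ> \<gamma>"
  define g' where "g' = (\<lambda>t. if t \<in> S \<union> {0, u} then 0 else vector_derivative g (at t))"
  have der: "(g has_vector_derivative vector_derivative g (at t)) (at t)" if t: "t \<in> {0<..<u} - S" for t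
  proof -
    have "t \<in> {0<..<1} - S" "\<gamma> t \<in> fst c" using t u inU[of t] by auto
    then obtain N where "open N" "t \<in> N" "(snd c \<circ> \<gamma>) C1_differentiable_on N"
      using S(2)[OF c] by blast
    then show ?thesis unfolding g_def by (rule curve_deriv)
  qed
  have cont: "continuous_on {0..u} g"
  proof -
    have "continuous_map (top_of_set {0..u}) X \<gamma>"
      using path u continuous_map_from_subtopology_mono[of euclidean "{0..1}" X \<gamma> "{0..u}"]
      by (simp add: pathin_def)
    then have "continuous_map (top_of_set {0..u}) (subtopology X (fst c)) \<gamma>"
      using inU by (auto simp: continuous_map_in_subtopology)
    from continuous_map_compose[OF this chart_cont[OF c]]
    show ?thesis by (simp add: g_def)
  qed
  have "(g' has_integral (g u - g 0)) {0..u}"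
  proof (rule fundamental_theorem_of_calculus_interior_strong[of "S \<union> {0, u}"])
    fix t assume t: "t \<in> {0<..<u} - (S \<union> {0, u})"
    then show "(g has_vector_derivative g' t) (at t)" using der[of t] by (simp add: g'_def)
  qed (use S(1) u cont in auto)
  then have gI: "g' integrable_on {0..u}" "integral {0..u} g' = g u - g 0"
    by (auto simp: has_integral_iff)
  have nI: "?n integrable_on {0..1}" "integral {0..1} ?n = L" using I by (auto simp: has_integral_iff)
  have nu: "?n integrable_on {0..u}" by (rule integrable_on_subinterval[OF nI(1)]) (use u in auto)
  have le: "norm (g' t) \<le> ?n t / m" if t: "t \<in> {0..u}" for t
  proof (cases "t \<in> S \<union> {0, u}")
    case True then show ?thesis using m by (simp add: g'_def)
  next
    case False
    then have t': "t \<in> {0<..<u} - S" using t by auto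
    then have t1: "t \<in> {0<..<1}" using u by auto
    have ev: "eventually (\<lambda>s. \<gamma> s \<in> fst c) (nhds t)"
      by (rule pathin_eventually[OF path t1 chart_openin[OF c]]) (use inU[OF t] in simp)
    have "?n t = \<mu> c (\<gamma> t) * norm (vector_derivative g (at t))"
      by (rule speed[OF c ev der[OF t', unfolded g_def], folded g_def])
    also have "\<dots> \<ge> m * norm (vector_derivative g (at t))"
      using inU[OF t] by (intro mult_right_mono) auto
    finally show ?thesis using m False by (simp add: g'_def field_simps)
  qed
  have "norm (integral {0..u} g') \<le> integral {0..u} (\<lambda>t. ?n t / m)"
    by (rule Henstock_Kurzweil_Integration.integral_norm_bound_integral[OF gI(1) _ le])
      (use nu in \<open>auto intro: integrable_on_divide\<close>)
  also have "\<dots> = integral {0..u} ?n / m" by simp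
  also have "\<dots> \<le> L / m"
  proof (rule divide_right_mono)
    show "integral {0..u} ?n \<le> L"
      unfolding nI(2)[symmetric] by (rule integral_subset_le[OF _ nu nI(1)]) (use u in auto)
  qed (use m in simp)
  finally show ?thesis by (simp add: gI(2)) (simp add: g_def)
qed

text \<open>At the first time \<open>t0\<close> at which the curve leaves the coordinate disc, the coordinate has moved by at
  most \<open>L/m\<close>, which is not enough to reach the boundary circle. That the curve still lies over the
  smaller closed disc at time \<open>t0\<close> uses that the preimage of this disc is compact, hence closed in
  the Hausdorff space \<open>X\<close>.\<close>

lemma rect_curve_stays:
  assumes \<gamma>: "rect_curve \<gamma> L" and c: "c \<in> A" and m: "m > 0"
    and ball: "cball z0 s \<subseteq> snd c ` fst c"
    and mu: "\<And>q. q \<in> fst c \<Longrightarrow> snd c q \<in> cball z0 s \<Longrightarrow> m \<le> \<mu> c q"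
    and start: "\<gamma> 0 \<in> fst c" and short: "norm (snd c (\<gamma> 0) - z0) + L / m < s"
    and t: "t \<in> {0..1}"
  shows "\<gamma> t \<in> fst c \<and> snd c (\<gamma> t) \<in> ball z0 s \<and> norm (snd c (\<gamma> t) - snd c (\<gamma> 0)) \<le> L / m"
proof -
  have path: "pathin X \<gamma>" and L: "L \<ge> 0"
    using \<gamma> rect_curve_nonneg by (auto simp: rect_curve_def piecewise_C1_curve_def)
  define V where "V = {q \<in> fst c. snd c q \<in> ball z0 s}"
  have V: "openin X V" unfolding V_def by (rule chart_openin_vimage[OF c open_ball])
  have prog: "norm (snd c (\<gamma> u) - snd c (\<gamma> 0)) \<le> L / m"
    if "0 \<le> u" "u \<le> 1" "\<And>t. t \<in> {0..u} \<Longrightarrow> \<gamma> t \<in> V" for u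
  proof (rule rect_curve_progress[OF \<gamma> c m that(1,2)])
    fix t assume "t \<in> {0..u}"
    from that(3)[OF this] show "\<gamma> t \<in> fst c \<and> m \<le> \<mu> c (\<gamma> t)" using mu[of "\<gamma> t"] by (simp add: V_def)
  qed
  have L0: "L / m \<ge> 0" using L m by simp
  have V0: "\<gamma> 0 \<in> V" using start short L0 by (auto simp: V_def dist_norm norm_minus_commute)
  have all: "\<gamma> t \<in> V" if t: "t \<in> {0..1}" for t
  proof (rule ccontr)
    assume nV: "\<gamma> t \<notin> V"
    let ?B = "{t \<in> topspace (top_of_set {0..1}). \<gamma> t \<in> topspace X - V}"
    have "closedin (top_of_set {0..1}) ?B"
      by (rule closedin_continuous_map_preimage[OF path[unfolded pathin_def]])
        (rule openin_closedin_eq[THEN iffD1, OF V, THEN conjunct2])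
    then have clB: "closed ?B" by (rule closedin_closed_trans) simp
    have top: "\<gamma> s \<in> topspace X" if "s \<in> {0..1}" for s
      using path that by (auto simp: pathin_def continuous_map_def)
    have tB: "t \<in> ?B" using t nV top[OF t] by simp
    define t0 where "t0 = Inf ?B"
    have bdd: "bdd_below ?B" by (rule bdd_belowI[of _ 0]) auto
    have t0B: "t0 \<in> ?B" unfolding t0_def by (rule closed_contains_Inf[OF _ bdd clB]) (use tB in blast)
    have t01: "0 \<le> t0" "t0 \<le> 1" using t0B by auto
    have "t0 \<noteq> 0" using t0B V0 by auto
    then have t0pos: "t0 > 0" using t01 by simp
    have before: "\<gamma> s \<in> V" if "0 \<le> s" "s < t0" for s
    proof (rule ccontr)
      assume "\<gamma> s \<notin> V"
      then have "s \<in> ?B" using that t01 top[of s] by simp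
      then have "t0 \<le> s" unfolding t0_def by (rule cInf_lower[OF _ bdd])
      then show False using that by simp
    qed
    define r where "r = norm (snd c (\<gamma> 0) - z0) + L / m"
    have r: "r < s" "cball z0 r \<subseteq> snd c ` fst c" using short ball by (auto simp: r_def)
    define K where "K = point_at c ` cball z0 r"
    have "compactin (top_of_set (snd c ` fst c)) (cball z0 r)"
      using r(2) by (simp add: compactin_subtopology)
    then have "compactin X K" unfolding K_def
      by (rule image_compactin[OF _ chart_inv_continuous[OF c]])
    then have "closedin X K" using hausdorff compactin_imp_closedin by blast
    then have "closedin (top_of_set {0..1}) {t \<in> topspace (top_of_set {0..1}). \<gamma> t \<in> K}"
      by (rule closedin_continuous_map_preimage[OF path[unfolded pathin_def]])
    then have clK: "closed {t \<in> topspace (top_of_set {0..1}). \<gamma> t \<in> K}"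
      by (rule closedin_closed_trans) simp
    have inK: "\<gamma> u \<in> K" if u: "0 \<le> u" "u < t0" for u
    proof -
      have "norm (snd c (\<gamma> u) - snd c (\<gamma> 0)) \<le> L / m"
        by (rule prog) (use u t01 before in auto)
      then have "norm (snd c (\<gamma> u) - z0) \<le> r"
        using norm_triangle_ineq[of "snd c (\<gamma> u) - snd c (\<gamma> 0)" "snd c (\<gamma> 0) - z0"]
        by (simp add: r_def)
      then have "snd c (\<gamma> u) \<in> cball z0 r" by (simp add: dist_norm norm_minus_commute)
      moreover have "\<gamma> u = point_at c (snd c (\<gamma> u))"
        using before[OF u] c by (simp add: V_def)
      ultimately show ?thesis unfolding K_def by (rule rev_image_eqI)
    qed
    have "{0..<t0} \<subseteq> {t \<in> topspace (top_of_set {0..1}). \<gamma> t \<in> K}" using inK t01 by auto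
    then have "closure {0..<t0} \<subseteq> {t \<in> topspace (top_of_set {0..1}). \<gamma> t \<in> K}"
      by (rule closure_minimal[OF _ clK])
    moreover have "t0 \<in> closure {0..<t0}" using t0pos by simp
    ultimately have "t0 \<in> {t \<in> topspace (top_of_set {0..1}). \<gamma> t \<in> K}" by (rule subsetD)
    then have "\<gamma> t0 \<in> K" by simp
    then obtain z where z: "z \<in> cball z0 r" "\<gamma> t0 = point_at c z" by (auto simp: K_def)
    have zi: "z \<in> snd c ` fst c" using z r by blast
    have "\<gamma> t0 \<in> fst c" "snd c (\<gamma> t0) = z" using inv_into_into[OF zi] f_inv_into_f[OF zi] z by simp_all
    then have "\<gamma> t0 \<in> V" using z r by (auto simp: V_def)
    then show False using t0B by simp
  qed
  have "norm (snd c (\<gamma> t) - snd c (\<gamma> 0)) \<le> L / m"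
    by (rule prog) (use t all in auto)
  then show ?thesis using all[OF t] by (simp add: V_def)
qed

lemma chart_inv_holo_curve:
  assumes c: "c \<in> A" shows "holo_curve (snd c ` fst c) (point_at c)"
  unfolding holo_curve_def
proof (intro conjI ballI impI chart_open[OF c] chart_inv_continuous[OF c])
  fix w d assume w: "w \<in> snd c ` fst c" and d: "d \<in> A" "point_at c w \<in> fst d"
  then obtain q where q: "q \<in> fst c" "w = snd c q" by blast
  show "snd d \<circ> point_at c field_differentiable at w"
    using transition_deriv[OF c d(1) q(1)] d q c
    by (auto simp: in_chart_def field_differentiable_def)
qed

text \<open>The infimum in the definition of the induced distance is over a nonempty set. Without this fact,
  a small value of the distance would not provide a short curve.\<close>

lemma joined_exists:
  assumes conn: "connected_space X" and p: "p \<in> topspace X" and q: "q \<in> topspace X"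
  shows "\<exists>L. joined p q L"
proof -
  have loc: "\<exists>N. openin X N \<and> a \<in> N \<and> (\<forall>b\<in>N. \<exists>L. joined a b L)" if a: "a \<in> topspace X" for a
  proof -
    obtain c where c: "c \<in> A" "a \<in> fst c" using chart_at[OF a] .
    obtain e where e: "e > 0" "ball (snd c a) e \<subseteq> snd c ` fst c"
      using chart_open[OF c(1)] c(2) open_contains_ball by (metis imageI)
    let ?N = "{b \<in> fst c. snd c b \<in> ball (snd c a) e}"
    have "\<exists>L. joined a b L" if b: "b \<in> ?N" for b
    proof -
      let ?\<gamma> = "\<lambda>t. point_at c (snd c a + of_real t * (snd c b - snd c a))"
      have seg: "snd c a + of_real t * (snd c b - snd c a) \<in> snd c ` fst c" if t: "t \<in> {0..1}" for t
      proof -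
        have "norm (of_real t * (snd c b - snd c a)) \<le> 1 * norm (snd c b - snd c a)"
          unfolding norm_mult by (rule mult_right_mono) (use t in auto)
        also have "\<dots> < e" using b by (simp add: dist_norm norm_minus_commute)
        finally have "snd c a + of_real t * (snd c b - snd c a) \<in> ball (snd c a) e"
          by (simp add: dist_norm)
        then show ?thesis using e by blast
      qed
      obtain L where "rect_curve ?\<gamma> L"
        by (rule rect_curve_segment[OF chart_inv_holo_curve[OF c(1)]], erule seg, rule that)
      moreover have "?\<gamma> 0 = a" "?\<gamma> 1 = b" using c b by simp_all
      ultimately show ?thesis unfolding joined_def by blast
    qed
    moreover have "openin X ?N" by (rule chart_openin_vimage[OF c(1) open_ball])
    moreover have "a \<in> ?N" using c e by simp
    ultimately show ?thesis by blast
  qed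
  let ?S = "{a \<in> topspace X. \<exists>L. joined p a L}"
  have "openin X ?S"
    unfolding openin_subopen[of X ?S]
  proof
    fix a assume a: "a \<in> ?S"
    then obtain N where N: "openin X N" "a \<in> N" "\<forall>b\<in>N. \<exists>L. joined a b L" using loc by blast
    have "N \<subseteq> ?S" using N(3) a openin_subset[OF N(1)] joined_trans by blast
    then show "\<exists>T. openin X T \<and> a \<in> T \<and> T \<subseteq> ?S" using N by blast
  qed
  moreover have "openin X (topspace X - ?S)"
    unfolding openin_subopen[of X "topspace X - ?S"]
  proof
    fix a assume a: "a \<in> topspace X - ?S"
    then obtain N where N: "openin X N" "a \<in> N" "\<forall>b\<in>N. \<exists>L. joined a b L" using loc by blast
    have "N \<subseteq> topspace X - ?S"
    proof
      fix b assume b: "b \<in> N"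
      have "\<not> joined p b L" for L
      proof
        assume "joined p b L"
        moreover obtain M where "joined a b M" using N(3) b by blast
        ultimately have "joined p a (L + M)" using joined_trans joined_reverse by blast
        then show False using a by blast
      qed
      then show "b \<in> topspace X - ?S" using openin_subset[OF N(1)] b by blast
    qed
    then show "\<exists>T. openin X T \<and> a \<in> T \<and> T \<subseteq> topspace X - ?S" using N by blast
  qed
  ultimately have "?S = {} \<or> ?S = topspace X"
    using conn unfolding connected_space_clopen_in closedin_def by blast
  moreover have "p \<in> ?S"
  proof -
    obtain N where "p \<in> N" "\<forall>b\<in>N. \<exists>L. joined p b L" using loc[OF p] by blast
    then show ?thesis using p by blast
  qed
  ultimately show ?thesis using q by blast
qed

lemma good_ball:
  assumes c: "c \<in> A" and p: "p \<in> fst c"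
  obtains s m where "s > 0" "m > 0" "cball (snd c p) s \<subseteq> snd c ` fst c"
    "\<And>q. q \<in> fst c \<Longrightarrow> snd c q \<in> cball (snd c p) s \<Longrightarrow> m \<le> \<mu> c q"
proof -
  obtain s where s: "s > 0" "cball (snd c p) s \<subseteq> snd c ` fst c"
    using chart_open[OF c] p open_contains_cball by (metis imageI)
  have "continuous_on (cball (snd c p) s) (in_chart c (\<mu> c))"
    by (rule continuous_on_subset[OF mu_cont[OF c] s(2)])
  then obtain z where z: "z \<in> cball (snd c p) s"
    "\<And>y. y \<in> cball (snd c p) s \<Longrightarrow> in_chart c (\<mu> c) z \<le> in_chart c (\<mu> c) y"
    using continuous_attains_inf[of "cball (snd c p) s" "in_chart c (\<mu> c)"] s(1) by auto
  obtain q0 where q0: "q0 \<in> fst c" "z = snd c q0" using z s by blast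
  show ?thesis
  proof (rule that[OF s(1) _ s(2)])
    show "in_chart c (\<mu> c) z > 0" using mu_pos[OF c q0(1)] c q0 by simp
    show "in_chart c (\<mu> c) z \<le> \<mu> c q" if "q \<in> fst c" "snd c q \<in> cball (snd c p) s" for q
      using z(2)[OF that(2)] that(1) c by simp
  qed
qed

text \<open>Short curves starting at \<open>p\<close> stay in a coordinate disc around \<open>p\<close>, so convergence in the induced
  distance implies convergence in the coordinate.\<close>

lemma induced_dist_tendsto_chart:
  assumes conn: "connected_space X" and c: "c \<in> A" and p: "p \<in> fst c"
    and \<sigma>: "\<And>n. \<sigma> n \<in> topspace X" and lim: "(\<lambda>n. induced_dist X A f (\<sigma> n) p) \<longlonglongrightarrow> 0"
  shows "eventually (\<lambda>n. \<sigma> n \<in> fst c) sequentially" and "(\<lambda>n. snd c (\<sigma> n)) \<longlonglongrightarrow> snd c p"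
proof -
  obtain s m where sm: "s > 0" "m > 0" "cball (snd c p) s \<subseteq> snd c ` fst c"
    "\<And>q. q \<in> fst c \<Longrightarrow> snd c q \<in> cball (snd c p) s \<Longrightarrow> m \<le> \<mu> c q"
    using good_ball[OF c p] by blast
  have pX: "p \<in> topspace X" using p chart_subset[OF c] by blast
  have key: "\<sigma> n \<in> fst c \<and> norm (snd c (\<sigma> n) - snd c p) < \<epsilon>"
    if \<epsilon>: "0 < \<epsilon>" "\<epsilon> \<le> s" and d: "induced_dist X A f (\<sigma> n) p < m * \<epsilon>" for n \<epsilon>
  proof -
    obtain L0 where "joined (\<sigma> n) p L0" using joined_exists[OF conn \<sigma> pX] by blast
    from induced_dist_less[OF this d] obtain L where L: "L < m * \<epsilon>" "joined (\<sigma> n) p L" by blast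
    obtain \<gamma> where \<gamma>: "rect_curve \<gamma> L" "\<gamma> 0 = p" "\<gamma> 1 = \<sigma> n"
      using joined_reverse[OF L(2)] by (auto simp: joined_def)
    have Lm: "L / m < \<epsilon>" using L(1) sm(2) by (simp add: field_simps)
    have "\<gamma> 1 \<in> fst c \<and> snd c (\<gamma> 1) \<in> ball (snd c p) s \<and> norm (snd c (\<gamma> 1) - snd c (\<gamma> 0)) \<le> L / m"
      by (rule rect_curve_stays[OF \<gamma>(1) c sm(2,3,4)]) (use \<gamma> p Lm \<epsilon> in auto)
    then show ?thesis using \<gamma> Lm by simp
  qed
  have ev: "eventually (\<lambda>n. \<sigma> n \<in> fst c \<and> norm (snd c (\<sigma> n) - snd c p) < \<epsilon>) sequentially"
    if "0 < \<epsilon>" "\<epsilon> \<le> s" for \<epsilon>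
  proof -
    have "0 < m * \<epsilon>" using that sm by simp
    from order_tendstoD(2)[OF lim this] show ?thesis
      by eventually_elim (rule key[OF that])
  qed
  show "eventually (\<lambda>n. \<sigma> n \<in> fst c) sequentially"
    using ev[OF sm(1) order_refl] by eventually_elim simp
  show "(\<lambda>n. snd c (\<sigma> n)) \<longlonglongrightarrow> snd c p"
  proof (rule tendstoI)
    fix e :: real assume "e > 0"
    then have "0 < min e s" "min e s \<le> s" using sm by auto
    from ev[OF this] show "eventually (\<lambda>n. dist (snd c (\<sigma> n)) (snd c p) < e) sequentially"
      by eventually_elim (simp add: dist_norm)
  qed
qed

end

section \<open>Flow discs in a complete metric\<close>

locale metric_flow = vector_field X A H + metric_surface X A f \<mu>
  for X :: "'a topology" and A :: "'a chart set" and H and f :: "'a \<Rightarrow> 'b::euclidean_space" and \<mu>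
begin

definition max_disc :: "real \<Rightarrow> (complex \<Rightarrow> 'a) \<Rightarrow> bool" where
  "max_disc \<rho> \<Phi> \<longleftrightarrow> 0 < \<rho> \<and> flow_on (ball 0 \<rho>) \<Phi> \<and>
     (\<forall>r \<Psi>. flow_on (ball 0 r) \<Psi> \<longrightarrow> \<Psi> 0 = \<Phi> 0 \<longrightarrow> r \<le> \<rho>)"

text \<open>Otherwise all points of the circle of radius \<open>\<rho>/2\<close> would be centres of flow discs of radius
  \<open>3\<rho>/4\<close>, and the given disc could be enlarged.\<close>

lemma max_disc_step:
  assumes "max_disc \<rho> \<Phi>"
  obtains c \<rho>' \<Phi>' where "norm c = \<rho> / 2" "max_disc \<rho>' \<Phi>'" "\<Phi>' 0 = \<Phi> c" "\<rho>' \<le> 3 / 4 * \<rho>"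
proof -
  have \<rho>: "\<rho> > 0" and fl: "flow_on (ball 0 \<rho>) \<Phi>"
    and mx: "\<And>r \<Psi>. flow_on (ball 0 r) \<Psi> \<Longrightarrow> \<Psi> 0 = \<Phi> 0 \<Longrightarrow> r \<le> \<rho>"
    using assms by (auto simp: max_disc_def)
  have "\<exists>c. norm c = \<rho> / 2 \<and> \<not> (\<exists>\<Psi>. flow_on (ball 0 (3 * \<rho> / 4)) \<Psi> \<and> \<Psi> 0 = \<Phi> c)"
  proof (rule ccontr)
    assume "\<not> ?thesis"
    then obtain \<Psi> where "flow_on (ball 0 (5 * \<rho> / 4)) \<Psi>" "\<Psi> 0 = \<Phi> 0"
      using flow_extend[OF \<rho> fl] by blast
    from mx[OF this] show False using \<rho> by simp
  qed
  then obtain c where c: "norm c = \<rho> / 2"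
    and no: "\<And>\<Psi>. flow_on (ball 0 (3 * \<rho> / 4)) \<Psi> \<Longrightarrow> \<Psi> 0 \<noteq> \<Phi> c" by blast
  have sub: "(\<lambda>w. c + w) ` ball 0 (\<rho> / 2) \<subseteq> ball 0 \<rho>"
  proof
    fix x assume "x \<in> (\<lambda>w. c + w) ` ball 0 (\<rho> / 2)"
    then obtain w where "w \<in> ball 0 (\<rho> / 2)" and w2: "x = c + w" by (rule imageE)
    then have w: "norm w < \<rho> / 2" by simp
    from w w2 show "x \<in> ball 0 \<rho>" using norm_triangle_ineq[of c w] c by simp
  qed
  have s: "flow_on (ball 0 (\<rho> / 2)) (\<lambda>w. \<Phi> (c + w))"
    by (rule flow_on_shift[OF fl open_ball open_ball sub])
  have bd: "r \<le> 3 * \<rho> / 4" if "flow_on (ball 0 r) \<Psi>" "\<Psi> 0 = \<Phi> c" for r \<Psi>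
  proof (rule ccontr)
    assume "\<not> ?thesis"
    then have "flow_on (ball 0 (3 * \<rho> / 4)) \<Psi>" by (intro flow_on_subset[OF that(1)]) auto
    from no[OF this] show False using that by simp
  qed
  obtain \<rho>' \<Phi>' where r': "\<rho>' > 0" "flow_on (ball 0 \<rho>') \<Phi>'" "\<Phi>' 0 = \<Phi> c"
    "\<And>r \<Psi>. flow_on (ball 0 r) \<Psi> \<Longrightarrow> \<Psi> 0 = \<Phi> c \<Longrightarrow> r \<le> \<rho>'"
  proof (rule flow_maximal_disc[OF s])
    show "\<Phi> (c + 0) = \<Phi> c" "\<rho> / 2 > 0" using \<rho> by simp_all
  qed (erule bd, assumption, rule that)
  show ?thesis
  proof (rule that[OF c])
    show "max_disc \<rho>' \<Phi>'" unfolding max_disc_def using r' by auto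
    show "\<Phi>' 0 = \<Phi> c" by fact
    show "\<rho>' \<le> 3 / 4 * \<rho>" using bd[OF r'(2,3)] by simp
  qed
qed

lemma flow_holo_curve:
  assumes "flow_on D \<Phi>" "open D" shows "holo_curve D \<Phi>"
  unfolding holo_curve_def
proof (intro conjI ballI impI)
  show "open D" by (rule assms(2))
  show "continuous_map (top_of_set D) X \<Phi>" using assms(1) by (simp add: flow_on_def)
  show "snd c \<circ> \<Phi> field_differentiable at w" if "w \<in> D" "c \<in> A" "\<Phi> w \<in> fst c" for w c
    unfolding field_differentiable_def by (rule exI, rule flow_deriv[OF assms(1) that])
qed

text \<open>This is the place where completeness enters. Suppose that the maximal radius at \<open>q0\<close> is finite.
  Repeated steps to points with smaller radius give a sequence \<open>q\<^sub>n\<close> whose maximal radii \<open>\<rho>\<^sub>n\<close> decay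
  geometrically. The estimate for the speed of the flow bounds the length of the \<open>n\<close>-th step by a
  constant times \<open>\<rho>\<^sub>n\<^bsup>\<beta>\<^esup>\<close>, so the sequence is a Cauchy sequence and has a limit \<open>p\<close>. If the field does
  not vanish at \<open>p\<close>, then the radii near \<open>p\<close> are bounded below, a contradiction. If it vanishes at
  \<open>p\<close>, then \<open>H(q\<^sub>n)\<close> tends to \<open>0\<close>; but in a coordinate near \<open>p\<close> the function \<open>ln \<bar>H\<bar>\<close> changes along the
  \<open>n\<close>-th step by at most a constant times \<open>\<rho>\<^sub>n\<close>, because the derivative of \<open>H\<close> along the flow is
  \<open>H' H\<close>. The total change is finite, again a contradiction.\<close>

lemma flow_radius_unbounded:
  fixes K \<beta> :: real
  assumes conn: "connected_space X" and complete: "complete_induced_metric X A f"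
    and \<beta>: "\<beta> > 0" and K: "K \<ge> 0"
    and est: "\<And>c r \<Phi>. \<lbrakk>r > 0; flow_on (ball 0 r) \<Phi>; c \<in> A; \<Phi> 0 \<in> fst c\<rbrakk> \<Longrightarrow>
       \<mu> c (\<Phi> 0) * norm (H c (\<Phi> 0)) \<le> K * r powr (\<beta> - 1)"
    and c0: "c0 \<in> A" "q0 \<in> fst c0" "H c0 q0 \<noteq> 0"
  shows "\<exists>r \<Phi>. B < r \<and> flow_on (ball 0 r) \<Phi> \<and> \<Phi> 0 = q0"
proof (rule ccontr)
  assume neg: "\<not> ?thesis"
  obtain N0 \<delta>0 where N0: "openin X N0" "q0 \<in> N0" "\<delta>0 > 0"
    "\<And>q. q \<in> N0 \<Longrightarrow> \<exists>\<Phi>. flow_on (ball 0 \<delta>0) \<Phi> \<and> \<Phi> 0 = q"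
    by (rule flow_exists_locally[OF c0]) (rule that)
  from N0(4)[OF N0(2)] N0(3) obtain \<Phi>0 where \<Phi>0: "flow_on (ball 0 \<delta>0) \<Phi>0" "\<Phi>0 0 = q0" "\<delta>0 > 0" by blast
  obtain \<rho>0 \<Psi>0 where \<Psi>0: "\<rho>0 > 0" "flow_on (ball 0 \<rho>0) \<Psi>0" "\<Psi>0 0 = q0"
    "\<And>r \<Psi>. flow_on (ball 0 r) \<Psi> \<Longrightarrow> \<Psi> 0 = q0 \<Longrightarrow> r \<le> \<rho>0"
  proof (rule flow_maximal_disc[OF \<Phi>0])
    fix r \<Phi> assume fl: "flow_on (ball 0 r) \<Phi>" "\<Phi> 0 = q0"
    show "r \<le> B"
    proof (rule ccontr)
      assume "\<not> r \<le> B"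
      then have "B < r" by simp
      with fl neg show False by blast
    qed
  qed (rule that)
  have start: "max_disc \<rho>0 \<Psi>0" using \<Psi>0 by (auto simp: max_disc_def)
  define P where "P = (\<lambda>x::real \<times> (complex \<Rightarrow> 'a). max_disc (fst x) (snd x))"
  define Q where "Q = (\<lambda>(x::real \<times> (complex \<Rightarrow> 'a)) (y::real \<times> (complex \<Rightarrow> 'a)).
      \<exists>c. norm c = fst x / 2 \<and> snd y 0 = snd x c \<and> fst y \<le> 3 / 4 * fst x)"
  have "\<exists>s. s 0 = (\<rho>0, \<Psi>0) \<and> (\<forall>n. P (s n)) \<and> (\<forall>n. Q (s n) (s (Suc n)))"
  proof -
    have step: "\<exists>y. P y \<and> Q x y" if Px: "P x" for x
    proof -
      obtain c \<rho>' \<Phi>' where "norm c = fst x / 2" "max_disc \<rho>' \<Phi>'" "\<Phi>' 0 = snd x c" "\<rho>' \<le> 3 / 4 * fst x"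
        by (rule max_disc_step[OF Px[unfolded P_def]], rule that)
      then show ?thesis unfolding P_def Q_def by (intro exI[of _ "(\<rho>', \<Phi>')"]) auto
    qed
    define s where "s = rec_nat (\<rho>0, \<Psi>0) (\<lambda>_ x. SOME y. P y \<and> Q x y)"
    have s0: "s 0 = (\<rho>0, \<Psi>0)" and sS: "\<And>n. s (Suc n) = (SOME y. P y \<and> Q (s n) y)"
      by (simp_all add: s_def)
    have Ps: "P (s n)" for n
    proof (induction n)
      case 0 then show ?case using start by (simp add: s0 P_def)
    next
      case (Suc n) then show ?case unfolding sS using someI_ex[OF step[OF Suc]] by blast
    qed
    have "Q (s n) (s (Suc n))" for n unfolding sS using someI_ex[OF step[OF Ps]] by blast
    then show ?thesis using s0 Ps by blast
  qed
  then obtain s where s: "\<And>n. P (s n)" "\<And>n. Q (s n) (s (Suc n))" by blast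
  define \<rho> where "\<rho> = (\<lambda>n. fst (s n))"
  define \<Phi> where "\<Phi> = (\<lambda>n. snd (s n))"
  define q where "q = (\<lambda>n. \<Phi> n 0)"
  have "\<forall>n. \<exists>c. norm c = \<rho> n / 2 \<and> q (Suc n) = \<Phi> n c \<and> \<rho> (Suc n) \<le> 3 / 4 * \<rho> n"
    using s(2) by (auto simp: Q_def \<rho>_def \<Phi>_def q_def)
  then obtain b where b: "\<And>n. norm (b n) = \<rho> n / 2" "\<And>n. q (Suc n) = \<Phi> n (b n)"
    "\<And>n. \<rho> (Suc n) \<le> 3 / 4 * \<rho> n" by metis
  have \<rho>pos: "\<rho> n > 0" and fl: "flow_on (ball 0 (\<rho> n)) (\<Phi> n)"
    and mx: "\<And>r \<Psi>. flow_on (ball 0 r) \<Psi> \<Longrightarrow> \<Psi> 0 = q n \<Longrightarrow> r \<le> \<rho> n" for n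
    using s(1)[of n] by (auto simp: P_def max_disc_def \<rho>_def \<Phi>_def q_def)
  have \<rho>geo: "\<rho> n \<le> (3/4) ^ n * \<rho> 0" for n
  proof (induction n)
    case (Suc n) then show ?case using b(3)[of n] by simp
  qed simp
  have qX: "q n \<in> topspace X" for n
    using flow_in_topspace[OF fl, of 0 n] \<rho>pos[of n] by (simp add: q_def)
  define \<gamma> where "\<gamma> = (\<lambda>n t. \<Phi> n (0 + complex_of_real t * b n))"
  have inball: "0 + complex_of_real t * b n \<in> ball 0 (\<rho> n)" "norm (complex_of_real t * b n) \<le> \<rho> n / 2"
    if t: "t \<in> {0..1}" for t n
  proof -
    have "norm (complex_of_real t * b n) \<le> 1 * (\<rho> n / 2)"
      unfolding norm_mult b(1) by (rule mult_right_mono) (use t \<rho>pos[of n] in auto)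
    then show "0 + complex_of_real t * b n \<in> ball 0 (\<rho> n)" "norm (complex_of_real t * b n) \<le> \<rho> n / 2"
      using \<rho>pos[of n] by auto
  qed
  \<comment> \<open>ratio of the geometric series that bounds the lengths of the steps\<close>
  define \<theta> where "\<theta> = (3/4::real) powr \<beta>"
  have \<theta>: "0 < \<theta>" "\<theta> < 1" using \<beta> powr_less_mono2[of \<beta> "3/4" 1] by (auto simp: \<theta>_def)
  define C where "C = K * (\<rho> 0) powr \<beta>"
  have C: "C \<ge> 0" using K by (simp add: C_def)
  have curve: "\<exists>L. rect_curve (\<gamma> n) L \<and> L \<le> C * \<theta> ^ n" for n
  proof -
    have hc: "holo_curve (ball 0 (\<rho> n)) (\<Phi> n)" by (rule flow_holo_curve[OF fl open_ball])
    obtain L where L: "rect_curve (\<lambda>t. \<Phi> n (0 + of_real t * b n)) L"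
      and Lb: "\<And>B. (\<And>t. t \<in> {0..1} \<Longrightarrow> \<exists>c\<in>A. \<Phi> n (0 + of_real t * b n) \<in> fst c \<and>
        \<mu> c (\<Phi> n (0 + of_real t * b n)) * norm (deriv (snd c \<circ> \<Phi> n) (0 + of_real t * b n)) \<le> B) \<Longrightarrow> L \<le> B * norm (b n)"
      by (rule rect_curve_segment[OF hc, of 0 "b n"], erule inball(1)) blast
    have "L \<le> (K * (\<rho> n / 2) powr (\<beta> - 1)) * norm (b n)"
    proof (rule Lb)
      fix t :: real assume t: "t \<in> {0..1}"
      let ?w = "0 + complex_of_real t * b n"
      have w: "?w \<in> ball 0 (\<rho> n)" by (rule inball(1)[OF t])
      obtain c where c: "c \<in> A" "\<Phi> n ?w \<in> fst c" using chart_at[OF flow_in_topspace[OF fl w]] .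
      have sub: "(\<lambda>z. ?w + z) ` ball 0 (\<rho> n / 2) \<subseteq> ball 0 (\<rho> n)"
      proof
        fix x assume "x \<in> (\<lambda>z. ?w + z) ` ball 0 (\<rho> n / 2)"
        then obtain z where "z \<in> ball 0 (\<rho> n / 2)" and z2: "x = ?w + z" by (rule imageE)
        then have z: "norm z < \<rho> n / 2" by simp
        from z z2 show "x \<in> ball 0 (\<rho> n)"
          using norm_triangle_ineq[of "complex_of_real t * b n" z] inball(2)[OF t, of n] by simp
      qed
      have sh: "flow_on (ball 0 (\<rho> n / 2)) (\<lambda>z. \<Phi> n (?w + z))"
        by (rule flow_on_shift[OF fl open_ball open_ball sub])
      \<comment> \<open>a point of the segment is the centre of a flow disc of radius \<open>\<rho> n / 2\<close> inside the n-th disc\<close>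
      have "\<mu> c (\<Phi> n (?w + 0)) * norm (H c (\<Phi> n (?w + 0))) \<le> K * (\<rho> n / 2) powr (\<beta> - 1)"
        by (rule est[OF _ sh]) (use \<rho>pos[of n] c in auto)
      moreover have "deriv (snd c \<circ> \<Phi> n) ?w = H c (\<Phi> n ?w)"
        by (rule DERIV_imp_deriv[OF flow_deriv[OF fl w c]])
      ultimately have "\<mu> c (\<Phi> n ?w) * norm (deriv (snd c \<circ> \<Phi> n) ?w) \<le> K * (\<rho> n / 2) powr (\<beta> - 1)"
        by simp
      with c show "\<exists>c\<in>A. \<Phi> n ?w \<in> fst c \<and>
        \<mu> c (\<Phi> n ?w) * norm (deriv (snd c \<circ> \<Phi> n) ?w) \<le> K * (\<rho> n / 2) powr (\<beta> - 1)" by blast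
    qed
    also have "\<dots> = K * (\<rho> n / 2) powr \<beta>"
      using \<rho>pos[of n] by (simp add: b(1) powr_diff)
    also have "\<dots> \<le> K * ((3/4) ^ n * \<rho> 0) powr \<beta>"
      using \<rho>geo[of n] \<rho>pos[of n] \<beta> K by (intro mult_left_mono powr_mono2) auto
    also have "\<dots> = C * \<theta> ^ n"
    proof -
      have "((3/4::real) ^ n) powr \<beta> = \<theta> ^ n"
        unfolding \<theta>_def by (simp add: powr_realpow[symmetric] powr_powr mult.commute)
      then show ?thesis using \<rho>pos[of 0] by (simp add: C_def powr_mult)
    qed
    finally show ?thesis using L by (auto simp: \<gamma>_def)
  qed
  then obtain l where l: "\<And>n. rect_curve (\<gamma> n) (l n)" "\<And>n. l n \<le> C * \<theta> ^ n" by metis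
  have \<gamma>ends: "\<gamma> n 0 = q n" "\<gamma> n 1 = q (Suc n)" for n
    unfolding b(2) by (simp_all add: \<gamma>_def q_def)
  have chain: "\<exists>L. L \<le> C * \<theta> ^ m / (1 - \<theta>) * (1 - \<theta> ^ k) \<and> joined (q m) (q (m + k)) L" for m k
  proof (induction k)
    case 0
    have hc: "holo_curve (ball 0 (\<rho> m)) (\<Phi> m)" by (rule flow_holo_curve[OF fl open_ball])
    obtain L where L: "rect_curve (\<lambda>t. \<Phi> m (0 + of_real t * 0)) L"
      and Lb: "\<And>B. (\<And>t. t \<in> {0..1} \<Longrightarrow> \<exists>c\<in>A. \<Phi> m (0 + of_real t * 0) \<in> fst c \<and>
        \<mu> c (\<Phi> m (0 + of_real t * 0)) * norm (deriv (snd c \<circ> \<Phi> m) (0 + of_real t * 0)) \<le> B) \<Longrightarrow> L \<le> B * norm (0::complex)"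
      by (rule rect_curve_segment[OF hc, of 0 0]) (use \<rho>pos[of m] in auto)
    obtain c where c: "c \<in> A" "\<Phi> m 0 \<in> fst c" using chart_at[OF qX[of m]] by (auto simp: q_def)
    have "L \<le> 0"
      using Lb[of "\<mu> c (\<Phi> m 0) * norm (deriv (snd c \<circ> \<Phi> m) 0)"] c by auto
    then show ?case using L
      by (intro exI[of _ L]) (auto simp: joined_def q_def)
  next
    case (Suc k)
    then obtain L where L: "L \<le> C * \<theta> ^ m / (1 - \<theta>) * (1 - \<theta> ^ k)" "joined (q m) (q (m + k)) L" by blast
    have "joined (q (m + k)) (q (Suc (m + k))) (l (m + k))"
      unfolding joined_def using l(1) \<gamma>ends by blast
    from joined_trans[OF L(2) this] have "joined (q m) (q (m + Suc k)) (L + l (m + k))" by simp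
    moreover have "L + l (m + k) \<le> C * \<theta> ^ m / (1 - \<theta>) * (1 - \<theta> ^ Suc k)"
    proof -
      have "L + l (m + k) \<le> C * \<theta> ^ m / (1 - \<theta>) * (1 - \<theta> ^ k) + C * \<theta> ^ (m + k)"
        using L(1) l(2)[of "m + k"] by linarith
      also have "\<dots> = C * \<theta> ^ m / (1 - \<theta>) * (1 - \<theta> ^ Suc k)"
        using \<theta> by (simp add: field_simps power_add)
      finally show ?thesis .
    qed
    ultimately show ?case by blast
  qed
  have chain': "\<exists>L. L \<le> C * \<theta> ^ N / (1 - \<theta>) \<and> joined (q m) (q n) L" if "N \<le> m" "m \<le> n" for N m n
  proof -
    have "m + (n - m) = n" using that by simp
    then obtain L where L: "L \<le> C * \<theta> ^ m / (1 - \<theta>) * (1 - \<theta> ^ (n - m))" "joined (q m) (q n) L"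
      using chain[of m "n - m"] by metis
    note L(1)
    also have "C * \<theta> ^ m / (1 - \<theta>) * (1 - \<theta> ^ (n - m)) \<le> C * \<theta> ^ m / (1 - \<theta>) * 1"
      using C \<theta> by (intro mult_left_mono) auto
    also have "\<dots> \<le> C * \<theta> ^ N / (1 - \<theta>)"
      using C \<theta> that by (auto intro!: divide_right_mono mult_left_mono power_decreasing)
    finally show ?thesis using L(2) by blast
  qed
  have tail0: "(\<lambda>N. C * \<theta> ^ N / (1 - \<theta>)) \<longlonglongrightarrow> 0"
    using \<theta> by (intro tendsto_eq_intros LIMSEQ_power_zero) auto
  have "\<exists>p \<in> topspace X. (\<lambda>n. induced_dist X A f (q n) p) \<longlonglongrightarrow> 0"
  proof (rule complete[unfolded complete_induced_metric_def, rule_format])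
    show "range q \<subseteq> topspace X" using qX by blast
    fix \<epsilon> :: real assume "\<epsilon> > 0"
    with tail0 obtain N where N: "C * \<theta> ^ N / (1 - \<theta>) < \<epsilon>"
      using order_tendstoD(2)[OF tail0] by (metis eventually_sequentially order_refl)
    have "induced_dist X A f (q m) (q n) < \<epsilon>" if mn: "N \<le> m" "N \<le> n" for m n
    proof -
      have "\<exists>L. L \<le> C * \<theta> ^ N / (1 - \<theta>) \<and> joined (q m) (q n) L"
      proof (cases "m \<le> n")
        case True then show ?thesis using chain' mn by blast
      next
        case False
        then have "n \<le> m" by simp
        then obtain L where "L \<le> C * \<theta> ^ N / (1 - \<theta>)" "joined (q n) (q m) L" using chain' mn by blast
        then show ?thesis using joined_reverse by blast
      qed
      then obtain L where "L \<le> C * \<theta> ^ N / (1 - \<theta>)" "joined (q m) (q n) L" by blast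
      then show ?thesis using induced_dist_le N by fastforce
    qed
    then show "\<exists>N. \<forall>m\<ge>N. \<forall>n\<ge>N. induced_dist X A f (q m) (q n) < \<epsilon>" by blast
  qed
  then obtain p where p: "p \<in> topspace X" and lim: "(\<lambda>n. induced_dist X A f (q n) p) \<longlonglongrightarrow> 0" by blast
  obtain c where c: "c \<in> A" "p \<in> fst c" using chart_at[OF p] .
  have evc: "eventually (\<lambda>n. q n \<in> fst c) sequentially" and limc: "(\<lambda>n. snd c (q n)) \<longlonglongrightarrow> snd c p"
    using induced_dist_tendsto_chart[OF conn c qX lim] by auto
  have \<rho>0: "\<rho> \<longlonglongrightarrow> 0"
  proof (rule tendsto_sandwich[OF _ _ tendsto_const])
    show "(\<lambda>n. (3/4) ^ n * \<rho> 0) \<longlonglongrightarrow> 0" by (intro tendsto_eq_intros LIMSEQ_power_zero) auto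
  qed (use \<rho>pos \<rho>geo in \<open>auto simp: less_imp_le\<close>)
  show False
  proof (cases "H c p = 0")
    case False
    obtain N \<delta> where N: "openin X N" "p \<in> N" "\<delta> > 0"
      "\<And>q. q \<in> N \<Longrightarrow> \<exists>\<Phi>. flow_on (ball 0 \<delta>) \<Phi> \<and> \<Phi> 0 = q"
      by (rule flow_exists_locally[OF c False]) (rule that)
    have opN: "open (snd c ` (N \<inter> fst c))"
      by (rule chart_image_open[OF c(1)]) (use N(1) chart_openin[OF c(1)] in auto)
    have "eventually (\<lambda>n. snd c (q n) \<in> snd c ` (N \<inter> fst c)) sequentially"
      by (rule topological_tendstoD[OF limc opN]) (use N c in auto)
    moreover have "eventually (\<lambda>n. \<rho> n < \<delta>) sequentially"
      using order_tendstoD(2)[OF \<rho>0 N(3)] .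
    ultimately have "eventually (\<lambda>n. False) sequentially" using evc
    proof eventually_elim
      case (elim n)
      then have "q n \<in> N" using inj_onD[OF chart_inj[OF c(1)]] by auto
      then obtain \<Psi> where "flow_on (ball 0 \<delta>) \<Psi>" "\<Psi> 0 = q n" using N(4) by blast
      from mx[OF this] elim show False by simp
    qed
    then show False by simp
  next
    case True
    obtain s m where sm: "s > 0" "m > 0" "cball (snd c p) s \<subseteq> snd c ` fst c"
      "\<And>q. q \<in> fst c \<Longrightarrow> snd c q \<in> cball (snd c p) s \<Longrightarrow> m \<le> \<mu> c q"
      by (rule good_ball[OF c]) (rule that)
    define h where "h = in_chart c (H c)"
    have holh: "h holomorphic_on snd c ` fst c" unfolding h_def by (rule H_holo[OF c(1)])
    have hd: "(h has_field_derivative deriv h z) (at z)" if "z \<in> snd c ` fst c" for z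
      by (rule holomorphic_derivI[OF holh chart_open[OF c(1)] that])
    have "continuous_on (cball (snd c p) s) (deriv h)"
      using holomorphic_deriv[OF holh chart_open[OF c(1)]] sm(3)
      by (meson continuous_on_subset holomorphic_on_imp_continuous_on)
    then have "bounded (deriv h ` cball (snd c p) s)"
      by (intro compact_imp_bounded compact_continuous_image) auto
    then obtain M where M: "M > 0" "\<And>z. z \<in> cball (snd c p) s \<Longrightarrow> norm (deriv h z) \<le> M"
      unfolding bounded_pos by auto
    have "(\<lambda>n. norm (snd c (q n) - snd c p) + C * \<theta> ^ n / m) \<longlonglongrightarrow> norm (snd c p - snd c p) + C * 0 / m"
      using \<theta> sm(2) by (intro tendsto_intros limc LIMSEQ_power_zero) auto
    then have "eventually (\<lambda>n. norm (snd c (q n) - snd c p) + C * \<theta> ^ n / m < s) sequentially"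
      using order_tendstoD(2)[of _ 0 sequentially s] sm(1) by simp
    with evc have "eventually (\<lambda>n. q n \<in> fst c \<and> norm (snd c (q n) - snd c p) + C * \<theta> ^ n / m < s) sequentially"
      by eventually_elim simp
    then obtain n0 where n0: "\<And>n. n \<ge> n0 \<Longrightarrow> q n \<in> fst c \<and> norm (snd c (q n) - snd c p) + C * \<theta> ^ n / m < s"
      unfolding eventually_sequentially by blast
    let ?h = "\<lambda>n. norm (h (snd c (q n)))"
    have step: "ln (?h n) - M * (\<rho> n / 2) \<le> ln (?h (Suc n))" if n: "n \<ge> n0" for n
    proof -
      have stay: "\<gamma> n t \<in> fst c \<and> snd c (\<gamma> n t) \<in> ball (snd c p) s" if t: "t \<in> {0..1}" for t
      proof -
        have "l n / m \<le> C * \<theta> ^ n / m" using l(2)[of n] sm(2) by (simp add: divide_right_mono)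
        moreover have "norm (snd c (q n) - snd c p) + C * \<theta> ^ n / m < s" using n0[OF n] by (rule conjunct2)
        ultimately have short: "norm (snd c (\<gamma> n 0) - snd c p) + l n / m < s"
          unfolding \<gamma>ends by linarith
        have g0: "\<gamma> n 0 \<in> fst c" unfolding \<gamma>ends using n0[OF n] by (rule conjunct1)
        have "\<gamma> n t \<in> fst c \<and> snd c (\<gamma> n t) \<in> ball (snd c p) s \<and>
            norm (snd c (\<gamma> n t) - snd c (\<gamma> n 0)) \<le> l n / m"
          by (rule rect_curve_stays[OF l(1) c(1) sm(2,3) _ g0 short t], erule sm(4))
        then show ?thesis by (elim conjE) (intro conjI)
      qed
      define y where "y = (\<lambda>t. h (snd c (\<gamma> n t)))"
      define y' where "y' = (\<lambda>t. b n * H c (\<gamma> n t) * deriv h (snd c (\<gamma> n t)))"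
      have yH: "y t = H c (\<gamma> n t)" if "t \<in> {0..1}" for t
        using stay[OF that] c by (simp add: y_def h_def)
      have "ln (norm (y 0)) - M * norm (b n) \<le> ln (norm (y 1))"
      proof (rule norm_decay_bound)
        fix t :: real assume t: "t \<in> {0..1}"
        have g: "\<gamma> n t \<in> fst c" "snd c (\<gamma> n t) \<in> snd c ` fst c" using stay[OF t] by auto
        have w: "0 + complex_of_real t * b n \<in> ball 0 (\<rho> n)" by (rule inball(1)[OF t])
        have "((\<lambda>t. 0 + complex_of_real t * b n) has_vector_derivative b n) (at t)"
          by (auto intro!: derivative_eq_intros simp: has_vector_derivative_def scaleR_conv_of_real)
        moreover have "((snd c \<circ> \<Phi> n) has_field_derivative H c (\<gamma> n t)) (at (0 + complex_of_real t * b n))"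
          using flow_deriv[OF fl w c(1)] g by (simp add: \<gamma>_def)
        ultimately have "((snd c \<circ> \<Phi> n) \<circ> (\<lambda>t. 0 + complex_of_real t * b n) has_vector_derivative b n * H c (\<gamma> n t)) (at t)"
          by (rule field_vector_diff_chain_at)
        moreover have "((snd c \<circ> \<Phi> n) \<circ> (\<lambda>t. 0 + complex_of_real t * b n)) = (\<lambda>t. snd c (\<gamma> n t))"
          by (simp add: o_def \<gamma>_def)
        ultimately have d1: "((\<lambda>t. snd c (\<gamma> n t)) has_vector_derivative b n * H c (\<gamma> n t)) (at t)" by simp
        have "(h \<circ> (\<lambda>t. snd c (\<gamma> n t)) has_vector_derivative b n * H c (\<gamma> n t) * deriv h (snd c (\<gamma> n t))) (at t)"
          by (rule field_vector_diff_chain_at[OF d1 hd[OF g(2)]])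
        then show "(y has_vector_derivative y' t) (at t)" by (simp add: y_def y'_def o_def)
        have Hnz: "H c (\<gamma> n t) \<noteq> 0" using flow_nz[OF fl w c(1)] g by (simp add: \<gamma>_def)
        then show "y t \<noteq> 0" using yH[OF t] by simp
        have "norm (y' t) = norm (b n) * norm (y t) * norm (deriv h (snd c (\<gamma> n t)))"
          using yH[OF t] by (simp add: y'_def norm_mult)
        also have "\<dots> \<le> norm (b n) * norm (y t) * M"
          by (intro mult_left_mono M) (use stay[OF t] in auto)
        finally show "norm (y' t) \<le> M * norm (b n) * norm (y t)" by (simp add: mult_ac)
      qed
      then show ?thesis by (simp add: y_def \<gamma>ends b(1))
    qed
    \<comment> \<open>the corrections \<open>\<rho> n / 2\<close> sum up to at most \<open>2 \<rho> n0\<close> since \<open>\<rho>\<close> decays by the factor 3/4\<close>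
    define E where "E = ln (?h n0) - M * (2 * \<rho> n0)"
    have low: "ln (?h (n0 + k)) \<ge> E + M * (2 * \<rho> (n0 + k))" for k
    proof (induction k)
      case 0 then show ?case by (simp add: E_def)
    next
      case (Suc k)
      have "M * (2 * \<rho> (n0 + Suc k)) \<le> M * (2 * \<rho> (n0 + k) - \<rho> (n0 + k) / 2)"
        using b(3)[of "n0 + k"] M(1) by (intro mult_left_mono) auto
      then show ?case using Suc step[of "n0 + k"] by (simp add: algebra_simps)
    qed
    have hpos: "?h n > 0" if "n \<ge> n0" for n
    proof -
      have z: "0 \<in> ball 0 (\<rho> n)" "\<Phi> n 0 \<in> fst c" using n0[OF that] \<rho>pos[of n] by (auto simp: q_def)
      have "h (snd c (q n)) = H c (q n)" using n0[OF that] c by (simp add: h_def)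
      then show ?thesis using flow_nz[OF fl z(1) c(1) z(2)] by (simp add: q_def)
    qed
    have "?h (n0 + k) \<ge> exp E" for k
    proof -
      have "E \<le> ln (?h (n0 + k))" using low[of k] M(1) \<rho>pos[of "n0 + k"]
        by (smt (verit) mult_nonneg_nonneg)
      then show ?thesis using hpos[of "n0 + k"] by (metis exp_le_cancel_iff exp_ln le_add1)
    qed
    then have ge: "?h n \<ge> exp E" if "n \<ge> n0" for n using that le_Suc_ex by blast
    have "isCont h (snd c p)" using hd[of "snd c p"] c by (auto intro: DERIV_isCont)
    then have "(\<lambda>n. h (snd c (q n))) \<longlonglongrightarrow> h (snd c p)" using limc by (rule isCont_tendsto_compose)
    then have "?h \<longlonglongrightarrow> norm (h (snd c p))" by (rule tendsto_norm)
    moreover have "h (snd c p) = 0" using True c by (simp add: h_def)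
    ultimately have "?h \<longlonglongrightarrow> 0" by simp
    then have "exp E \<le> 0" by (rule LIMSEQ_le_const) (use ge in blast)
    then show False by simp
  qed
qed

end

lemma has_derivative_along_line:
  fixes u :: "complex \<Rightarrow> 'b::real_normed_vector"
  assumes "(u has_derivative D) (at (z + of_real t * v))"
  shows "((\<lambda>s. u (z + of_real s * v)) has_vector_derivative D v) (at t)"
proof -
  have "((\<lambda>s. z + of_real s * v) has_derivative (\<lambda>h. h *\<^sub>R v)) (at t)"
    by (auto intro!: derivative_eq_intros simp: scaleR_conv_of_real)
  from has_derivative_compose[OF this assms]
  have "((\<lambda>s. u (z + of_real s * v)) has_derivative (\<lambda>h. D (h *\<^sub>R v))) (at t)" .
  then show ?thesis
    unfolding has_vector_derivative_def
    using linear_scale[OF has_derivative_linear[OF assms]] by simp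
qed

section \<open>Conformal minimal Lagrangian maps in a coordinate\<close>

text \<open>The second difference of \<open>u\<close> over a square with sides \<open>s v\<close> and \<open>s w\<close> is symmetric in \<open>v\<close> and \<open>w\<close>.
  The mean value theorem is applied to the scalar function obtained from \<open>u\<close> by the inner product
  with \<open>d\<close>, since it fails for vector-valued functions.\<close>

lemma double_mean_value:
  fixes u :: "complex \<Rightarrow> 'b::real_inner" and d :: 'b
  assumes s: "s > 0"
    and box: "\<And>\<xi> \<eta>. \<xi> \<in> {0..s} \<Longrightarrow> \<eta> \<in> {0..s} \<Longrightarrow> z0 + of_real \<xi> * v + of_real \<eta> * w \<in> S"
    and du: "\<And>z. z \<in> S \<Longrightarrow> u differentiable (at z)"
    and dv: "\<And>z. z \<in> S \<Longrightarrow> (\<lambda>z. frechet_derivative u (at z) v) differentiable (at z)"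
  shows "\<exists>\<xi>\<in>{0..s}. \<exists>\<eta>\<in>{0..s}.
    (u (z0 + of_real s * v + of_real s * w) - u (z0 + of_real s * v) - u (z0 + of_real s * w) + u z0) \<bullet> d
      = s * s * (frechet_derivative (\<lambda>z. frechet_derivative u (at z) v)
          (at (z0 + of_real \<xi> * v + of_real \<eta> * w)) w \<bullet> d)"
proof -
  define uv where "uv = (\<lambda>z. frechet_derivative u (at z) v)"
  define \<phi> where "\<phi> = (\<lambda>t. (u ((z0 + of_real s * w) + of_real t * v) - u (z0 + of_real t * v)) \<bullet> d)"
  have inS: "(z0 + of_real s * w) + of_real t * v \<in> S" "z0 + of_real t * v \<in> S"
    if "t \<in> {0..s}" for t
    using box[OF that, of s] box[OF that, of 0] s by (simp_all add: algebra_simps)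
  have line: "((\<lambda>t. u (z + of_real t * v)) has_vector_derivative uv (z + of_real t * v)) (at t)"
    if "z + of_real t * v \<in> S" for z t
    unfolding uv_def by (rule has_derivative_along_line) (use du[OF that] frechet_derivative_works in blast)
  have d\<phi>: "(\<phi> has_real_derivative (uv ((z0 + of_real s * w) + of_real t * v) - uv (z0 + of_real t * v)) \<bullet> d) (at t)"
    if t: "t \<in> {0..s}" for t
    unfolding \<phi>_def has_real_derivative_iff_has_vector_derivative
    by (rule bounded_linear.has_vector_derivative[OF bounded_linear_inner_left])
      (intro has_vector_derivative_diff line inS t)
  obtain \<xi> where \<xi>: "0 < \<xi>" "\<xi> < s"
    "\<phi> s - \<phi> 0 = (s - 0) * ((uv ((z0 + of_real s * w) + of_real \<xi> * v) - uv (z0 + of_real \<xi> * v)) \<bullet> d)"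
    using MVT2[OF s, of \<phi> "\<lambda>t. (uv ((z0 + of_real s * w) + of_real t * v) - uv (z0 + of_real t * v)) \<bullet> d"] d\<phi>
    by auto
  define \<psi> where "\<psi> = (\<lambda>t. uv ((z0 + of_real \<xi> * v) + of_real t * w) \<bullet> d)"
  have d\<psi>: "(\<psi> has_real_derivative frechet_derivative uv (at ((z0 + of_real \<xi> * v) + of_real t * w)) w \<bullet> d) (at t)"
    if t: "t \<in> {0..s}" for t
    unfolding \<psi>_def has_real_derivative_iff_has_vector_derivative
  proof (rule bounded_linear.has_vector_derivative[OF bounded_linear_inner_left])
    have "(z0 + of_real \<xi> * v) + of_real t * w \<in> S" using box[of \<xi> t] \<xi> t by simp
    from dv[OF this] show "((\<lambda>t. uv ((z0 + of_real \<xi> * v) + of_real t * w)) has_vector_derivative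
        frechet_derivative uv (at ((z0 + of_real \<xi> * v) + of_real t * w)) w) (at t)"
      by (intro has_derivative_along_line) (simp add: frechet_derivative_works uv_def)
  qed
  obtain \<eta> where \<eta>: "0 < \<eta>" "\<eta> < s"
    "\<psi> s - \<psi> 0 = (s - 0) * (frechet_derivative uv (at ((z0 + of_real \<xi> * v) + of_real \<eta> * w)) w \<bullet> d)"
    using MVT2[OF s, of \<psi> "\<lambda>t. frechet_derivative uv (at ((z0 + of_real \<xi> * v) + of_real t * w)) w \<bullet> d"] d\<psi>
    by auto
  have "(u (z0 + of_real s * v + of_real s * w) - u (z0 + of_real s * v) - u (z0 + of_real s * w) + u z0) \<bullet> d = \<phi> s - \<phi> 0"
    by (simp add: \<phi>_def inner_diff_left inner_add_left algebra_simps)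
  also have "\<dots> = s * (\<psi> s - \<psi> 0)"
    unfolding \<xi>(3) by (simp add: \<psi>_def inner_diff_left algebra_simps)
  also have "\<dots> = s * s * (frechet_derivative uv (at ((z0 + of_real \<xi> * v) + of_real \<eta> * w)) w \<bullet> d)"
    unfolding \<eta>(3) by simp
  finally show ?thesis
    using \<xi> \<eta> unfolding uv_def by (intro bexI[of _ \<xi>] bexI[of _ \<eta>]) auto
qed

text \<open>The two mixed derivatives are limits of the same second difference quotient. It is tested against
  the difference \<open>d\<close> of the two derivatives.\<close>

lemma mixed_partials_commute:
  fixes u :: "complex \<Rightarrow> 'b::real_inner"
  assumes S: "open S" "z0 \<in> S"
    and du: "\<And>z. z \<in> S \<Longrightarrow> u differentiable (at z)"
    and dx: "\<And>z. z \<in> S \<Longrightarrow> Dx u differentiable (at z)"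
    and dy: "\<And>z. z \<in> S \<Longrightarrow> Dy u differentiable (at z)"
    and cxy: "continuous_on S (Dy (Dx u))" and cyx: "continuous_on S (Dx (Dy u))"
  shows "Dy (Dx u) z0 = Dx (Dy u) z0"
proof (rule ccontr)
  assume ne: "Dy (Dx u) z0 \<noteq> Dx (Dy u) z0"
  define d where "d = Dy (Dx u) z0 - Dx (Dy u) z0"
  have dd: "d \<bullet> d > 0" using ne by (simp add: d_def)
  have c1: "isCont (Dy (Dx u)) z0" and c2: "isCont (Dx (Dy u)) z0"
    using cxy cyx S by (auto simp: continuous_on_eq_continuous_at)
  have "isCont (\<lambda>z. Dy (Dx u) z \<bullet> d) z0" "isCont (\<lambda>z. Dx (Dy u) z \<bullet> d) z0"
    by (intro continuous_intros c1 c2)+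
  then have lim: "((\<lambda>z. Dy (Dx u) z \<bullet> d) \<longlongrightarrow> Dy (Dx u) z0 \<bullet> d) (nhds z0)"
      "((\<lambda>z. Dx (Dy u) z \<bullet> d) \<longlongrightarrow> Dx (Dy u) z0 \<bullet> d) (nhds z0)"
    unfolding isCont_def
    by (auto intro: tendsto_at_iff_tendsto_nhds[of "\<lambda>z. Dy (Dx u) z \<bullet> d", THEN iffD1]
        tendsto_at_iff_tendsto_nhds[of "\<lambda>z. Dx (Dy u) z \<bullet> d", THEN iffD1])
  have gap: "Dy (Dx u) z0 \<bullet> d - d \<bullet> d / 2 < Dy (Dx u) z0 \<bullet> d"
    "Dx (Dy u) z0 \<bullet> d < Dx (Dy u) z0 \<bullet> d + d \<bullet> d / 2" using dd by simp_all
  have "eventually (\<lambda>z. Dy (Dx u) z0 \<bullet> d - d \<bullet> d / 2 < Dy (Dx u) z \<bullet> d \<and>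
      Dx (Dy u) z \<bullet> d < Dx (Dy u) z0 \<bullet> d + d \<bullet> d / 2 \<and> z \<in> S) (nhds z0)"
    using order_tendstoD(1)[OF lim(1) gap(1)] order_tendstoD(2)[OF lim(2) gap(2)]
      eventually_nhds_in_open[OF S] by eventually_elim simp
  then obtain e where e: "e > 0" "\<And>z. dist z z0 < e \<Longrightarrow> Dy (Dx u) z0 \<bullet> d - d \<bullet> d / 2 < Dy (Dx u) z \<bullet> d \<and>
      Dx (Dy u) z \<bullet> d < Dx (Dy u) z0 \<bullet> d + d \<bullet> d / 2 \<and> z \<in> S"
    unfolding eventually_nhds_metric by blast
  define s where "s = e / 3"
  have s: "s > 0" using e by (simp add: s_def)
  have close: "dist (z0 + of_real \<xi> * v + of_real \<eta> * w) z0 < e"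
    if "\<xi> \<in> {0..s}" "\<eta> \<in> {0..s}" "norm v = 1" "norm w = 1" for \<xi> \<eta> and v w :: complex
  proof -
    have "norm (of_real \<xi> * v + of_real \<eta> * w) \<le> \<bar>\<xi>\<bar> + \<bar>\<eta>\<bar>"
      using norm_triangle_ineq[of "of_real \<xi> * v" "of_real \<eta> * w"] that by (simp add: norm_mult)
    also have "\<dots> < e" using that e by (simp add: s_def)
    finally show ?thesis by (simp add: dist_norm add.assoc)
  qed
  have n: "norm (1::complex) = 1" "norm \<i> = 1" by simp_all
  have dvx: "(\<lambda>z. frechet_derivative u (at z) 1) = Dx u" "(\<lambda>z. frechet_derivative u (at z) \<i>) = Dy u"
    by (auto simp: Dx_def Dy_def)
  let ?\<Delta> = "(u (z0 + of_real s * 1 + of_real s * \<i>) - u (z0 + of_real s * 1) - u (z0 + of_real s * \<i>) + u z0) \<bullet> d"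
  have "\<exists>\<xi>\<in>{0..s}. \<exists>\<eta>\<in>{0..s}. ?\<Delta> = s * s * (frechet_derivative (\<lambda>z. frechet_derivative u (at z) 1)
          (at (z0 + of_real \<xi> * 1 + of_real \<eta> * \<i>)) \<i> \<bullet> d)"
    by (rule double_mean_value[OF s, of z0 1 \<i> S]) (use close[OF _ _ n] e(2) du dx dvx in auto)
  then obtain \<xi> \<eta> where 1: "\<xi> \<in> {0..s}" "\<eta> \<in> {0..s}"
    "?\<Delta> = s * s * (Dy (Dx u) (z0 + of_real \<xi> * 1 + of_real \<eta> * \<i>) \<bullet> d)"
    unfolding dvx Dy_def[of "Dx u"] by blast
  let ?\<Delta>' = "(u (z0 + of_real s * \<i> + of_real s * 1) - u (z0 + of_real s * \<i>) - u (z0 + of_real s * 1) + u z0) \<bullet> d"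
  have "\<exists>\<xi>\<in>{0..s}. \<exists>\<eta>\<in>{0..s}. ?\<Delta>' = s * s * (frechet_derivative (\<lambda>z. frechet_derivative u (at z) \<i>)
          (at (z0 + of_real \<xi> * \<i> + of_real \<eta> * 1)) 1 \<bullet> d)"
    by (rule double_mean_value[OF s, of z0 \<i> 1 S]) (use close[OF _ _ n(2,1)] e(2) du dy dvx in auto)
  then obtain \<xi>' \<eta>' where 2: "\<xi>' \<in> {0..s}" "\<eta>' \<in> {0..s}"
    "?\<Delta>' = s * s * (Dx (Dy u) (z0 + of_real \<xi>' * \<i> + of_real \<eta>' * 1) \<bullet> d)"
    unfolding dvx Dx_def[of "Dy u"] by blast
  have "?\<Delta> = ?\<Delta>'" by (simp add: algebra_simps)
  then have eq: "Dy (Dx u) (z0 + of_real \<xi> * 1 + of_real \<eta> * \<i>) \<bullet> d =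
      Dx (Dy u) (z0 + of_real \<xi>' * \<i> + of_real \<eta>' * 1) \<bullet> d"
    using 1(3) 2(3) s by simp
  have "Dy (Dx u) z0 \<bullet> d - d \<bullet> d / 2 < Dy (Dx u) (z0 + of_real \<xi> * 1 + of_real \<eta> * \<i>) \<bullet> d"
    using e(2)[OF close[OF 1(1,2) n]] by blast
  moreover have "Dx (Dy u) (z0 + of_real \<xi>' * \<i> + of_real \<eta>' * 1) \<bullet> d < Dx (Dy u) z0 \<bullet> d + d \<bullet> d / 2"
    using e(2)[OF close[OF 2(1,2) n(2,1)]] by blast
  moreover have "Dy (Dx u) z0 \<bullet> d - Dx (Dy u) z0 \<bullet> d = d \<bullet> d" by (simp add: d_def inner_diff_left)
  ultimately show False using eq by simp
qed

lemma Dx_eq: "(h has_derivative D) (at z) \<Longrightarrow> Dx h z = D 1"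
  and Dy_eq: "(h has_derivative D) (at z) \<Longrightarrow> Dy h z = D \<i>"
  by (simp_all add: Dx_def Dy_def frechet_derivative_at[symmetric])

lemma frechet_derivative_Dx_Dy:
  assumes "h differentiable (at z)"
  shows "frechet_derivative h (at z) v = Re v *\<^sub>R Dx h z + Im v *\<^sub>R Dy h z"
proof -
  have lin: "linear (frechet_derivative h (at z))"
    using assms linear_frechet_derivative by blast
  have "v = Re v *\<^sub>R 1 + Im v *\<^sub>R \<i>" by (simp add: complex_eq_iff)
  then have "frechet_derivative h (at z) v = frechet_derivative h (at z) (Re v *\<^sub>R 1 + Im v *\<^sub>R \<i>)" by simp
  also have "\<dots> = Re v *\<^sub>R Dx h z + Im v *\<^sub>R Dy h z"
    using linear_add[OF lin] linear_scale[OF lin] by (simp add: Dx_def Dy_def)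
  finally show ?thesis .
qed

lemma Cauchy_Riemann_imp_field_derivative:
  fixes p :: "complex \<Rightarrow> complex"
  assumes D: "(p has_derivative D) (at z)" and CR: "D \<i> = \<i> * D 1"
  shows "(p has_field_derivative D 1) (at z)"
proof -
  have lin: "linear D" using D by (rule has_derivative_linear)
  have "D v = D 1 * v" for v
  proof -
    have v: "v = Re v *\<^sub>R 1 + Im v *\<^sub>R \<i>" by (simp add: complex_eq_iff)
    then have "D v = D (Re v *\<^sub>R 1 + Im v *\<^sub>R \<i>)" by simp
    also have "\<dots> = Re v *\<^sub>R D 1 + Im v *\<^sub>R D \<i>"
      using linear_add[OF lin] linear_scale[OF lin] by simp
    also have "\<dots> = D 1 * (Re v *\<^sub>R 1 + Im v *\<^sub>R \<i>)"
      unfolding CR by (simp add: scaleR_conv_of_real algebra_simps)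
    finally show ?thesis using v by simp
  qed
  then have "D = (*) (D 1)" by (rule ext)
  with D show ?thesis unfolding has_field_derivative_def by (simp only:)
qed

text \<open>For a conformal map the mean curvature vector is a multiple of the normal part of the Laplacian.
  Differentiating the two conformality equations shows that the Laplacian has no tangential part:
  it is orthogonal to both coordinate derivatives.\<close>

lemma conformal_minimal_harmonic:
  fixes h :: "complex \<Rightarrow> 'b::euclidean_space"
  assumes S: "open S" "z \<in> S"
    and dx: "\<And>z. z \<in> S \<Longrightarrow> Dx h differentiable (at z)"
    and dy: "\<And>z. z \<in> S \<Longrightarrow> Dy h differentiable (at z)"
    and sym: "Dy (Dx h) z = Dx (Dy h) z"
    and conf: "\<And>z. z \<in> S \<Longrightarrow> Dx h z \<bullet> Dx h z = Dy h z \<bullet> Dy h z \<and> Dx h z \<bullet> Dy h z = 0"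
    and nz: "Dx h z \<noteq> 0" and mc: "mean_curvature h z = 0"
  shows "Dx (Dx h) z + Dy (Dy h) z = 0"
proof -
  let ?x = "Dx h z" and ?y = "Dy h z" and ?xx = "Dx (Dx h) z" and ?yy = "Dy (Dy h) z"
    and ?xy = "Dx (Dy h) z"
  let ?X = "frechet_derivative (Dx h) (at z)" and ?Y = "frechet_derivative (Dy h) (at z)"
  have dX: "(Dx h has_derivative ?X) (at z)" and dY: "(Dy h has_derivative ?Y) (at z)"
    using dx[OF S(2)] dy[OF S(2)] by (simp_all add: frechet_derivative_works)
  have X: "?X 1 = ?xx" "?X \<i> = ?xy" "?Y 1 = ?xy" "?Y \<i> = ?yy"
    using sym by (simp_all add: Dx_def[of "Dx h"] Dy_def[of "Dx h"] Dx_def[of "Dy h"] Dy_def[of "Dy h"])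
  have zero: "D v = 0" if "((\<lambda>z. g z) has_derivative D) (at z)" "\<And>z. z \<in> S \<Longrightarrow> g z = (0::real)" for g D v
  proof -
    have "((\<lambda>z. 0::real) has_derivative D) (at z)"
      by (rule has_derivative_transform_within_open[OF that(1) S]) (use that(2) in auto)
    then show ?thesis using has_derivative_unique[OF _ has_derivative_const] by fastforce
  qed
  have c1: "2 * (?x \<bullet> ?X v) - 2 * (?y \<bullet> ?Y v) = 0" for v
  proof -
    have "((\<lambda>z. Dx h z \<bullet> Dx h z - Dy h z \<bullet> Dy h z) has_derivative
        (\<lambda>v. (?x \<bullet> ?X v + ?X v \<bullet> ?x) - (?y \<bullet> ?Y v + ?Y v \<bullet> ?y))) (at z)"
      by (rule has_derivative_diff[OF has_derivative_inner[OF dX dX] has_derivative_inner[OF dY dY]])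
    from zero[OF this, of v] conf show ?thesis by (simp add: inner_commute)
  qed
  have c2: "?x \<bullet> ?Y v + ?X v \<bullet> ?y = 0" for v
  proof -
    have "((\<lambda>z. Dx h z \<bullet> Dy h z) has_derivative (\<lambda>v. ?x \<bullet> ?Y v + ?X v \<bullet> ?y)) (at z)"
      by (rule has_derivative_inner[OF dX dY])
    from zero[OF this, of v] conf show ?thesis by simp
  qed
  let ?L = "?xx + ?yy"
  have Lx: "?L \<bullet> ?x = 0" and Ly: "?L \<bullet> ?y = 0"
    using c1[of 1] c1[of \<i>] c2[of 1] c2[of \<i>] unfolding X
    by (simp_all add: inner_add_left inner_add_right inner_commute)
  let ?E = "?x \<bullet> ?x"
  have E: "?E > 0" using nz by simp
  have gram: "gram h z = ?E * ?E" and xy0: "?x \<bullet> ?y = 0" "?y \<bullet> ?y = ?E"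
    using conf[OF S(2)] by (auto simp: gram_def)
  let ?W = "span {?x, ?y}"
  have cl: "closest_point ?W w \<in> ?W" for w
    by (rule closest_point_in_set) (simp add: closed_subspace, use span_zero in blast)
  have "?E *\<^sub>R normal_part h z ?xx + ?E *\<^sub>R normal_part h z ?yy = 0"
  proof -
    have "(1 / (2 * (?E * ?E))) *\<^sub>R (?E *\<^sub>R normal_part h z ?xx - (2 * 0) *\<^sub>R normal_part h z (Dy (Dx h) z)
        + ?E *\<^sub>R normal_part h z ?yy) = 0"
      using mc unfolding mean_curvature_def gram xy0 .
    then show ?thesis using E by (simp only: scaleR_eq_0_iff) simp
  qed
  then have "normal_part h z ?xx + normal_part h z ?yy = 0"
    using E by (simp flip: scaleR_add_right)
  then have "?L = closest_point ?W ?xx + closest_point ?W ?yy"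
    unfolding normal_part_def by (simp add: algebra_simps)
  then have LW: "?L \<in> ?W" using span_add[OF cl cl] by simp
  have "orthogonal ?L y" if "y \<in> {?x, ?y}" for y
    using that Lx Ly by (auto simp: orthogonal_def)
  then have "orthogonal ?L ?L" using orthogonal_to_span[OF LW] by blast
  then show ?thesis by (simp add: orthogonal_def)
qed

lemma holomorphic_norm_one_const:
  assumes g: "g holomorphic_on ball z0 e" and e: "e > 0"
    and n: "\<And>z. z \<in> ball z0 e \<Longrightarrow> norm (g z) = 1" and z: "z \<in> ball z0 e"
  shows "g z = g z0"
proof -
  have "g constant_on ball z0 e"
    by (rule maximum_modulus_principle[OF g open_ball connected_ball open_ball order_refl, of z0])
      (use e n in auto)
  then show ?thesis using z e by (auto simp: constant_on_def)
qed

text \<open>For conformal Lagrangian \<open>h\<close> this is \<open>e\<^bsup>i\<beta>\<^esup>\<close>, where \<open>\<beta>\<close> is the Lagrangian angle: the denominator is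
  the area density.\<close>

definition angle :: "(complex \<Rightarrow> complex \<times> complex) \<Rightarrow> complex \<Rightarrow> complex" where
  "angle h z = (fst (Dx h z) * snd (Dy h z) - snd (Dx h z) * fst (Dy h z)) / of_real (Dx h z \<bullet> Dx h z)"

text \<open>Conjugates are replaced by independent variables (capital letters), which turns the computation
  into a polynomial identity.\<close>

lemma lagrangian_frame_algebra:
  fixes x1 x2 y1 y2 X1 X2 Y1 Y2 E j :: complex
  assumes "j * j = - 1" "x1 * Y1 + x2 * Y2 = 0" "X1 * y1 + X2 * y2 = 0"
    "E = x1 * X1 + x2 * X2" "E = y1 * Y1 + y2 * Y2"
  shows "E * (x1 + j * y1) = - j * (x1 * y2 - x2 * y1) * (X2 + j * Y2)"
    and "E * (x2 + j * y2) = j * (x1 * y2 - x2 * y1) * (X1 + j * Y1)"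
    and "(x1 * y2 - x2 * y1) * (X1 * Y2 - X2 * Y1) = E * E"
proof -
  have e: "X2 * y2 = - (X1 * y1)" "x2 * Y2 = - (x1 * Y1)"
    using assms(2,3) by (simp_all add: eq_neg_iff_add_eq_0 add.commute)
  have E1: "E * t = (x1 * X1 + x2 * X2) * t" "E * t = (y1 * Y1 + y2 * Y2) * t" for t
    by (simp_all only: assms(4)[symmetric] assms(5)[symmetric])
  have "- j * (x1 * y2 - x2 * y1) * (X2 + j * Y2)
      = - j * x1 * (X2 * y2) - j * j * (x1 * y2 * Y2) + j * x2 * y1 * X2 + j * j * (y1 * (x2 * Y2))"
    by (simp add: algebra_simps)
  also have "\<dots> = (y1 * Y1 + y2 * Y2) * x1 + j * ((x1 * X1 + x2 * X2) * y1)"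
    unfolding e assms(1) by (simp add: algebra_simps)
  also have "\<dots> = E * x1 + j * (E * y1)" by (simp only: E1(1)[of y1] E1(2)[of x1])
  finally show "E * (x1 + j * y1) = - j * (x1 * y2 - x2 * y1) * (X2 + j * Y2)"
    by (simp add: algebra_simps)
  have e': "X1 * y1 = - (X2 * y2)" "x1 * Y1 = - (x2 * Y2)"
    using e by simp_all
  have "j * (x1 * y2 - x2 * y1) * (X1 + j * Y1)
      = j * x1 * y2 * X1 + j * j * (y2 * (x1 * Y1)) - j * x2 * (X1 * y1) - j * j * (x2 * y1 * Y1)"
    by (simp add: algebra_simps)
  also have "\<dots> = (y1 * Y1 + y2 * Y2) * x2 + j * ((x1 * X1 + x2 * X2) * y2)"
    unfolding e' assms(1) by (simp add: algebra_simps)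
  also have "\<dots> = E * x2 + j * (E * y2)" by (simp only: E1(1)[of y2] E1(2)[of x2])
  finally show "E * (x2 + j * y2) = j * (x1 * y2 - x2 * y1) * (X1 + j * Y1)"
    by (simp add: algebra_simps)
  have "(x1 * y2 - x2 * y1) * (X1 * Y2 - X2 * Y1)
      = (x1 * X1 + x2 * X2) * (y1 * Y1 + y2 * Y2) - (x1 * Y1 + x2 * Y2) * (X1 * y1 + X2 * y2)"
    by (simp add: algebra_simps)
  then show "(x1 * y2 - x2 * y1) * (X1 * Y2 - X2 * Y1) = E * E"
    unfolding assms(2,3) assms(4)[symmetric] assms(5)[symmetric] by simp
qed

text \<open>A conformal Lagrangian frame is orthogonal for the Hermitian inner product: the metric is its real
  part and the symplectic form is, up to sign, its imaginary part.\<close>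

lemma hermitian_frame:
  fixes x y :: "complex \<times> complex"
  assumes "x \<bullet> x = y \<bullet> y" "x \<bullet> y = 0" "symp x y = 0"
  shows "fst x * cnj (fst y) + snd x * cnj (snd y) = 0"
    and "of_real (x \<bullet> x) = fst x * cnj (fst x) + snd x * cnj (snd x)"
    and "of_real (x \<bullet> x) = fst y * cnj (fst y) + snd y * cnj (snd y)"
proof -
  show "fst x * cnj (fst y) + snd x * cnj (snd y) = 0"
    using assms(2,3) by (auto simp: complex_eq_iff symp_def inner_prod_def inner_complex_def algebra_simps)
  have gen: "of_real (w \<bullet> w) = fst w * cnj (fst w) + snd w * cnj (snd w)" for w :: "complex \<times> complex"
    by (auto simp: complex_eq_iff inner_prod_def inner_complex_def)
  show "of_real (x \<bullet> x) = fst x * cnj (fst x) + snd x * cnj (snd x)" by (rule gen)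
  show "of_real (x \<bullet> x) = fst y * cnj (fst y) + snd y * cnj (snd y)"
    unfolding assms(1) by (rule gen)
qed

text \<open>With \<open>a = (x - i y) / 2\<close> and \<open>b = (x + i y) / 2\<close>, which become the two Wirtinger derivatives of an
  immersion, the conditions say that \<open>b\<close> is Hermitian orthogonal to \<open>a\<close> and of the same length. In
  dimension two this determines \<open>b\<close> up to a unit number \<open>N\<close>: \<open>b = N (-i cnj a\<^sub>2, i cnj a\<^sub>1)\<close>. Comparing
  with the complex determinant of the frame identifies \<open>N\<close>.\<close>

lemma lagrangian_frame:
  fixes x y :: "complex \<times> complex"
  assumes fr: "x \<bullet> x = y \<bullet> y" "x \<bullet> y = 0" "symp x y = 0" and nz: "x \<noteq> 0"
  defines "N \<equiv> (fst x * snd y - snd x * fst y) / of_real (x \<bullet> x)"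
  shows "fst x + \<i> * fst y = - \<i> * N * cnj (snd x - \<i> * snd y)"
    and "snd x + \<i> * snd y = \<i> * N * cnj (fst x - \<i> * fst y)"
    and "norm N = 1"
proof -
  let ?E = "complex_of_real (x \<bullet> x)"
  have E: "?E \<noteq> 0" using nz by simp
  have h: "cnj (fst x) * fst y + cnj (snd x) * snd y = 0"
    using arg_cong[OF hermitian_frame(1)[OF fr], of cnj] by simp
  note alg = lagrangian_frame_algebra[OF _ hermitian_frame(1)[OF fr] h hermitian_frame(2,3)[OF fr], of \<i>]
  have NE: "N * ?E = fst x * snd y - snd x * fst y" using E by (simp add: N_def)
  have c: "cnj (snd x - \<i> * snd y) = cnj (snd x) + \<i> * cnj (snd y)"
    "cnj (fst x - \<i> * fst y) = cnj (fst x) + \<i> * cnj (fst y)" by simp_all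
  have "?E * (fst x + \<i> * fst y) = - \<i> * (N * ?E) * cnj (snd x - \<i> * snd y)"
    unfolding NE c by (rule alg(1)) simp
  then have "?E * (fst x + \<i> * fst y) = ?E * (- \<i> * N * cnj (snd x - \<i> * snd y))"
    by (simp only: mult_ac)
  then show "fst x + \<i> * fst y = - \<i> * N * cnj (snd x - \<i> * snd y)"
    using E by (simp only: mult_cancel_left) simp
  have "?E * (snd x + \<i> * snd y) = \<i> * (N * ?E) * cnj (fst x - \<i> * fst y)"
    unfolding NE c by (rule alg(2)) simp
  then have "?E * (snd x + \<i> * snd y) = ?E * (\<i> * N * cnj (fst x - \<i> * fst y))"
    by (simp only: mult_ac)
  then show "snd x + \<i> * snd y = \<i> * N * cnj (fst x - \<i> * fst y)"
    using E by (simp only: mult_cancel_left) simp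
  have "N * cnj N = 1"
    using alg(3) E by (simp add: N_def power2_eq_square)
  then have "of_real ((norm N)\<^sup>2) = (1::complex)" by (simp only: complex_norm_square)
  then have "(norm N)\<^sup>2 = 1" by (metis of_real_eq_1_iff)
  then have "norm N = 1 \<or> norm N = - 1" by (simp only: power2_eq_1_iff)
  then show "norm N = 1" using norm_ge_zero[of N] by linarith
qed

text \<open>The coordinate expression of a conformal minimal Lagrangian immersion.\<close>

locale cml_patch =
  fixes S :: "complex set" and h :: "complex \<Rightarrow> complex \<times> complex"
  assumes open_S: "open S" and C2: "Ck_on 2 S h"
    and conf: "\<And>z. z \<in> S \<Longrightarrow> Dx h z \<bullet> Dx h z = Dy h z \<bullet> Dy h z \<and> Dx h z \<bullet> Dy h z = 0"
    and lag: "\<And>z. z \<in> S \<Longrightarrow> symp (Dx h z) (Dy h z) = 0"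
    and imm: "\<And>z. z \<in> S \<Longrightarrow> Dx h z \<noteq> 0"
    and mc: "\<And>z. z \<in> S \<Longrightarrow> mean_curvature h z = 0"
begin

lemma d0: "z \<in> S \<Longrightarrow> h differentiable (at z)"
  and dx: "z \<in> S \<Longrightarrow> Dx h differentiable (at z)"
  and dy: "z \<in> S \<Longrightarrow> Dy h differentiable (at z)"
  and cxy: "continuous_on S (Dy (Dx h))" and cyx: "continuous_on S (Dx (Dy h))"
  using C2 by (simp_all add: numeral_2_eq_2)

lemma sym: "z \<in> S \<Longrightarrow> Dy (Dx h) z = Dx (Dy h) z"
  by (rule mixed_partials_commute[OF open_S _ d0 dx dy cxy cyx])

lemma harmonic: "z \<in> S \<Longrightarrow> Dy (Dy h) z = - Dx (Dx h) z"
  using conformal_minimal_harmonic[OF open_S _ dx dy sym conf imm mc]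
  by (simp add: eq_neg_iff_add_eq_0 add.commute)

lemma frames:
  assumes "z \<in> S"
  shows "fst (Dx h z) + \<i> * fst (Dy h z) = - \<i> * angle h z * cnj (snd (Dx h z) - \<i> * snd (Dy h z))"
    and "snd (Dx h z) + \<i> * snd (Dy h z) = \<i> * angle h z * cnj (fst (Dx h z) - \<i> * fst (Dy h z))"
    and "norm (angle h z) = 1"
  using lagrangian_frame[OF _ _ lag[OF assms] imm[OF assms]] conf[OF assms] by (simp_all add: angle_def)

text \<open>Harmonicity and the symmetry of the second derivatives are the Cauchy-Riemann equations for
  \<open>Dx h - i Dy h\<close> and for the conjugate of \<open>Dx h + i Dy h\<close>. The condition on \<open>L\<close> singles out the
  combinations of this kind.\<close>

lemma linear_combination_deriv:
  assumes z: "z \<in> S" and L: "bounded_linear L"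
    and anti: "\<And>w. L (w, 0) = \<i> * L (0, w)" 
  shows "(\<lambda>z. (L (Dx h z, Dy h z) :: complex)) field_differentiable (at z)"
proof -
  let ?X = "frechet_derivative (Dx h) (at z)" and ?Y = "frechet_derivative (Dy h) (at z)"
  have dX: "(Dx h has_derivative ?X) (at z)" and dY: "(Dy h has_derivative ?Y) (at z)"
    using dx[OF z] dy[OF z] by (simp_all add: frechet_derivative_works)
  have X: "?X 1 = Dx (Dx h) z" "?X \<i> = Dx (Dy h) z" "?Y 1 = Dx (Dy h) z" "?Y \<i> = - Dx (Dx h) z"
    using sym[OF z] harmonic[OF z]
    by (simp_all add: Dx_def[of "Dx h"] Dy_def[of "Dx h"] Dx_def[of "Dy h"] Dy_def[of "Dy h"])
  have lin: "linear L" using L by (rule bounded_linear.linear)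
  have split: "L (u, v) = \<i> * L (0, u) + L (0, v)" for u v
    using linear_add[OF lin, of "(u, 0)" "(0, v)"] anti by simp
  have neg: "L (0, - v) = - L (0, v)" for v
    using linear_neg[OF lin, of "(0, v)"] by simp
  have "((\<lambda>z. L (Dx h z, Dy h z)) has_derivative (\<lambda>v. L (?X v, ?Y v))) (at z)"
    by (rule bounded_linear.has_derivative[OF L has_derivative_Pair[OF dX dY]])
  then have "((\<lambda>z. L (Dx h z, Dy h z)) has_field_derivative L (?X 1, ?Y 1)) (at z)"
  proof (rule Cauchy_Riemann_imp_field_derivative)
    show "L (?X \<i>, ?Y \<i>) = \<i> * L (?X 1, ?Y 1)"
      unfolding X split[of "Dx (Dy h) z"] split[of "Dx (Dx h) z"] neg by (simp add: algebra_simps)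
  qed
  then show ?thesis unfolding field_differentiable_def by blast
qed

text \<open>One Wirtinger derivative of \<open>h\<close> is holomorphic and the other one is antiholomorphic. By the frame
  equations the conjugate of the angle is a quotient of a component of the conjugate of the latter by
  a component of the former. It has modulus one, so it is constant by the maximum
  principle.\<close>

lemma angle_locally_constant:
  assumes z0: "z0 \<in> S"
  obtains e where "e > 0" "ball z0 e \<subseteq> S" "\<And>z. z \<in> ball z0 e \<Longrightarrow> angle h z = angle h z0"
proof -
  \<comment> \<open>up to factors, a consists of the components of the holomorphic Wirtinger derivative and b of the
    conjugated components of the other one, numbered so that b = cnj (angle) a\<close>
  define a where "a = (\<lambda>(j::nat) z. if j = 0 then fst (Dx h z) - \<i> * fst (Dy h z) else snd (Dx h z) - \<i> * snd (Dy h z))"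
  define b where "b = (\<lambda>(j::nat) z. if j = 0 then \<i> * cnj (snd (Dx h z) + \<i> * snd (Dy h z))
     else - \<i> * cnj (fst (Dx h z) + \<i> * fst (Dy h z)))"
  have ab: "b j z = cnj (angle h z) * a j z" if "z \<in> S" for j z
    unfolding a_def b_def by (simp add: frames(1,2)[OF that] algebra_simps)
  have holL: "(\<lambda>z. L (Dx h z, Dy h z)) holomorphic_on S"
    if "bounded_linear L" "\<And>w. L (w, 0) = \<i> * L (0, w)" for L :: "_ \<Rightarrow> complex"
    unfolding holomorphic_on_def
    using linear_combination_deriv[OF _ that] field_differentiable_at_within by blast
  have a: "a j holomorphic_on S" for j
  proof (cases "j = 0")
    case True
    have "(\<lambda>z. (\<lambda>w. fst (fst w) - \<i> * fst (snd w)) (Dx h z, Dy h z)) holomorphic_on S"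
      by (rule holL) (auto intro!: bounded_linear_intros)
    then show ?thesis using True by (simp add: a_def)
  next
    case False
    have "(\<lambda>z. (\<lambda>w. snd (fst w) - \<i> * snd (snd w)) (Dx h z, Dy h z)) holomorphic_on S"
      by (rule holL) (auto intro!: bounded_linear_intros)
    then show ?thesis using False by (simp add: a_def)
  qed
  have b: "b j holomorphic_on S" for j
  proof (cases "j = 0")
    case True
    have "(\<lambda>z. (\<lambda>w. \<i> * cnj (snd (fst w) + \<i> * snd (snd w))) (Dx h z, Dy h z)) holomorphic_on S"
      by (rule holL) (auto intro!: bounded_linear_intros bounded_linear_compose[OF bounded_linear_cnj])
    then show ?thesis using True by (simp add: b_def)
  next
    case False
    have "(\<lambda>z. (\<lambda>w. - \<i> * cnj (fst (fst w) + \<i> * fst (snd w))) (Dx h z, Dy h z)) holomorphic_on S"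
      by (rule holL) (auto simp: linear_conv_bounded_linear[symmetric] scaleR_conv_of_real algebra_simps intro!: linearI)
    then show ?thesis using False by (simp add: b_def)
  qed
  have "\<exists>j. a j z0 \<noteq> 0"
  proof (rule ccontr)
    assume "\<not> ?thesis"
    then have "a 0 z0 = 0" "a 1 z0 = 0" by auto
    then have "fst (Dx h z0) = \<i> * fst (Dy h z0)" "snd (Dx h z0) = \<i> * snd (Dy h z0)"
      by (auto simp: a_def)
    moreover from this have "fst (Dx h z0) = - \<i> * fst (Dy h z0)" "snd (Dx h z0) = - \<i> * snd (Dy h z0)"
      using frames(1,2)[OF z0] by (auto simp: eq_neg_iff_add_eq_0)
    ultimately have "fst (Dx h z0) = 0" "snd (Dx h z0) = 0" by auto
    then show False using imm[OF z0] by (simp add: prod_eq_iff)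
  qed
  then obtain j where j: "a j z0 \<noteq> 0" by blast
  have "isCont (a j) z0"
    using a open_S z0 by (meson continuous_on_eq_continuous_at holomorphic_on_imp_continuous_on)
  from continuous_at_avoid[OF this j]
  obtain e1 where e1: "e1 > 0" "\<And>z. dist z0 z < e1 \<Longrightarrow> a j z \<noteq> 0" by blast
  obtain e2 where e2: "e2 > 0" "ball z0 e2 \<subseteq> S" using open_S z0 open_contains_ball by blast
  define e where "e = min e1 e2"
  have e: "e > 0" "ball z0 e \<subseteq> S" "\<And>z. z \<in> ball z0 e \<Longrightarrow> a j z \<noteq> 0"
    using e1 e2 by (auto simp: e_def)
  have q: "b j z / a j z = cnj (angle h z)" if "z \<in> ball z0 e" for z
    using ab[of z j] e(2,3) that by (simp add: subsetD)
  have "(\<lambda>z. b j z / a j z) holomorphic_on ball z0 e"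
    by (intro holomorphic_intros holomorphic_on_subset[OF a] holomorphic_on_subset[OF b] e)
  then have const: "b j z / a j z = b j z0 / a j z0" if "z \<in> ball z0 e" for z
    by (rule holomorphic_norm_one_const[OF _ e(1) _ that])
      (use q frames(3) e(2) in auto)
  have "angle h z = angle h z0" if "z \<in> ball z0 e" for z
  proof -
    have "cnj (angle h z) = cnj (angle h z0)"
      using const[OF that] q[OF that] q[of z0] e(1) by simp
    then show ?thesis by (simp only: complex_cnj_cancel_iff)
  qed
  with e(1,2) show ?thesis by (rule that)
qed

end

text \<open>Under a change of coordinates, the determinant and the area density are multiplied by the same
  positive number.\<close>

lemma angle_change:
  assumes h: "h differentiable (at (\<tau> z))" and \<tau>: "(\<tau> has_field_derivative \<kappa>) (at z)" and l: "\<kappa> \<noteq> 0"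
    and conf: "Dx h (\<tau> z) \<bullet> Dx h (\<tau> z) = Dy h (\<tau> z) \<bullet> Dy h (\<tau> z)" "Dx h (\<tau> z) \<bullet> Dy h (\<tau> z) = 0"
  shows "angle (h \<circ> \<tau>) z = angle h (\<tau> z)"
proof -
  let ?D = "frechet_derivative h (at (\<tau> z))" and ?x = "Dx h (\<tau> z)" and ?y = "Dy h (\<tau> z)"
  have "(h has_derivative ?D) (at (\<tau> z))" using h frechet_derivative_works by blast
  moreover have "(\<tau> has_derivative (*) \<kappa>) (at z)" using \<tau> by (simp add: has_field_derivative_def)
  ultimately have d: "(h \<circ> \<tau> has_derivative (\<lambda>v. ?D (\<kappa> * v))) (at z)"
    using diff_chain_at[of \<tau> "(*) \<kappa>" z h ?D] by (simp add: o_def)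
  have x: "Dx (h \<circ> \<tau>) z = Re \<kappa> *\<^sub>R ?x + Im \<kappa> *\<^sub>R ?y"
    using Dx_eq[OF d] frechet_derivative_Dx_Dy[OF h, of \<kappa>] by simp
  have y: "Dy (h \<circ> \<tau>) z = (- Im \<kappa>) *\<^sub>R ?x + Re \<kappa> *\<^sub>R ?y"
    using Dy_eq[OF d] frechet_derivative_Dx_Dy[OF h, of "\<kappa> * \<i>"] by simp
  let ?k = "(Re \<kappa>)\<^sup>2 + (Im \<kappa>)\<^sup>2"
  have k: "?k \<noteq> 0" using l by (simp add: complex_eq_iff sum_power2_eq_zero_iff)
  have E: "Dx (h \<circ> \<tau>) z \<bullet> Dx (h \<circ> \<tau>) z = ?k * (?x \<bullet> ?x)"
    unfolding x using conf
    by (simp add: inner_add_left inner_add_right inner_commute power2_eq_square algebra_simps)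
  have det: "fst (Dx (h \<circ> \<tau>) z) * snd (Dy (h \<circ> \<tau>) z) - snd (Dx (h \<circ> \<tau>) z) * fst (Dy (h \<circ> \<tau>) z)
      = of_real ?k * (fst ?x * snd ?y - snd ?x * fst ?y)"
    unfolding x y by (simp add: scaleR_conv_of_real power2_eq_square algebra_simps)
  have k': "complex_of_real ?k \<noteq> 0" using k by (simp only: of_real_eq_0_iff) simp
  show ?thesis unfolding angle_def E det of_real_mult by (rule mult_divide_mult_cancel_left[OF k'])
qed

section \<open>The representation formula and the Gauss map\<close>

context surface
begin

lemma in_chart_transition:
  assumes c: "c \<in> A" and d: "d \<in> A" and p: "p \<in> fst c" "p \<in> fst d"
  shows "eventually (\<lambda>z. in_chart d u z = (in_chart c u \<circ> in_chart d (snd c)) z) (nhds (snd d p))"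
  using chart_inv_eventually[OF d p(2) chart_openin[OF c] p(1)]
  by eventually_elim (use c in \<open>simp add: in_chart_def\<close>)

lemma cml_patch_chart:
  assumes f: "conformal_minimal_lagrangian_immersion A f" and c: "c \<in> A"
  shows "cml_patch (snd c ` fst c) (in_chart c f)"
proof
  show "open (snd c ` fst c)" by (rule chart_open[OF c])
  show "Ck_on 2 (snd c ` fst c) (in_chart c f)"
    using f c by (auto simp: conformal_minimal_lagrangian_immersion_def immersion_def smooth_map_def)
  fix z assume "z \<in> snd c ` fst c"
  then obtain p where p: "p \<in> fst c" "z = snd c p" by blast
  show "Dx (in_chart c f) z \<bullet> Dx (in_chart c f) z = Dy (in_chart c f) z \<bullet> Dy (in_chart c f) z
      \<and> Dx (in_chart c f) z \<bullet> Dy (in_chart c f) z = 0"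
    using f c p unfolding conformal_minimal_lagrangian_immersion_def conformal_def in_all_charts_def by blast
  show "symp (Dx (in_chart c f) z) (Dy (in_chart c f) z) = 0"
    using f c p unfolding conformal_minimal_lagrangian_immersion_def lagrangian_def in_all_charts_def by blast
  show "mean_curvature (in_chart c f) z = 0"
    using f c p unfolding conformal_minimal_lagrangian_immersion_def minimal_def in_all_charts_def by blast
  have inj: "inj (frechet_derivative (in_chart c f) (at z))"
    using f c p unfolding conformal_minimal_lagrangian_immersion_def immersion_def in_all_charts_def by blast
  have "\<forall>c \<in> A. \<forall>k. Ck_on k (snd c ` fst c) (in_chart c f)"
    using f unfolding conformal_minimal_lagrangian_immersion_def immersion_def smooth_map_def by blast
  then have "Ck_on (Suc 0) (snd c ` fst c) (in_chart c f)" using c by blast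
  then have "\<forall>z\<in>snd c ` fst c. in_chart c f differentiable (at z)"
    unfolding Ck_on.simps by (rule conjunct1)
  then have "in_chart c f differentiable (at z)" using p by blast
  then have "linear (frechet_derivative (in_chart c f) (at z))"
    using linear_frechet_derivative by blast
  then have "frechet_derivative (in_chart c f) (at z) 0 = 0" by (rule linear_0)
  then show "Dx (in_chart c f) z \<noteq> 0"
    using injD[OF inj, of 1 0] unfolding Dx_def by auto
qed

lemma angle_chart_independent:
  assumes f: "conformal_minimal_lagrangian_immersion A f"
    and c: "c \<in> A" and d: "d \<in> A" and p: "p \<in> fst c" "p \<in> fst d"
  shows "angle (in_chart d f) (snd d p) = angle (in_chart c f) (snd c p)"
proof -
  interpret cml_patch "snd c ` fst c" "in_chart c f" by (rule cml_patch_chart[OF f c])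
  let ?h = "in_chart c f \<circ> in_chart d (snd c)"
  have z: "in_chart d (snd c) (snd d p) = snd c p" using d p by simp
  have im: "snd c p \<in> snd c ` fst c" using p by blast
  have 1: "angle ?h (snd d p) = angle (in_chart c f) (snd c p)"
    unfolding z[symmetric]
    by (rule angle_change[OF _ transition_deriv[OF d c p(2,1)] jacobian_nonzero[OF d c p(2,1)]])
      (use d0[OF im] conf[OF im] z in simp_all)
  have "frechet_derivative (in_chart d f) (at (snd d p)) = frechet_derivative ?h (at (snd d p))"
  proof -
    have ev: "eventually (\<lambda>z. in_chart d f z = ?h z) (at (snd d p))"
      using in_chart_transition[OF c d p, of f] by (rule eventually_nhds_conv_at[THEN iffD1, THEN conjunct1])
    have eq: "in_chart d f (snd d p) = ?h (snd d p)"
      using in_chart_transition[OF c d p, of f] by (rule eventually_nhds_x_imp_x)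
    have ev': "eventually (\<lambda>z. ?h z = in_chart d f z) (at (snd d p))"
      using ev by eventually_elim simp
    have "(in_chart d f has_derivative D) (at (snd d p)) \<longleftrightarrow> (?h has_derivative D) (at (snd d p))" for D
      using has_derivative_transform_eventually[OF _ ev eq] has_derivative_transform_eventually[OF _ ev' eq[symmetric]]
      by blast
    then show ?thesis unfolding frechet_derivative_def by simp
  qed
  then have "angle (in_chart d f) (snd d p) = angle ?h (snd d p)"
    by (simp add: angle_def Dx_def Dy_def)
  with 1 show ?thesis by simp
qed

lemma constant_angle:
  assumes f: "conformal_minimal_lagrangian_immersion A f"
    and conn: "connected_space X" and ne: "topspace X \<noteq> {}"
  obtains \<beta> where "\<And>c p. c \<in> A \<Longrightarrow> p \<in> fst c \<Longrightarrow> angle (in_chart c f) (snd c p) = cis \<beta>"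
proof -
  define u where "u = (\<lambda>p. let c = (SOME c. c \<in> A \<and> p \<in> fst c) in angle (in_chart c f) (snd c p))"
  have u: "u p = angle (in_chart c f) (snd c p)" if c: "c \<in> A" "p \<in> fst c" for c p
  proof -
    have "(SOME c. c \<in> A \<and> p \<in> fst c) \<in> A \<and> p \<in> fst (SOME c. c \<in> A \<and> p \<in> fst c)"
      by (rule someI[of _ c]) (use c in simp)
    then show ?thesis unfolding u_def Let_def using c by (intro angle_chart_independent[OF f]) auto
  qed
  have d: "(in_chart c u has_field_derivative 0) (at z)" if c: "c \<in> A" and z: "z \<in> snd c ` fst c" for c z
  proof -
    interpret cml_patch "snd c ` fst c" "in_chart c f" by (rule cml_patch_chart[OF f c])
    obtain e where e: "e > 0" "ball z e \<subseteq> snd c ` fst c"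
      "\<And>z'. z' \<in> ball z e \<Longrightarrow> angle (in_chart c f) z' = angle (in_chart c f) z"
      by (rule angle_locally_constant[OF z], rule that)
    show ?thesis
    proof (rule has_field_derivative_transform_within_open[OF _ open_ball])
      show "((\<lambda>_. angle (in_chart c f) z) has_field_derivative 0) (at z)" by simp
      show "z \<in> ball z e" using e by simp
      fix z' assume z': "z' \<in> ball z e"
      then obtain q where q: "q \<in> fst c" "z' = snd c q" using e(2) by blast
      show "angle (in_chart c f) z = in_chart c u z'" using u[OF c q(1)] c q e(3)[OF z'] by simp
    qed
  qed
  have hu: "holo u"
    unfolding holo_def holomorphic_on_def field_differentiable_def
    using d has_field_derivative_at_within by blast
  have dvz: "dv c u p = 0" if "c \<in> A" "p \<in> fst c" for c p
    unfolding dv_def by (rule DERIV_imp_deriv[OF d]) (use that in auto)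
  have const: "u p = u q" if "p \<in> topspace X" "q \<in> topspace X" for p q
    by (rule holo_const_if_dv_zero[OF conn hu dvz that])
  obtain p0 where p0: "p0 \<in> topspace X" using ne by blast
  obtain c0 where c0: "c0 \<in> A" "p0 \<in> fst c0" using chart_at[OF p0] .
  interpret cml_patch "snd c0 ` fst c0" "in_chart c0 f" by (rule cml_patch_chart[OF f c0(1)])
  have "norm (u p0) = 1" using frames(3)[of "snd c0 p0"] u[OF c0] c0 by simp
  then have "u p0 = cis (Arg (u p0))"
    by (metis cis_Arg norm_eq_zero zero_neq_one sgn_div_norm scaleR_one inverse_1)
  moreover have "angle (in_chart c f) (snd c p) = u p0" if "c \<in> A" "p \<in> fst c" for c p
    using u[OF that] const[OF _ p0, of p] chart_subset[OF that(1)] that(2) by (simp add: subsetD)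
  ultimately show ?thesis using that by metis
qed

text \<open>The formula \<open>f = rep_formula \<beta> F\<close> can be solved for \<open>F\<close>. With \<open>k = \<surd>2 e\<^bsup>-i\<beta>/2\<^esup>\<close>, the frame equations for
  the constant angle \<open>e\<^bsup>i\<beta>\<^esup>\<close> amount to the Cauchy-Riemann equations for the two components of \<open>F\<close>.\<close>

lemma representation_exists:
  assumes f: "conformal_minimal_lagrangian_immersion A f"
    and conn: "connected_space X" and ne: "topspace X \<noteq> {}"
  shows "\<exists>\<beta> F. has_lagrangian_angle A f \<beta> \<and> represents X A \<beta> F f"
proof -
  obtain \<beta> where \<beta>: "\<And>c p. c \<in> A \<Longrightarrow> p \<in> fst c \<Longrightarrow> angle (in_chart c f) (snd c p) = cis \<beta>"
    by (rule constant_angle[OF assms], rule that)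
  define k where "k = complex_of_real (sqrt 2) * cis (- (\<beta> / 2))"
  have k: "k * cis \<beta> = cnj k" by (simp add: k_def cis_mult cis_cnj)
  have kinv: "of_real (1 / sqrt 2) * cis (\<beta> / 2) * k = 1"
    by (simp add: k_def cis_mult flip: of_real_mult)
  have k0: "k \<noteq> 0" by (simp add: k_def)
  define F where "F = (\<lambda>p. ((k * fst (f p) + \<i> * cnj (k * snd (f p))) / 2,
      (k * snd (f p) - \<i> * cnj (k * fst (f p))) / 2))"
  have repF: "f p = rep_formula \<beta> (F p)" for p
  proof -
    let ?P = "k * fst (f p)" and ?R = "k * snd (f p)"
    have 1: "(?P + \<i> * cnj ?R) / 2 - \<i> * cnj ((?R - \<i> * cnj ?P) / 2) = ?P"
      by (simp add: field_simps)
    have 2: "(?R - \<i> * cnj ?P) / 2 + \<i> * cnj ((?P + \<i> * cnj ?R) / 2) = ?R"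
      by (simp add: field_simps)
    have "rep_formula \<beta> (F p) = (of_real (1 / sqrt 2) * cis (\<beta> / 2) * ?P, of_real (1 / sqrt 2) * cis (\<beta> / 2) * ?R)"
      unfolding rep_formula_def F_def prod.case 1 2 ..
    also have "\<dots> = (fst (f p), snd (f p))" using kinv by (simp only: mult.assoc[symmetric]) simp
    finally show ?thesis by simp
  qed
  have half: "\<i> * ((a + \<i> * b) / 2) = (\<i> * a - b) / 2" "\<i> * ((a - \<i> * b) / 2) = (\<i> * a + b) / 2"
    for a b :: complex
    by (simp_all add: field_simps)
  have der: "(in_chart c (\<lambda>q. fst (F q)) has_field_derivative
        (k * fst (Dx (in_chart c f) z) + \<i> * cnj (k * snd (Dx (in_chart c f) z))) / 2) (at z)"
     "(in_chart c (\<lambda>q. snd (F q)) has_field_derivative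
        (k * snd (Dx (in_chart c f) z) - \<i> * cnj (k * fst (Dx (in_chart c f) z))) / 2) (at z)"
    if c: "c \<in> A" and z: "z \<in> snd c ` fst c" for c z
  proof -
    interpret cml_patch "snd c ` fst c" "in_chart c f" by (rule cml_patch_chart[OF f c])
    let ?h = "in_chart c f"
    let ?D = "frechet_derivative ?h (at z)"
    have D: "(?h has_derivative ?D) (at z)" using d0[OF z] by (simp add: frechet_derivative_works)
    have Dxy: "?D 1 = Dx ?h z" "?D \<i> = Dy ?h z" by (simp_all add: Dx_def Dy_def)
    have N: "angle ?h z = cis \<beta>" using \<beta>[OF c] z by auto
    let ?P = "k * fst (Dx ?h z)" and ?Q = "k * fst (Dy ?h z)"
    let ?R = "k * snd (Dx ?h z)" and ?T = "k * snd (Dy ?h z)"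
    have "k * (fst (Dx ?h z) + \<i> * fst (Dy ?h z)) = - \<i> * (k * cis \<beta>) * cnj (snd (Dx ?h z) - \<i> * snd (Dy ?h z))"
      unfolding frames(1)[OF z] N by (simp only: mult_ac)
    then have e1: "?P + \<i> * ?Q = - \<i> * (cnj ?R + \<i> * cnj ?T)"
      unfolding k by (simp add: algebra_simps)
    have "k * (snd (Dx ?h z) + \<i> * snd (Dy ?h z)) = \<i> * (k * cis \<beta>) * cnj (fst (Dx ?h z) - \<i> * fst (Dy ?h z))"
      unfolding frames(2)[OF z] N by (simp only: mult_ac)
    then have e2: "?R + \<i> * ?T = \<i> * (cnj ?P + \<i> * cnj ?Q)"
      unfolding k by (simp add: algebra_simps)
    have c1: "(?Q + \<i> * cnj ?T) / 2 = \<i> * ((?P + \<i> * cnj ?R) / 2)"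
    proof -
      have "\<i> * (?P + \<i> * ?Q) = \<i> * (- \<i> * (cnj ?R + \<i> * cnj ?T))" using e1 by simp
      then have "\<i> * ?P - ?Q = cnj ?R + \<i> * cnj ?T" by (simp add: algebra_simps)
      then have "?Q + \<i> * cnj ?T = \<i> * ?P - cnj ?R" by (simp add: algebra_simps)
      then show ?thesis by (simp only: half)
    qed
    have c2: "(?T - \<i> * cnj ?Q) / 2 = \<i> * ((?R - \<i> * cnj ?P) / 2)"
    proof -
      have "\<i> * (?R + \<i> * ?T) = \<i> * (\<i> * (cnj ?P + \<i> * cnj ?Q))" using e2 by simp
      then have "\<i> * ?R - ?T = - cnj ?P - \<i> * cnj ?Q" by (simp add: algebra_simps)
      then have "?T - \<i> * cnj ?Q = \<i> * ?R + cnj ?P" by (simp add: algebra_simps)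
      then show ?thesis by (simp only: half)
    qed
    have Df: "((\<lambda>z. k * fst (?h z)) has_derivative (\<lambda>v. k * fst (?D v))) (at z)"
      and Ds: "((\<lambda>z. k * snd (?h z)) has_derivative (\<lambda>v. k * snd (?D v))) (at z)"
      by (intro has_derivative_mult_right has_derivative_fst has_derivative_snd D)+
    have Cf: "((\<lambda>z. \<i> * cnj (k * fst (?h z))) has_derivative (\<lambda>v. \<i> * cnj (k * fst (?D v)))) (at z)"
      and Cs: "((\<lambda>z. \<i> * cnj (k * snd (?h z))) has_derivative (\<lambda>v. \<i> * cnj (k * snd (?D v)))) (at z)"
      by (intro has_derivative_mult_right bounded_linear.has_derivative[OF bounded_linear_cnj] Df Ds)+
    have A1: "((\<lambda>z. (k * fst (?h z) + \<i> * cnj (k * snd (?h z))) / 2) has_derivative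
        (\<lambda>v. (k * fst (?D v) + \<i> * cnj (k * snd (?D v))) / 2)) (at z)"
      by (intro bounded_linear.has_derivative[OF bounded_linear_divide] has_derivative_add Df Cs)
    have A2: "((\<lambda>z. (k * snd (?h z) - \<i> * cnj (k * fst (?h z))) / 2) has_derivative
        (\<lambda>v. (k * snd (?D v) - \<i> * cnj (k * fst (?D v))) / 2)) (at z)"
      by (intro bounded_linear.has_derivative[OF bounded_linear_divide] has_derivative_diff Ds Cf)
    have i1: "in_chart c (\<lambda>q. fst (F q)) = (\<lambda>z. (k * fst (?h z) + \<i> * cnj (k * snd (?h z))) / 2)"
      and i2: "in_chart c (\<lambda>q. snd (F q)) = (\<lambda>z. (k * snd (?h z) - \<i> * cnj (k * fst (?h z))) / 2)"
      by (auto simp: in_chart_def F_def)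
    show "(in_chart c (\<lambda>q. fst (F q)) has_field_derivative (?P + \<i> * cnj ?R) / 2) (at z)"
      unfolding i1 using Cauchy_Riemann_imp_field_derivative[OF A1] c1 unfolding Dxy by blast
    show "(in_chart c (\<lambda>q. snd (F q)) has_field_derivative (?R - \<i> * cnj ?P) / 2) (at z)"
      unfolding i2 using Cauchy_Riemann_imp_field_derivative[OF A2] c2 unfolding Dxy by blast
  qed
  have "holomorphic_map A F"
    unfolding holomorphic_map_def holomorphic_on_def field_differentiable_def
    using der has_field_derivative_at_within by blast
  moreover have "(cmod (S1 c F p))\<^sup>2 + (cmod (S2 c F p))\<^sup>2 \<noteq> 0" if c: "c \<in> A" and p: "p \<in> fst c" for c p
  proof
    interpret cml_patch "snd c ` fst c" "in_chart c f" by (rule cml_patch_chart[OF f c])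
    let ?z = "snd c p" and ?h = "in_chart c f"
    have z: "?z \<in> snd c ` fst c" using p by blast
    assume "(cmod (S1 c F p))\<^sup>2 + (cmod (S2 c F p))\<^sup>2 = 0"
    then have "S1 c F p = 0" "S2 c F p = 0" by (simp_all add: sum_power2_eq_zero_iff)
    then have "k * snd (Dx ?h ?z) - \<i> * cnj (k * fst (Dx ?h ?z)) = 0"
      and "k * fst (Dx ?h ?z) + \<i> * cnj (k * snd (Dx ?h ?z)) = 0"
      unfolding S1_def S2_def using DERIV_imp_deriv[OF der(1)[OF c z]] DERIV_imp_deriv[OF der(2)[OF c z]] by simp_all
    then have "k * fst (Dx ?h ?z) = 0 \<and> k * snd (Dx ?h ?z) = 0"
      by (auto simp: complex_eq_iff)
    then have "Dx ?h ?z = 0" using k0 by (simp add: prod_eq_iff)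
    then show False using imm[OF z] by simp
  qed
  ultimately have "represents X A \<beta> F f" unfolding represents_def using repF by blast
  moreover have "has_lagrangian_angle A f \<beta>"
    unfolding has_lagrangian_angle_def in_all_charts_def
  proof (intro ballI)
    fix c p assume c: "c \<in> A" and p: "p \<in> fst c"
    interpret cml_patch "snd c ` fst c" "in_chart c f" by (rule cml_patch_chart[OF f c])
    let ?z = "snd c p" and ?h = "in_chart c f"
    have z: "?z \<in> snd c ` fst c" using p by blast
    let ?E = "Dx ?h ?z \<bullet> Dx ?h ?z"
    have E: "?E \<noteq> 0" using imm[OF z] by simp
    have "gram ?h ?z = ?E * ?E" using conf[OF z] by (simp add: gram_def)
    then have "sqrt (gram ?h ?z) = ?E" by simp
    moreover have "cis \<beta> = angle ?h ?z" using \<beta>[OF c p] by simp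
    ultimately show "fst (Dx ?h ?z) * snd (Dy ?h ?z) - snd (Dx ?h ?z) * fst (Dy ?h ?z)
       = of_real (sqrt (gram ?h ?z)) * cis \<beta>"
      using E by (simp add: angle_def del: inner_eq_zero_iff)
  qed
  ultimately show ?thesis by blast
qed

end

text \<open>The induced metric is \<open>density\<^sup>2 |dz|\<^sup>2\<close>.\<close>

abbreviation density :: "('a \<Rightarrow> complex \<times> complex) \<Rightarrow> 'a chart \<Rightarrow> 'a \<Rightarrow> real" where
  "density F \<equiv> (\<lambda>c p. sqrt ((cmod (S1 c F p))\<^sup>2 + (cmod (S2 c F p))\<^sup>2))"

lemma linear_rep_formula: "linear (rep_formula \<beta>)"
  by (rule linearI) (auto simp: rep_formula_def split_beta scaleR_conv_of_real algebra_simps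
      add_divide_distrib diff_divide_distrib)

lemma norm_rep_formula: "norm (rep_formula \<beta> v) = norm v"
proof -
  obtain a b where v: "v = (a, b)" by fastforce
  have par: "(norm (a - \<i> * cnj b))\<^sup>2 + (norm (b + \<i> * cnj a))\<^sup>2 = 2 * ((norm a)\<^sup>2 + (norm b)\<^sup>2)"
    unfolding cmod_power2 by (simp add: power2_eq_square algebra_simps)
  have n: "norm (of_real (1 / sqrt 2) * cis (\<beta> / 2) * z) = norm z / sqrt 2" for z :: complex
    by (simp add: norm_mult norm_divide)
  have "(norm (rep_formula \<beta> v))\<^sup>2 = (norm (a - \<i> * cnj b) / sqrt 2)\<^sup>2 + (norm (b + \<i> * cnj a) / sqrt 2)\<^sup>2"
    unfolding v rep_formula_def prod.case norm_Pair n by simp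
  also have "\<dots> = ((norm (a - \<i> * cnj b))\<^sup>2 + (norm (b + \<i> * cnj a))\<^sup>2) / 2"
    by (simp add: power_divide add_divide_distrib)
  also have "\<dots> = (norm v)\<^sup>2" unfolding par by (simp add: v norm_Pair)
  finally show ?thesis by (simp add: power2_eq_iff_nonneg)
qed

context surface
begin

lemma dv_holomorphic:
  assumes u: "holo u" and c: "c \<in> A"
  shows "in_chart c (dv c u) holomorphic_on snd c ` fst c"
proof (rule holomorphic_transform)
  show "deriv (in_chart c u) holomorphic_on snd c ` fst c"
    using u c chart_open by (auto simp: holo_def intro!: holomorphic_deriv)
  show "deriv (in_chart c u) z = in_chart c (dv c u) z" if "z \<in> snd c ` fst c" for z
    using that c by (auto simp: dv_def)
qed

lemma
  assumes u: "holo u" and v: "holo v"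
  shows holo_combination: "holo (\<lambda>p. a * u p + b * v p)"
    and dv_combination: "\<lbrakk>c \<in> A; p \<in> fst c\<rbrakk> \<Longrightarrow>
      dv c (\<lambda>p. a * u p + b * v p) p = a * dv c u p + b * dv c v p"
proof -
  have eq: "in_chart c (\<lambda>p. a * u p + b * v p) = (\<lambda>z. a * in_chart c u z + b * in_chart c v z)" for c
    by (auto simp: in_chart_def)
  show "holo (\<lambda>p. a * u p + b * v p)"
    using u v unfolding holo_def eq by (auto intro!: holomorphic_intros)
  assume cp: "c \<in> A" "p \<in> fst c"
  show "dv c (\<lambda>p. a * u p + b * v p) p = a * dv c u p + b * dv c v p"
    unfolding dv_def[of c "\<lambda>p. a * u p + b * v p"] eq
    by (rule DERIV_imp_deriv, intro DERIV_add DERIV_cmult holo_deriv u v cp)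
qed

lemma represents_holo:
  assumes "represents X A \<beta> F f"
  shows "holo (\<lambda>q. fst (F q))" and "holo (\<lambda>q. snd (F q))"
  using assms by (auto simp: represents_def holomorphic_map_def holo_def)

lemma S_eq_dv:
  "S1 c F p = dv c (\<lambda>q. snd (F q)) p" "S2 c F p = - dv c (\<lambda>q. fst (F q)) p"
  by (simp_all add: S1_def S2_def dv_def)

text \<open>The linear map \<open>rep_formula \<beta>\<close> preserves norms, so \<open>f\<close> and \<open>F\<close> induce the same metric.\<close>

lemma represents_metric:
  assumes rep: "represents X A \<beta> F f"
  shows "metric_surface X A f (density F)"
proof
  let ?F1 = "\<lambda>q. fst (F q)" and ?F2 = "\<lambda>q. snd (F q)"
  note h1 = represents_holo(1)[OF rep] and h2 = represents_holo(2)[OF rep] and S12 = S_eq_dv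
  have repF: "f p = rep_formula \<beta> (F p)" if "p \<in> topspace X" for p
    using rep that by (simp add: represents_def)
  have bl: "bounded_linear (rep_formula \<beta>)" using linear_rep_formula linear_conv_bounded_linear by blast
  show "norm (vector_derivative (f \<circ> \<gamma>) (at t)) = density F c (\<gamma> t) * norm D"
    if c: "c \<in> A" and ev: "eventually (\<lambda>s. \<gamma> s \<in> fst c) (nhds t)"
      and D: "((snd c \<circ> \<gamma>) has_vector_derivative D) (at t)" for c \<gamma> t D
  proof -
    have p: "\<gamma> t \<in> fst c" by (rule eventually_nhds_x_imp_x[OF ev])
    have 1: "((?F1 \<circ> \<gamma>) has_vector_derivative dv c ?F1 (\<gamma> t) * D) (at t)"
      by (rule chain_real[OF c ev D holo_deriv[OF h1 c p]])
    have 2: "((?F2 \<circ> \<gamma>) has_vector_derivative dv c ?F2 (\<gamma> t) * D) (at t)"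
      by (rule chain_real[OF c ev D holo_deriv[OF h2 c p]])
    let ?w = "(dv c ?F1 (\<gamma> t) * D, dv c ?F2 (\<gamma> t) * D)"
    have "((\<lambda>s. rep_formula \<beta> ((?F1 \<circ> \<gamma>) s, (?F2 \<circ> \<gamma>) s)) has_vector_derivative rep_formula \<beta> ?w) (at t)"
      by (rule bounded_linear.has_vector_derivative[OF bl has_vector_derivative_Pair[OF 1 2]])
    moreover have "eventually (\<lambda>s. rep_formula \<beta> ((?F1 \<circ> \<gamma>) s, (?F2 \<circ> \<gamma>) s) = (f \<circ> \<gamma>) s) (nhds t)"
      using ev by eventually_elim (use chart_subset[OF c] repF in auto)
    ultimately have "((f \<circ> \<gamma>) has_vector_derivative rep_formula \<beta> ?w) (at t)"
      using repF[of "\<gamma> t"] p chart_subset[OF c]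
      by (subst has_vector_derivative_cong_ev[symmetric, where f = "\<lambda>s. rep_formula \<beta> ((?F1 \<circ> \<gamma>) s, (?F2 \<circ> \<gamma>) s)"])
        (auto elim: eventually_mono)
    then have "norm (vector_derivative (f \<circ> \<gamma>) (at t)) = norm ?w"
      by (simp add: vector_derivative_at norm_rep_formula)
    also have "\<dots> = sqrt (((cmod (dv c ?F2 (\<gamma> t)))\<^sup>2 + (cmod (dv c ?F1 (\<gamma> t)))\<^sup>2) * (norm D)\<^sup>2)"
      by (simp add: norm_Pair norm_mult power_mult_distrib algebra_simps)
    also have "\<dots> = density F c (\<gamma> t) * norm D"
      by (simp add: S12 real_sqrt_mult)
    finally show ?thesis .
  qed
  show "continuous_on (snd c ` fst c) (in_chart c (\<lambda>p. density F c p))"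
    if c: "c \<in> A" for c
  proof -
    have "in_chart c (\<lambda>p. density F c p)
        = (\<lambda>z. sqrt ((cmod (in_chart c (dv c ?F2) z))\<^sup>2 + (cmod (in_chart c (dv c ?F1) z))\<^sup>2))"
      by (auto simp: in_chart_def S12)
    then show ?thesis
      by (simp only:) (intro continuous_intros holomorphic_on_imp_continuous_on dv_holomorphic h1 h2 c)
  qed
  show "density F c p > 0" if "c \<in> A" "p \<in> fst c" for c p
  proof -
    have "(cmod (S1 c F p))\<^sup>2 + (cmod (S2 c F p))\<^sup>2 \<noteq> 0" using rep that by (auto simp: represents_def)
    moreover have "(cmod (S1 c F p))\<^sup>2 + (cmod (S2 c F p))\<^sup>2 \<ge> 0" by simp
    ultimately show ?thesis by (simp only: real_sqrt_gt_0_iff)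
  qed
qed

lemma gauss_map_first:
  assumes f: "conformal_minimal_lagrangian_immersion A f"
    and conn: "connected_space X" and ne: "topspace X \<noteq> {}"
  obtains \<beta> F where "represents X A \<beta> F f"
    "\<And>c p. c \<in> A \<Longrightarrow> p \<in> fst c \<Longrightarrow> fst (gauss_map X A f p) = sphere_quotient (- S2 c F p) (S1 c F p)"
proof -
  define \<beta>F where "\<beta>F = (SOME (\<beta>, F). has_lagrangian_angle A f \<beta> \<and> represents X A \<beta> F f)"
  have "case \<beta>F of (\<beta>, F) \<Rightarrow> has_lagrangian_angle A f \<beta> \<and> represents X A \<beta> F f"
    unfolding \<beta>F_def
  proof (rule someI_ex)
    obtain \<beta> F where "has_lagrangian_angle A f \<beta> \<and> represents X A \<beta> F f"
      using representation_exists[OF assms] by blast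
    then show "\<exists>x. case x of (\<beta>, F) \<Rightarrow> has_lagrangian_angle A f \<beta> \<and> represents X A \<beta> F f"
      by (intro exI[of _ "(\<beta>, F)"]) simp
  qed
  then obtain \<beta> F where bF: "\<beta>F = (\<beta>, F)" and rep: "represents X A \<beta> F f"
    by (cases \<beta>F) auto
  let ?F1 = "\<lambda>q. fst (F q)" and ?F2 = "\<lambda>q. snd (F q)"
  note h1 = represents_holo(1)[OF rep] and h2 = represents_holo(2)[OF rep] and S12 = S_eq_dv
  have indep: "sphere_quotient (- S2 d F p) (S1 d F p) = sphere_quotient (- S2 c F p) (S1 c F p)"
    if "c \<in> A" "d \<in> A" "p \<in> fst c" "p \<in> fst d" for c d p
    using dv_change[OF h1 that] dv_change[OF h2 that] jacobian_nonzero[OF that(2,1,4,3)]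
    by (simp add: S12 sphere_quotient_def)
  have "fst (gauss_map X A f p) = sphere_quotient (- S2 c F p) (S1 c F p)"
    if c: "c \<in> A" "p \<in> fst c" for c p
  proof -
    have "fst (gauss_map X A f p) = (THE w. \<forall>c \<in> A. p \<in> fst c \<longrightarrow> w = sphere_quotient (- S2 c F p) (S1 c F p))"
      unfolding gauss_map_def using bF by (simp add: \<beta>F_def)
    also have "\<dots> = sphere_quotient (- S2 c F p) (S1 c F p)"
    proof (rule the_equality)
      show "\<forall>d \<in> A. p \<in> fst d \<longrightarrow> sphere_quotient (- S2 c F p) (S1 c F p) = sphere_quotient (- S2 d F p) (S1 d F p)"
        using indep[OF _ c(1) _ c(2)] by blast
    qed (use c in blast)
    finally show ?thesis .
  qed
  with rep show ?thesis by (rule that)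
qed

text \<open>Both derivatives are multiplied by the same factor under a change of charts, so their quotient is
  a function.\<close>

lemma quotient_function:
  assumes P: "holo P" and T: "holo T" and nz: "\<And>c p. c \<in> A \<Longrightarrow> p \<in> fst c \<Longrightarrow> dv c P p \<noteq> 0"
  obtains G where "holo G" "\<And>c p. c \<in> A \<Longrightarrow> p \<in> fst c \<Longrightarrow> dv c T p = G p * dv c P p"
proof -
  define G where "G = (\<lambda>p. let c = (SOME c. c \<in> A \<and> p \<in> fst c) in dv c T p / dv c P p)"
  have G: "G p = dv c T p / dv c P p" if c: "c \<in> A" "p \<in> fst c" for c p
  proof -
    define d where "d = (SOME c. c \<in> A \<and> p \<in> fst c)"
    have d: "d \<in> A \<and> p \<in> fst d"
      unfolding d_def by (rule someI[of _ c]) (use c in simp)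
    have "G p = dv d T p / dv d P p" by (simp add: G_def d_def Let_def)
    also have "\<dots> = dv c T p / dv c P p"
      using dv_change[OF P c(1) _ c(2), of d] dv_change[OF T c(1) _ c(2), of d] d
        jacobian_nonzero[of d c p] c by simp
    finally show ?thesis .
  qed
  have "holo G"
    unfolding holo_def
  proof
    fix c assume c: "c \<in> A"
    show "in_chart c G holomorphic_on snd c ` fst c"
    proof (rule holomorphic_transform)
      show "(\<lambda>z. in_chart c (dv c T) z / in_chart c (dv c P) z) holomorphic_on snd c ` fst c"
        by (intro holomorphic_intros dv_holomorphic P T c) (use nz[OF c] c in auto)
      show "in_chart c (dv c T) z / in_chart c (dv c P) z = in_chart c G z" if "z \<in> snd c ` fst c" for z
        using that G[OF c] c by auto
    qed
  qed
  moreover have "dv c T p = G p * dv c P p" if "c \<in> A" "p \<in> fst c" for c p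
    using G[OF that] nz[OF that] by simp
  ultimately show ?thesis by (rule that)
qed

end

lemma (in vector_field) flow_function_deriv:
  assumes u: "holo u" and fl: "flow_on D \<Phi>" and D: "open D" "w \<in> D" and c: "c \<in> A" "\<Phi> w \<in> fst c"
  shows "((u \<circ> \<Phi>) has_field_derivative dv c u (\<Phi> w) * H c (\<Phi> w)) (at w)"
  by (rule chain_complex[OF c(1) flow_eventually[OF fl D chart_openin[OF c(1)] c(2)]
        flow_deriv[OF fl D(2) c] holo_deriv[OF u c]])

lemma (in vector_field) flow_function_holomorphic:
  assumes u: "holo u" and fl: "flow_on D \<Phi>" and D: "open D"
  shows "(u \<circ> \<Phi>) holomorphic_on D"
  unfolding holomorphic_on_def
proof
  fix w assume w: "w \<in> D"
  obtain c where c: "c \<in> A" "\<Phi> w \<in> fst c" using chart_at[OF flow_in_topspace[OF fl w]] .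
  show "(u \<circ> \<Phi>) field_differentiable (at w within D)"
    using flow_function_deriv[OF u fl D w c] field_differentiable_def field_differentiable_at_within by blast
qed

section \<open>The omitted values\<close>

text \<open>The factor \<open>t\<close> of a coordinate change enters with exponent \<open>5 - 6 = -1\<close>, as for a vector field.\<close>

lemma weight_identity:
  fixes g w q t :: "'a::field"
  assumes t: "t \<noteq> 0"
  shows "(g * t) ^ 5 / ((w * t) ^ 6 * q) = 1 / t * (g ^ 5 / (w ^ 6 * q))"
proof -
  have "(g * t) ^ 5 = t ^ 5 * g ^ 5" by (simp add: power_mult_distrib)
  moreover have "(w * t) ^ 6 * q = t ^ 5 * (t * (w ^ 6 * q))"
    by (simp add: power_mult_distrib eval_nat_numeral mult_ac)
  ultimately have "(g * t) ^ 5 / ((w * t) ^ 6 * q) = (t ^ 5 * g ^ 5) / (t ^ 5 * (t * (w ^ 6 * q)))"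
    by (simp only:)
  also have "\<dots> = g ^ 5 / (t * (w ^ 6 * q))"
    using t by (intro mult_divide_mult_cancel_left) simp
  finally show ?thesis by simp
qed

lemma root_six_bound:
  fixes x r M :: real
  assumes x: "x \<ge> 0" and r: "r > 0" and M: "M \<ge> 0" and le: "x ^ 6 * r ^ 5 \<le> M"
  shows "x \<le> root 6 M * r powr (1/6 - 1)"
proof (rule power_le_imp_le_base[of _ 5, simplified])
  have "(r powr (1/6 - 1)) ^ 6 = r powr (6 * (1/6 - 1))"
    using r by (simp add: powr_realpow[symmetric] powr_powr)
  also have "\<dots> = r powr (- 5)" by simp
  also have "\<dots> = 1 / r ^ 5" using r by (simp add: powr_minus_divide powr_numeral)
  finally have "(root 6 M * r powr (1/6 - 1)) ^ 6 = M / r ^ 5"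
    using M by (simp add: power_mult_distrib)
  moreover have "x ^ 6 \<le> M / r ^ 5" using le r by (simp add: field_simps)
  ultimately show "x ^ 6 \<le> (root 6 M * r powr (1/6 - 1)) ^ 6" by simp
  show "0 \<le> root 6 M * r powr (1/6 - 1)" using M r by simp
qed

context metric_surface
begin

text \<open>This is the core of Fujimoto's argument. The field \<open>H = G'\<^sup>5 / (P'\<^sup>6 (\<Prod>\<^sub>i (G - b\<^sub>i))\<^sup>4)\<close> is the dual
  of his flat metric. Along a flow disc \<open>\<Phi>\<close> of radius \<open>r\<close>, the derivative of \<open>k = G \<circ> \<Phi>\<close> is \<open>G' H\<close>, and
  the speed \<open>\<mu> \<bar>H\<bar>\<close> of the flow in the induced metric satisfies
  \<open>(\<mu> \<bar>H\<bar>)\<^sup>6 \<le> C (1 + \<bar>k\<bar>)\<^sup>6 \<bar>k'\<bar>\<^sup>5 / (\<Prod>\<^sub>i \<bar>k - b\<^sub>i\<bar>)\<^sup>4\<close>. The estimate for functions omitting three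
  finite values bounds the right-hand side by a multiple of \<open>r\<^bsup>-5\<^esup>\<close>, that is, the speed is at most of
  order \<open>r\<^bsup>-5/6\<^esup>\<close>. This is integrable in \<open>r\<close> at \<open>0\<close>, so completeness gives flow discs of all
  radii around a point with \<open>G' \<noteq> 0\<close>, and the positive speed at their common centre contradicts the
  bound for large \<open>r\<close>.\<close>

lemma omitting_three_values_constant:
  assumes conn: "connected_space X" and complete: "complete_induced_metric X A f"
    and P: "holo P" and G: "holo G"
    and nz: "\<And>c p. c \<in> A \<Longrightarrow> p \<in> fst c \<Longrightarrow> dv c P p \<noteq> 0"
    and mu: "\<And>c p. c \<in> A \<Longrightarrow> p \<in> fst c \<Longrightarrow> \<mu> c p \<le> C1 * (1 + norm (G p)) * norm (dv c P p)"
    and b: "b1 \<noteq> b2" "b1 \<noteq> b3" "b2 \<noteq> b3"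
    and om: "\<And>p. p \<in> topspace X \<Longrightarrow> G p \<noteq> b1 \<and> G p \<noteq> b2 \<and> G p \<noteq> b3"
    and c0: "c0 \<in> A" "q0 \<in> fst c0"
  shows "dv c0 G q0 = 0"
proof (rule ccontr)
  assume G0: "dv c0 G q0 \<noteq> 0"
  define Q where "Q = (\<lambda>p. (G p - b1) * (G p - b2) * (G p - b3))"
  have Qnz: "Q p \<noteq> 0" if "p \<in> topspace X" for p using om[OF that] by (simp add: Q_def)
  define H where "H = (\<lambda>c p. dv c G p ^ 5 / (dv c P p ^ 6 * Q p ^ 4))"
  interpret metric_flow X A H f \<mu>
  proof
    fix c assume c: "c \<in> A"
    have hG: "in_chart c G holomorphic_on snd c ` fst c" using G c by (simp add: holo_def)
    have "(\<lambda>z. in_chart c (dv c G) z ^ 5 / (in_chart c (dv c P) z ^ 6 *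
        ((in_chart c G z - b1) * (in_chart c G z - b2) * (in_chart c G z - b3)) ^ 4))
        holomorphic_on snd c ` fst c"
    proof (intro holomorphic_intros dv_holomorphic P G c hG)
      fix z assume "z \<in> snd c ` fst c"
      then obtain p where p: "p \<in> fst c" "z = snd c p" by blast
      then show "in_chart c (dv c P) z ^ 6 *
          ((in_chart c G z - b1) * (in_chart c G z - b2) * (in_chart c G z - b3)) ^ 4 \<noteq> 0"
        using nz[OF c p(1)] om[of p] chart_subset[OF c] c by auto
    qed
    moreover have "in_chart c (H c) = (\<lambda>z. in_chart c (dv c G) z ^ 5 / (in_chart c (dv c P) z ^ 6 *
        ((in_chart c G z - b1) * (in_chart c G z - b2) * (in_chart c G z - b3)) ^ 4))"
      by (auto simp: in_chart_def H_def Q_def)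
    ultimately show "in_chart c (H c) holomorphic_on snd c ` fst c" by simp
  next
    fix c d p assume cd: "c \<in> A" "d \<in> A" "p \<in> fst c" "p \<in> fst d"
    have t: "jacobian d c p \<noteq> 0" "jacobian c d p = 1 / jacobian d c p"
      using jacobian_nonzero[OF cd(2,1,4,3)] jacobian_inverse[OF cd] by (simp_all add: field_simps)
    show "H d p = jacobian c d p * H c p"
      unfolding H_def dv_change[OF P cd] dv_change[OF G cd] t(2)
      by (rule weight_identity[OF t(1)])
  qed
  obtain C where C: "C > 0" and CC: "\<And>k r. 0 < r \<Longrightarrow> k holomorphic_on ball 0 r \<Longrightarrow>
     (\<forall>z\<in>ball 0 r. k z \<noteq> b1 \<and> k z \<noteq> b2 \<and> k z \<noteq> b3) \<Longrightarrow>
     (r * norm (deriv k 0)) ^ 5 * (1 + norm (k 0)) ^ 6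
       \<le> C * (norm (k 0 - b1) * norm (k 0 - b2) * norm (k 0 - b3)) ^ 4"
    using deriv_bound_omitting_three[OF b] by blast
  define M where "M = C1 ^ 6 * C"
  have est6: "(\<mu> c (\<Phi> 0) * norm (H c (\<Phi> 0))) ^ 6 * r ^ 5 \<le> M"
    if r: "r > 0" and fl: "flow_on (ball 0 r) \<Phi>" and c: "c \<in> A" "\<Phi> 0 \<in> fst c" for c r \<Phi>
  proof -
    let ?q = "\<Phi> 0"
    have z0: "0 \<in> ball (0::complex) r" using r by simp
    have qX: "?q \<in> topspace X" by (rule flow_in_topspace[OF fl z0])
    define g where "g = norm (dv c G ?q)"
    define w where "w = norm (dv c P ?q)"
    define k where "k = norm (Q ?q)"
    define a where "a = 1 + norm (G ?q)"
    have pos: "w > 0" "k > 0" "g \<ge> 0" "a \<ge> 0" using nz[OF c] Qnz[OF qX] by (auto simp: w_def k_def g_def a_def)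
    have nH: "norm (H c ?q) = g ^ 5 / (w ^ 6 * k ^ 4)"
      by (simp add: H_def norm_divide norm_mult norm_power g_def w_def k_def)
    have d: "deriv (G \<circ> \<Phi>) 0 = dv c G ?q * H c ?q"
      by (rule DERIV_imp_deriv[OF flow_function_deriv[OF G fl open_ball z0 c]])
    have "(r * norm (deriv (G \<circ> \<Phi>) 0)) ^ 5 * (1 + norm ((G \<circ> \<Phi>) 0)) ^ 6
       \<le> C * (norm ((G \<circ> \<Phi>) 0 - b1) * norm ((G \<circ> \<Phi>) 0 - b2) * norm ((G \<circ> \<Phi>) 0 - b3)) ^ 4"
      by (rule CC[OF r flow_function_holomorphic[OF G fl open_ball]])
        (use om flow_in_topspace[OF fl] in auto)
    then have main: "(r * (g * norm (H c ?q))) ^ 5 * a ^ 6 \<le> C * k ^ 4"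
      unfolding d by (simp add: norm_mult g_def a_def k_def Q_def)
    have "\<mu> c ?q * norm (H c ?q) \<le> C1 * a * w * norm (H c ?q)"
      by (rule mult_right_mono) (use mu[OF c] in \<open>auto simp: a_def w_def\<close>)
    then have "(\<mu> c ?q * norm (H c ?q)) ^ 6 \<le> (C1 * a * w * norm (H c ?q)) ^ 6"
      using mu_pos[OF c] by (intro power_mono) auto
    then have "(\<mu> c ?q * norm (H c ?q)) ^ 6 * r ^ 5 \<le> (C1 * a * w * norm (H c ?q)) ^ 6 * r ^ 5"
      using r by (intro mult_right_mono) auto
    also have "\<dots> = C1 ^ 6 * (((r * (g * norm (H c ?q))) ^ 5 * a ^ 6) / k ^ 4)"
    proof -
      have e: "w ^ 6 * norm (H c ?q) = g ^ 5 / k ^ 4" using pos unfolding nH by simp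
      have "(C1 * a * w * norm (H c ?q)) ^ 6 = C1 ^ 6 * a ^ 6 * (w ^ 6 * norm (H c ?q)) * norm (H c ?q) ^ 5"
        by (simp add: power_mult_distrib eval_nat_numeral mult_ac)
      then show ?thesis unfolding e by (simp add: power_mult_distrib)
    qed
    also have "\<dots> \<le> C1 ^ 6 * ((C * k ^ 4) / k ^ 4)"
      using main pos by (intro mult_left_mono divide_right_mono) auto
    also have "\<dots> = M" using pos by (simp add: M_def)
    finally show ?thesis .
  qed
  have M: "M \<ge> 0" using C by (simp add: M_def)
  have est: "\<mu> c (\<Phi> 0) * norm (H c (\<Phi> 0)) \<le> root 6 M * r powr (1/6 - 1)"
    if "r > 0" "flow_on (ball 0 r) \<Phi>" "c \<in> A" "\<Phi> 0 \<in> fst c" for c r \<Phi>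
    by (rule root_six_bound[OF _ that(1) M est6[OF that]]) (use mu_pos[OF that(3,4)] in simp)
  have q0X: "q0 \<in> topspace X" using c0 chart_subset by blast
  have H0: "H c0 q0 \<noteq> 0" using G0 nz[OF c0] Qnz[OF q0X] by (simp add: H_def)
  define m where "m = \<mu> c0 q0 * norm (H c0 q0)"
  have m: "m > 0" using mu_pos[OF c0] H0 by (simp add: m_def)
  have "\<exists>r \<Phi>. max 1 (M / m ^ 6) < r \<and> flow_on (ball 0 r) \<Phi> \<and> \<Phi> 0 = q0"
  proof (rule flow_radius_unbounded[OF conn complete, where \<beta> = "1/6" and K = "root 6 M"])
    show "root 6 M \<ge> 0" using M by simp
  qed (fact est c0 H0 | simp)+
  then obtain r \<Phi> where r: "max 1 (M / m ^ 6) < r" and \<Phi>: "flow_on (ball 0 r) \<Phi>" "\<Phi> 0 = q0"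
    by blast
  \<comment> \<open>m is the speed at q0; a large flow disc around q0 forces it to be too small\<close>
  have "m ^ 6 * r ^ 5 \<le> M" using est6[OF _ \<Phi>(1) c0(1)] \<Phi>(2) c0(2) r by (simp add: m_def)
  moreover have "r \<le> r ^ 5" using r self_le_power[of r 5] by simp
  moreover have "M < m ^ 6 * r" using r m by (simp add: field_simps)
  ultimately show False using m by (smt (verit) mult_left_mono zero_le_power)
qed

text \<open>The flow of the field \<open>1/u'\<close> inverts \<open>u\<close>: along it \<open>u\<close> grows with derivative one. Its speed is the
  constant \<open>K\<close>, so by completeness it exists on discs of all radii.\<close>

lemma isometric_coordinate_surj:
  assumes conn: "connected_space X" and complete: "complete_induced_metric X A f"
    and ne: "topspace X \<noteq> {}" and u: "holo u" and K: "K > 0"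
    and mu: "\<And>c p. c \<in> A \<Longrightarrow> p \<in> fst c \<Longrightarrow> \<mu> c p = K * norm (dv c u p)"
  shows "u ` topspace X = UNIV"
proof -
  have nz: "dv c u p \<noteq> 0" if "c \<in> A" "p \<in> fst c" for c p
    using mu_pos[OF that] mu[OF that] by auto
  define H where "H = (\<lambda>c p. 1 / dv c u p)"
  interpret metric_flow X A H f \<mu>
  proof
    fix c assume c: "c \<in> A"
    have "(\<lambda>z. 1 / in_chart c (dv c u) z) holomorphic_on snd c ` fst c"
      by (intro holomorphic_intros dv_holomorphic u c) (use nz[OF c] c in auto)
    then show "in_chart c (H c) holomorphic_on snd c ` fst c" by (simp add: in_chart_def H_def o_def)
  next
    fix c d p assume cd: "c \<in> A" "d \<in> A" "p \<in> fst c" "p \<in> fst d"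
    show "H d p = jacobian c d p * H c p"
      unfolding H_def dv_change[OF u cd] using jacobian_inverse[OF cd] jacobian_nonzero[OF cd(2,1,4,3)]
      by (simp add: divide_simps)
  qed
  have est: "\<mu> c (\<Phi> 0) * norm (H c (\<Phi> 0)) \<le> K * r powr (1 - 1)"
    if "r > 0" "flow_on (ball 0 r) \<Phi>" "c \<in> A" "\<Phi> 0 \<in> fst c" for c r \<Phi>
    using mu[OF that(3,4)] nz[OF that(3,4)] that(1) by (simp add: H_def norm_divide)
  obtain p0 where p0: "p0 \<in> topspace X" using ne by blast
  obtain c0 where c0: "c0 \<in> A" "p0 \<in> fst c0" using chart_at[OF p0] .
  have H0: "H c0 p0 \<noteq> 0" using nz[OF c0] by (simp add: H_def)
  have surj: "\<exists>p\<in>topspace X. u p = \<zeta>" for \<zeta>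
  proof -
    have "\<exists>r \<Phi>. norm (\<zeta> - u p0) < r \<and> flow_on (ball 0 r) \<Phi> \<and> \<Phi> 0 = p0"
    proof (rule flow_radius_unbounded[OF conn complete, where \<beta> = 1 and K = K])
      show "K \<ge> 0" using K by simp
    qed (fact est c0 H0 | simp)+
    then obtain r \<Phi> where r: "norm (\<zeta> - u p0) < r" and \<Phi>: "flow_on (ball 0 r) \<Phi>" "\<Phi> 0 = p0"
      by blast
    have "\<exists>k. \<forall>w\<in>ball 0 r. (u \<circ> \<Phi>) w - w = k"
    proof (rule has_field_derivative_zero_constant[OF convex_ball])
      fix w :: complex assume w: "w \<in> ball 0 r"
      obtain c where c: "c \<in> A" "\<Phi> w \<in> fst c" using chart_at[OF flow_in_topspace[OF \<Phi>(1) w]] .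
      have "((\<lambda>w. (u \<circ> \<Phi>) w - w) has_field_derivative dv c u (\<Phi> w) * H c (\<Phi> w) - 1) (at w)"
        by (intro DERIV_diff flow_function_deriv[OF u \<Phi>(1) open_ball w c] DERIV_ident)
      then show "((\<lambda>w. (u \<circ> \<Phi>) w - w) has_field_derivative 0) (at w within ball 0 r)"
        using nz[OF c] by (simp add: H_def has_field_derivative_at_within)
    qed
    then obtain k where k: "\<And>w. w \<in> ball 0 r \<Longrightarrow> (u \<circ> \<Phi>) w - w = k" by blast
    have r0: "0 < r" using r by (meson le_less_trans norm_ge_zero)
    have "k = u p0" using k[of 0] r0 \<Phi>(2) by simp
    moreover have w: "\<zeta> - u p0 \<in> ball 0 r" using r by simp
    ultimately have "u (\<Phi> (\<zeta> - u p0)) = \<zeta>" using k[OF w] by simp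
    then show ?thesis using flow_in_topspace[OF \<Phi>(1) w] by blast
  qed
  have "\<zeta> \<in> u ` topspace X" for \<zeta> using surj[of \<zeta>] by blast
  then show ?thesis by blast
qed

end

text \<open>The Hermitian inner product of the two vectors is real: a complex line is mapped to a Lagrangian
  plane by the representation formula.\<close>

lemma symp_rep_formula:
  "symp (rep_formula \<beta> (\<mu> * a, \<mu> * b)) (rep_formula \<beta> (\<nu> * a, \<nu> * b)) = 0"
proof -
  define k where "k = complex_of_real (1 / sqrt 2) * cis (\<beta> / 2)"
  let ?u1 = "\<mu> * a - \<i> * cnj (\<mu> * b)" and ?u2 = "\<mu> * b + \<i> * cnj (\<mu> * a)"
  let ?v1 = "\<nu> * a - \<i> * cnj (\<nu> * b)" and ?v2 = "\<nu> * b + \<i> * cnj (\<nu> * a)"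
  have factor: "(x * y) * (x' * y') + (x * z) * (x' * z') = (x * x') * (y * y' + z * z')"
    for x x' y y' z z' :: complex
    by (simp add: algebra_simps)
  have sy: "symp u v = - Im (fst u * cnj (fst v) + snd u * cnj (snd v))" for u v
    by (simp add: symp_def inner_prod_def inner_complex_def algebra_simps)
  have "?u1 * cnj ?v1 + ?u2 * cnj ?v2
      = (\<mu> * cnj \<nu> + cnj (\<mu> * cnj \<nu>)) * (a * cnj a + b * cnj b)"
    by (simp add: algebra_simps)
  also have "\<dots> = of_real (2 * Re (\<mu> * cnj \<nu>) * ((norm a)\<^sup>2 + (norm b)\<^sup>2))"
    unfolding complex_add_cnj complex_norm_square[symmetric] by simp
  finally have herm: "?u1 * cnj ?v1 + ?u2 * cnj ?v2 = of_real (2 * Re (\<mu> * cnj \<nu>) * ((norm a)\<^sup>2 + (norm b)\<^sup>2))" .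
  have "(k * ?u1) * cnj (k * ?v1) + (k * ?u2) * cnj (k * ?v2) = (k * cnj k) * (?u1 * cnj ?v1 + ?u2 * cnj ?v2)"
    unfolding complex_cnj_mult[of k] by (rule factor)
  also have "\<dots> = of_real ((norm k)\<^sup>2 * (2 * Re (\<mu> * cnj \<nu>) * ((norm a)\<^sup>2 + (norm b)\<^sup>2)))"
    unfolding herm complex_norm_square[symmetric] by (simp only: of_real_mult)
  finally have "Im ((k * ?u1) * cnj (k * ?v1) + (k * ?u2) * cnj (k * ?v2)) = 0"
    by (simp only: Im_complex_of_real)
  then show ?thesis unfolding sy rep_formula_def prod.case fst_conv snd_conv k_def[symmetric] by simp
qed

context surface
begin

text \<open>By the relation, \<open>v = a F\<^sub>2 - b F\<^sub>1\<close> is constant, so \<open>F\<close> takes values in a complex line, on which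
  \<open>u = cnj a F\<^sub>1 + cnj b F\<^sub>2\<close> is an affine coordinate. The induced metric is a constant multiple of
  \<open>\<bar>du\<bar>\<^sup>2\<close>, so completeness makes \<open>u\<close> surjective and the image of \<open>f\<close> is the whole plane.\<close>

lemma linear_relation_imp_plane:
  assumes rep: "represents X A \<beta> F f"
    and conn: "connected_space X" and ne: "topspace X \<noteq> {}"
    and complete: "complete_induced_metric X A f"
    and ab: "a \<noteq> 0 \<or> b \<noteq> 0"
    and rel: "\<And>c p. c \<in> A \<Longrightarrow> p \<in> fst c \<Longrightarrow> a * S1 c F p + b * S2 c F p = 0"
  shows "lagrangian_plane (f ` topspace X)"
proof -
  let ?F1 = "\<lambda>q. fst (F q)" and ?F2 = "\<lambda>q. snd (F q)"
  note h1 = represents_holo(1)[OF rep] and h2 = represents_holo(2)[OF rep] and S12 = S_eq_dv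
  define v where "v = (\<lambda>p. a * snd (F p) + (- b) * fst (F p))"
  define u where "u = (\<lambda>p. cnj a * fst (F p) + cnj b * snd (F p))"
  have hv: "holo v" and hu: "holo u"
    unfolding v_def u_def by (intro holo_combination h1 h2)+
  have dvv: "dv c v p = 0" if "c \<in> A" "p \<in> fst c" for c p
    using dv_combination[OF h2 h1 that, of a "- b"] rel[OF that] by (simp add: v_def S12)
  have dvu: "dv c u p = cnj a * dv c ?F1 p + cnj b * dv c ?F2 p" if "c \<in> A" "p \<in> fst c" for c p
    unfolding u_def by (rule dv_combination[OF h1 h2 that])
  define N where "N = (norm a)\<^sup>2 + (norm b)\<^sup>2"
  have N: "N > 0" using ab by (auto simp: N_def sum_power2_gt_zero_iff)
  have NC: "of_real N = a * cnj a + b * cnj b" unfolding N_def of_real_add complex_norm_square ..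
  obtain p0 where p0: "p0 \<in> topspace X" using ne by blast
  have vc: "v p = v p0" if "p \<in> topspace X" for p
    by (rule holo_const_if_dv_zero[OF conn hv dvv that p0])
  interpret metric_surface X A f "density F"
    by (rule represents_metric[OF rep])
  have iso: "density F c p = (1 / sqrt N) * norm (dv c u p)"
    if cp: "c \<in> A" "p \<in> fst c" for c p
  proof -
    let ?s = "dv c ?F1 p" and ?t = "dv c ?F2 p"
    have r: "a * ?t - b * ?s = 0" using rel[OF cp] by (simp add: S12)
    have "of_real ((norm (dv c u p))\<^sup>2) = of_real (N * ((norm ?t)\<^sup>2 + (norm ?s)\<^sup>2)) - (a * ?t - b * ?s) * cnj (a * ?t - b * ?s)"
      unfolding dvu[OF cp] of_real_mult NC of_real_add complex_norm_square by (simp add: algebra_simps)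
    then have "(norm (dv c u p))\<^sup>2 = N * ((norm ?t)\<^sup>2 + (norm ?s)\<^sup>2)"
      unfolding r by (simp only: mult_zero_left diff_zero of_real_eq_iff)
    then have "norm (dv c u p) = sqrt N * sqrt ((norm ?t)\<^sup>2 + (norm ?s)\<^sup>2)"
      by (metis norm_ge_zero real_sqrt_abs real_sqrt_mult abs_of_nonneg)
    then show ?thesis using N by (simp add: S12)
  qed
  have surj: "u ` topspace X = UNIV"
    by (rule isometric_coordinate_surj[OF conn complete ne hu, of "1 / sqrt N"]) (use N iso in auto)
  define \<Lambda> where "\<Lambda> = (\<lambda>\<zeta>. rep_formula \<beta> ((\<zeta> / of_real N) * a, (\<zeta> / of_real N) * b))"
  define w0 where "w0 = rep_formula \<beta> (- cnj b * v p0 / of_real N, cnj a * v p0 / of_real N)"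
  have Nnz: "complex_of_real N \<noteq> 0" using N by simp
  have fp: "f p = w0 + \<Lambda> (u p)" if p: "p \<in> topspace X" for p
  proof -
    have "a * u p - cnj b * v p = of_real N * fst (F p)" "b * u p + cnj a * v p = of_real N * snd (F p)"
      unfolding NC by (simp_all add: u_def v_def algebra_simps)
    then have "fst (F p) = (a * u p - cnj b * v p) / of_real N" "snd (F p) = (b * u p + cnj a * v p) / of_real N"
      using Nnz by simp_all
    then have Fp: "F p = (- cnj b * v p0 / of_real N, cnj a * v p0 / of_real N) + ((u p / of_real N) * a, (u p / of_real N) * b)"
      unfolding vc[OF p] by (simp add: prod_eq_iff add_divide_distrib diff_divide_distrib mult.commute)
    have "rep_formula \<beta> (F p) = w0 + \<Lambda> (u p)"
      unfolding w0_def \<Lambda>_def Fp by (rule linear_add[OF linear_rep_formula])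
    then show ?thesis using rep p by (simp add: represents_def)
  qed
  have lin: "linear \<Lambda>"
  proof -
    have "linear (\<lambda>\<zeta>. ((\<zeta> / of_real N) * a, (\<zeta> / of_real N) * b))"
      by (rule linearI) (auto simp: scaleR_conv_of_real algebra_simps add_divide_distrib)
    from linear_compose[OF this linear_rep_formula] show ?thesis by (simp add: \<Lambda>_def o_def)
  qed
  have inj: "inj \<Lambda>"
  proof (rule injI)
    fix x y assume "\<Lambda> x = \<Lambda> y"
    then have "((x / of_real N) * a, (x / of_real N) * b) = ((y / of_real N) * a, (y / of_real N) * b)"
      unfolding \<Lambda>_def by (rule injD[OF inj_rep_formula])
    then show "x = y" using ab Nnz by auto
  qed
  have "f ` topspace X = (\<lambda>p. w0 + \<Lambda> (u p)) ` topspace X" by (rule image_cong) (use fp in auto)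
  also have "\<dots> = (\<lambda>v. w0 + v) ` range \<Lambda>" unfolding surj[symmetric] by (simp add: image_image)
  finally have img: "f ` topspace X = (\<lambda>v. w0 + v) ` range \<Lambda>" .
  have "subspace (range \<Lambda>)" by (rule linear_subspace_image[OF lin subspace_UNIV])
  moreover have "dim (range \<Lambda>) = 2"
    using dim_image_eq[OF lin, of UNIV] inj by simp
  moreover have "\<forall>x\<in>range \<Lambda>. \<forall>y\<in>range \<Lambda>. symp x y = 0"
    unfolding \<Lambda>_def using symp_rep_formula by blast
  ultimately show ?thesis unfolding lagrangian_plane_def using img by blast
qed

text \<open>The omitted values are given by linear forms in \<open>(S\<^sub>1, S\<^sub>2)\<close> without zeros. The first form serves as
  \<open>dP\<close>, which moves the corresponding omitted value to \<open>\<infinity>\<close>; the others say that the quotient \<open>G\<close> of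
  the two forms omits \<open>b\<^sub>1\<close>, \<open>b\<^sub>2\<close> and \<open>b\<^sub>3\<close>. Constancy of \<open>G\<close> is a linear relation between \<open>S\<^sub>1\<close> and
  \<open>S\<^sub>2\<close>.\<close>

lemma four_omitted_imp_plane:
  assumes rep: "represents X A \<beta> F f"
    and conn: "connected_space X" and ne: "topspace X \<noteq> {}"
    and complete: "complete_induced_metric X A f"
    and det: "p1 * q2 - p2 * q1 \<noteq> 0"
    and nz: "\<And>c p. c \<in> A \<Longrightarrow> p \<in> fst c \<Longrightarrow> p1 * S1 c F p + q1 * S2 c F p \<noteq> 0"
    and b: "b1 \<noteq> b2" "b1 \<noteq> b3" "b2 \<noteq> b3"
    and om: "\<And>c p x. c \<in> A \<Longrightarrow> p \<in> fst c \<Longrightarrow> x \<in> {b1, b2, b3} \<Longrightarrow>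
       p2 * S1 c F p + q2 * S2 c F p \<noteq> x * (p1 * S1 c F p + q1 * S2 c F p)"
  shows "lagrangian_plane (f ` topspace X)"
proof -
  let ?F1 = "\<lambda>q. fst (F q)" and ?F2 = "\<lambda>q. snd (F q)"
  note h1 = represents_holo(1)[OF rep] and h2 = represents_holo(2)[OF rep] and S12 = S_eq_dv
  define P where "P = (\<lambda>p. p1 * snd (F p) + (- q1) * fst (F p))"
  define T where "T = (\<lambda>p. p2 * snd (F p) + (- q2) * fst (F p))"
  have hP: "holo P" and hT: "holo T"
    unfolding P_def T_def by (intro holo_combination h1 h2)+
  have dP: "dv c P p = p1 * S1 c F p + q1 * S2 c F p" if "c \<in> A" "p \<in> fst c" for c p
    unfolding P_def using dv_combination[OF h2 h1 that, of p1 "- q1"] by (simp add: S12)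
  have dT: "dv c T p = p2 * S1 c F p + q2 * S2 c F p" if "c \<in> A" "p \<in> fst c" for c p
    unfolding T_def using dv_combination[OF h2 h1 that, of p2 "- q2"] by (simp add: S12)
  have nzP: "dv c P p \<noteq> 0" if "c \<in> A" "p \<in> fst c" for c p using nz[OF that] dP[OF that] by simp
  obtain G where G: "holo G" "\<And>c p. c \<in> A \<Longrightarrow> p \<in> fst c \<Longrightarrow> dv c T p = G p * dv c P p"
    by (rule quotient_function[OF hP hT nzP], assumption+) (rule that)
  have omG: "G p \<noteq> b1 \<and> G p \<noteq> b2 \<and> G p \<noteq> b3" if p: "p \<in> topspace X" for p
  proof -
    obtain c where c: "c \<in> A" "p \<in> fst c" using chart_at[OF p] .
    have "G p \<noteq> x" if "x \<in> {b1, b2, b3}" for x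
      using om[OF c that] G(2)[OF c] dP[OF c] dT[OF c] by auto
    then show ?thesis by simp
  qed
  interpret metric_surface X A f "density F"
    by (rule represents_metric[OF rep])
  define \<delta> where "\<delta> = p1 * q2 - p2 * q1"
  define C1 where "C1 = (norm p1 + norm q1 + norm p2 + norm q2) / norm \<delta>"
  have \<delta>: "\<delta> \<noteq> 0" using det by (simp add: \<delta>_def)
  have mu: "density F c p \<le> C1 * (1 + norm (G p)) * norm (dv c P p)"
    if cp: "c \<in> A" "p \<in> fst c" for c p
  proof -
    let ?s = "S1 c F p" and ?t = "S2 c F p" and ?w = "dv c P p"
    have "\<delta> * ?s = (q2 - q1 * G p) * ?w" "\<delta> * ?t = (p1 * G p - p2) * ?w"
    proof -
      have "q2 * dv c P p - q1 * dv c T p = \<delta> * ?s" "p1 * dv c T p - p2 * dv c P p = \<delta> * ?t"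
        unfolding dP[OF cp] dT[OF cp] \<delta>_def by (simp_all add: algebra_simps)
      then show "\<delta> * ?s = (q2 - q1 * G p) * ?w" "\<delta> * ?t = (p1 * G p - p2) * ?w"
        unfolding G(2)[OF cp] by (simp_all add: algebra_simps)
    qed
    then have e: "norm \<delta> * norm ?s = norm (q2 - q1 * G p) * norm ?w" "norm \<delta> * norm ?t = norm (p1 * G p - p2) * norm ?w"
      by (metis norm_mult)+
    have n: "norm (q2 - q1 * G p) \<le> norm q2 + norm q1 * norm (G p)" "norm (p1 * G p - p2) \<le> norm p1 * norm (G p) + norm p2"
      using norm_triangle_ineq4[of q2 "q1 * G p"] norm_triangle_ineq4[of "p1 * G p" p2] by (simp_all add: norm_mult)
    have "norm \<delta> * (norm ?s + norm ?t) = (norm (q2 - q1 * G p) + norm (p1 * G p - p2)) * norm ?w"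
      using e by (simp add: algebra_simps)
    also have "\<dots> \<le> ((norm p1 + norm q1 + norm p2 + norm q2) * (1 + norm (G p))) * norm ?w"
    proof (rule mult_right_mono)
      have "0 \<le> norm p2 * norm (G p)" "0 \<le> norm q2 * norm (G p)" "0 \<le> norm p1" "0 \<le> norm q1"
        by simp_all
      then show "norm (q2 - q1 * G p) + norm (p1 * G p - p2) \<le> (norm p1 + norm q1 + norm p2 + norm q2) * (1 + norm (G p))"
        using n by (simp only: distrib_left distrib_right mult_1_right mult_1_left)
    qed simp
    finally have "norm ?s + norm ?t \<le> C1 * (1 + norm (G p)) * norm ?w"
      using \<delta> by (simp add: C1_def field_simps)
    moreover have "sqrt ((norm ?s)\<^sup>2 + (norm ?t)\<^sup>2) \<le> norm ?s + norm ?t"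
      by (rule sqrt_sum_squares_le_sum) auto
    ultimately show ?thesis by linarith
  qed
  have dG: "dv c G p = 0" if "c \<in> A" "p \<in> fst c" for c p
    by (rule omitting_three_values_constant[OF conn complete hP G(1) nzP mu b omG that])
  obtain p0 where p0: "p0 \<in> topspace X" using ne by blast
  define g0 where "g0 = G p0"
  have Gc: "G p = g0" if "p \<in> topspace X" for p
    unfolding g0_def by (rule holo_const_if_dv_zero[OF conn G(1) dG that p0])
  show ?thesis
  proof (rule linear_relation_imp_plane[OF rep conn ne complete])
    show "p2 - g0 * p1 \<noteq> 0 \<or> q2 - g0 * q1 \<noteq> 0"
      using det by (auto simp: algebra_simps)
    fix c p assume cp: "c \<in> A" "p \<in> fst c"
    have "p \<in> topspace X" using cp chart_subset by blast
    then have "dv c T p = g0 * dv c P p" using G(2)[OF cp] Gc by simp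
    then show "(p2 - g0 * p1) * S1 c F p + (q2 - g0 * q1) * S2 c F p = 0"
      unfolding dP[OF cp] dT[OF cp] by (simp add: algebra_simps)
  qed
qed

end

text \<open>At most one of four values is \<open>\<infinity>\<close>; it is chosen as \<open>v\<close> if it occurs.\<close>

lemma four_values:
  fixes W :: "complex option set"
  assumes "\<not> (finite W \<and> card W \<le> 3)"
  obtains v a1 a2 a3 where "{v, Some a1, Some a2, Some a3} \<subseteq> W" "a1 \<noteq> a2" "a1 \<noteq> a3" "a2 \<noteq> a3"
    "v \<notin> {Some a1, Some a2, Some a3}"
proof -
  obtain T where T: "T \<subseteq> W" "finite T" "card T = 4"
  proof (cases "finite W")
    case True
    then have "4 \<le> card W" using assms by simp
    then show ?thesis using obtain_subset_with_card_n that by metis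
  next
    case False
    then show ?thesis using infinite_arbitrarily_large that by metis
  qed
  obtain v where v: "v \<in> T" "None \<notin> T - {v}"
  proof (cases "None \<in> T")
    case True then show ?thesis using that[of None] by simp
  next
    case False
    moreover obtain v where "v \<in> T" using T by fastforce
    ultimately show ?thesis using that[of v] by simp
  qed
  have "card (T - {v}) = 3" using T v by simp
  then obtain x y z where xyz: "T - {v} = {x, y, z}" "x \<noteq> y" "x \<noteq> z" "y \<noteq> z"
    unfolding card_3_iff by blast
  then have "x \<noteq> None" "y \<noteq> None" "z \<noteq> None" using v(2) by auto
  then obtain a1 a2 a3 where a: "x = Some a1" "y = Some a2" "z = Some a3" by auto
  show ?thesis
  proof (rule that[of v a1 a2 a3])
    show "{v, Some a1, Some a2, Some a3} \<subseteq> W" "v \<notin> {Some a1, Some a2, Some a3}"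
      using xyz(1) T(1) v(1) unfolding a by blast+
  qed (use xyz a in auto)
qed

theorem corollary3p3:
  fixes X :: "'a topology" and A :: "'a chart set" and f :: "'a \<Rightarrow> complex \<times> complex"
  assumes "riemann_surface X A"
    and "connected_space X"
    and "topspace X \<noteq> {}"
    and "conformal_minimal_lagrangian_immersion A f"
    and "complete_induced_metric X A f"
    and "\<not> lagrangian_plane (f ` topspace X)"
  shows "finite (omitted_values (topspace X) (\<lambda>p. fst (gauss_map X A f p))) \<and>
         card (omitted_values (topspace X) (\<lambda>p. fst (gauss_map X A f p))) \<le> 3"
proof (rule ccontr)
  interpret surface X A by unfold_locales (rule assms(1))
  assume many: "\<not> ?thesis"
  obtain v a1 a2 a3 where
    W: "{v, Some a1, Some a2, Some a3} \<subseteq> omitted_values (topspace X) (\<lambda>p. fst (gauss_map X A f p))"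
    and a: "a1 \<noteq> a2" "a1 \<noteq> a3" "a2 \<noteq> a3" and va: "v \<notin> {Some a1, Some a2, Some a3}"
    by (rule four_values[OF many], rule that)
  obtain \<beta> F where rep: "represents X A \<beta> F f"
    and g: "\<And>c p. c \<in> A \<Longrightarrow> p \<in> fst c \<Longrightarrow> fst (gauss_map X A f p) = sphere_quotient (- S2 c F p) (S1 c F p)"
    by (rule gauss_map_first[OF assms(4,2,3)], rule that)
  have om: "sphere_quotient (- S2 c F p) (S1 c F p) \<noteq> w"
    if "w \<in> {v, Some a1, Some a2, Some a3}" "c \<in> A" "p \<in> fst c" for w c p
    using W that g[OF that(2,3)] chart_subset[OF that(2)] unfolding omitted_values_def by blast
  have S: "S1 c F p \<noteq> 0 \<or> S2 c F p \<noteq> 0" if "c \<in> A" "p \<in> fst c" for c p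
    using rep that by (fastforce simp: represents_def)
  have some: "S2 c F p + x * S1 c F p \<noteq> 0"
    if "Some x \<in> {v, Some a1, Some a2, Some a3}" "c \<in> A" "p \<in> fst c" for x c p
  proof
    assume "S2 c F p + x * S1 c F p = 0"
    then have S2: "S2 c F p = - (x * S1 c F p)" by (simp add: eq_neg_iff_add_eq_0)
    then have "S1 c F p \<noteq> 0" using S[OF that(2,3)] by auto
    then show False using om[OF that] by (simp add: sphere_quotient_def S2)
  qed
  have fin: "S2 c F p + x * S1 c F p \<noteq> 0" if "x \<in> {a1, a2, a3}" "c \<in> A" "p \<in> fst c" for x c p
    by (rule some[OF _ that(2,3)]) (use that(1) in auto)
  have "lagrangian_plane (f ` topspace X)"
  proof (cases v)
    case None
    show ?thesis
    \<comment> \<open>here G = g\<close>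
    proof (rule four_omitted_imp_plane[OF rep assms(2,3,5), of 1 "- 1" 0 0 a1 a2 a3])
      show "1 * S1 c F p + 0 * S2 c F p \<noteq> 0" if "c \<in> A" "p \<in> fst c" for c p
        using om[OF _ that, of v] None by (auto simp: sphere_quotient_def)
      show "0 * S1 c F p + - 1 * S2 c F p \<noteq> x * (1 * S1 c F p + 0 * S2 c F p)"
        if "c \<in> A" "p \<in> fst c" "x \<in> {a1, a2, a3}" for c p x
      proof
        assume "0 * S1 c F p + - 1 * S2 c F p = x * (1 * S1 c F p + 0 * S2 c F p)"
        then have "- S2 c F p = x * S1 c F p" by simp
        then have "S2 c F p + x * S1 c F p = 0" by (metis add.right_inverse)
        then show False using fin[OF that(3,1,2)] by simp
      qed
    qed (use a in auto)
  next
    case (Some a0)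
    have a0: "a0 - x \<noteq> 0" if "x \<in> {a1, a2, a3}" for x using va Some that by auto
    show ?thesis
    \<comment> \<open>here G = 1 / (a0 - g)\<close>
    proof (rule four_omitted_imp_plane[OF rep assms(2,3,5), of a0 0 1 1 "1 / (a0 - a1)" "1 / (a0 - a2)" "1 / (a0 - a3)"])
      show "a0 * S1 c F p + 1 * S2 c F p \<noteq> 0" if "c \<in> A" "p \<in> fst c" for c p
        using some[OF _ that, of a0] Some by (simp add: add.commute)
      show "1 * S1 c F p + 0 * S2 c F p \<noteq> y * (a0 * S1 c F p + 1 * S2 c F p)"
        if cp: "c \<in> A" "p \<in> fst c" and y: "y \<in> {1 / (a0 - a1), 1 / (a0 - a2), 1 / (a0 - a3)}" for c p y
      proof
        obtain x where x: "x \<in> {a1, a2, a3}" "y = 1 / (a0 - x)" using y by auto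
        assume "1 * S1 c F p + 0 * S2 c F p = y * (a0 * S1 c F p + 1 * S2 c F p)"
        then have "(a0 - x) * S1 c F p = a0 * S1 c F p + S2 c F p"
          using a0[OF x(1)] by (simp add: x(2) field_simps)
        then have "S2 c F p + x * S1 c F p = 0" by (simp add: algebra_simps)
        then show False using fin[OF x(1) cp] by simp
      qed
      show "1 / (a0 - a1) \<noteq> 1 / (a0 - a2)" "1 / (a0 - a1) \<noteq> 1 / (a0 - a3)" "1 / (a0 - a2) \<noteq> 1 / (a0 - a3)"
        using a a0 by (auto simp: field_simps)
    qed auto
  qed
  then show False using assms(6) by blast
qed

end
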